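(* Let $f:\mathbb{C}\to\overline{\mathbb{C}}$ be a transcendental meromorphic function or let $f:\overline{\mathbb{C}}\to\overline{\mathbb{C}}$ be a rational map of degree $\geq 2$. Suppose $z\in \mathcal{J}(f)\setminus \mathcal{P}(f)$. Then $z$ is contained in a simply connected nice set $U_z$ of arbitrarily small diameter satisfying $\mathrm{dist}(U_z,\mathcal{P}(f))>0$; that is, for every $\varepsilon>0$ there is a simply connected nice set $U_z\ni z$ with diameter less than $\varepsilon$ and $\mathrm{dist}(U_z,\mathcal{P}(f))>0$.
   Context: Distances and diameters are taken in the spherical metric on $\overline{\mathbb{C}}$. The Fatou set of $f$ is the set of points having a neighbourhood on which all iterates of $f$ are well-defined and form a normal family; the Julia set $\mathcal{J}(f)$ is the complement of the Fatou set in $\overline{\mathbb{C}}$. For $z\in\overline{\mathbb{C}}$, $\mathrm{Orb}(z):=\{f^i(z): i\geq 0 \text{ and } f^i(z) \text{ is defined}\}$, and $\mathrm{Orb}(A):=\bigcup_{z\in A}\mathrm{Orb}(z)$ for a set $A$. $S(f)\subset\overline{\mathbb{C}}$ is the set of singular values of $f$: a point $z$ belongs to $\overline{\mathbb{C}}\setminus S(f)$ if and only if there is a neighbourhood of $z$ on which all inverse branches of $f$ are well-defined univalent maps. The post-singular set is $\mathcal{P}(f):=\overline{\mathrm{Orb}(S(f))}$. An open set $U$ is called nice if $f^n(\partial U)\cap U=\emptyset$ for all $n>0$ (where $f^n(\partial U)$ denotes the set of images of those points of $\partial U$ at which $f^n$ is defined). *)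

theory Defs
  imports "HOL-Complex_Analysis.Complex_Analysis"
begin

section \<open>The Riemann sphere with the spherical metric\<close>

datatype riemann_sphere = Fin complex | Infty

text \<open>Inverse stereographic projection from the north pole onto the unit sphere of
  \<^typ>\<open>complex \<times> real\<close>, i.e. of Euclidean 3-space.\<close>

fun stereo :: "riemann_sphere \<Rightarrow> complex \<times> real" where
  "stereo (Fin z) = ((2 / (1 + (cmod z)\<^sup>2)) *\<^sub>R z, ((cmod z)\<^sup>2 - 1) / (1 + (cmod z)\<^sup>2))"
| "stereo Infty = (0, 1)"

lemma inner_stereo_self: "stereo x \<bullet> stereo x = 1"
proof (cases x)
  case (Fin z)
  define t where "t = (cmod z)\<^sup>2"
  have t: "1 + t > 0" by (simp add: t_def add_pos_nonneg)
  have "stereo x \<bullet> stereo x = (2 / (1 + t))\<^sup>2 * t + ((t - 1) / (1 + t))\<^sup>2"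
    by (simp add: Fin inner_prod_def t_def power2_eq_square dot_square_norm)
  also have "\<dots> = (4 * t + (t - 1)\<^sup>2) / (1 + t)\<^sup>2"
    by (simp add: power_divide add_divide_distrib)
  also have "4 * t + (t - 1)\<^sup>2 = (1 + t)\<^sup>2"
    by (simp add: power2_eq_square algebra_simps)
  finally show ?thesis using t by simp
qed (simp add: inner_prod_def)

lemma norm_stereo [simp]: "norm (stereo x) = 1"
  by (simp add: norm_eq_sqrt_inner inner_stereo_self)

lemma inj_stereo: "inj stereo"
proof (rule injI)
  fix x y assume eq: "stereo x = stereo y"
  have pos: "1 + (cmod z)\<^sup>2 > 0" for z :: complex
    by (simp add: add_pos_nonneg)
  have snd_Fin: "snd (stereo (Fin z)) = 1 - 2 / (1 + (cmod z)\<^sup>2)" for z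
    using pos[of z] by (simp add: field_simps)
  have ne: "stereo (Fin z) \<noteq> stereo Infty" for z
  proof
    assume "stereo (Fin z) = stereo Infty"
    then have "snd (stereo (Fin z)) = snd (stereo Infty)" by simp
    then show False using snd_Fin[of z] pos[of z] by simp
  qed
  show "x = y"
  proof (cases x)
    case x: (Fin z)
    show ?thesis
    proof (cases y)
      case y: (Fin w)
      have "2 / (1 + (cmod z)\<^sup>2) = 2 / (1 + (cmod w)\<^sup>2)"
        using snd_Fin[of z] snd_Fin[of w] eq x y by simp
      moreover have "fst (stereo x) = fst (stereo y)" using eq by simp
      ultimately have "z = w" using x y pos[of w] by simp
      then show ?thesis using x y by simp
    next
      case Infty
      then show ?thesis using ne[of z] eq x by simp
    qed
  next
    case x: Infty
    then show ?thesis using ne eq by (cases y) (force simp del: stereo.simps)+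
  qed
qed

text \<open>Spherical triangle inequality: angles between unit vectors.\<close>

lemma arccos_inner_triangle:
  fixes a b c :: "'a::real_inner"
  assumes [simp]: "norm a = 1" "norm b = 1" "norm c = 1"
  shows "arccos (a \<bullet> c) \<le> arccos (a \<bullet> b) + arccos (b \<bullet> c)"
proof -
  have bnd: "\<bar>x \<bullet> y\<bar> \<le> 1" if "norm x = 1" "norm y = 1" for x y :: 'a
    using Cauchy_Schwarz_ineq2[of x y] that by simp
  define \<alpha> \<beta> where "\<alpha> = arccos (a \<bullet> b)" and "\<beta> = arccos (b \<bullet> c)"
  have ab: "\<bar>a \<bullet> b\<bar> \<le> 1" and bc: "\<bar>b \<bullet> c\<bar> \<le> 1" and ac: "\<bar>a \<bullet> c\<bar> \<le> 1"
    by (auto intro: bnd)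
  have range: "0 \<le> \<alpha>" "\<alpha> \<le> pi" "0 \<le> \<beta>" "\<beta> \<le> pi"
    using ab bc by (auto simp: \<alpha>_def \<beta>_def intro!: arccos_lbound arccos_ubound)
  have cs: "cos \<alpha> = a \<bullet> b" "cos \<beta> = b \<bullet> c"
    using ab bc by (auto simp: \<alpha>_def \<beta>_def cos_arccos_abs)
  show ?thesis
  proof (cases "\<alpha> + \<beta> \<le> pi")
    case True
    define u v where "u = a - (a \<bullet> b) *\<^sub>R b" and "v = c - (b \<bullet> c) *\<^sub>R b"
    have self: "a \<bullet> a = 1" "b \<bullet> b = 1" "c \<bullet> c = 1"
      by (simp_all add: dot_square_norm)
    have uv: "u \<bullet> v = a \<bullet> c - cos \<alpha> * cos \<beta>"
      by (simp add: u_def v_def cs inner_diff_left inner_diff_right self inner_commute)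
    have "(norm u)\<^sup>2 = 1 - (cos \<alpha>)\<^sup>2"
      unfolding power2_norm_eq_inner
      by (simp add: u_def cs inner_diff_left inner_diff_right self inner_commute
          power2_eq_square)
    then have "(norm u)\<^sup>2 = (sin \<alpha>)\<^sup>2" by (simp add: sin_squared_eq)
    then have nu: "norm u = sin \<alpha>"
      using range by (simp add: sin_ge_zero)
    have "(norm v)\<^sup>2 = 1 - (cos \<beta>)\<^sup>2"
      unfolding power2_norm_eq_inner
      by (simp add: v_def cs inner_diff_left inner_diff_right self inner_commute
          power2_eq_square)
    then have "(norm v)\<^sup>2 = (sin \<beta>)\<^sup>2" by (simp add: sin_squared_eq)
    then have nv: "norm v = sin \<beta>"
      using range by (simp add: sin_ge_zero)
    have "- (sin \<alpha> * sin \<beta>) \<le> u \<bullet> v"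
      using Cauchy_Schwarz_ineq2[of u v] by (simp add: nu nv abs_le_iff)
    then have "cos (\<alpha> + \<beta>) \<le> a \<bullet> c" by (simp add: uv cos_add)
    then have "arccos (a \<bullet> c) \<le> arccos (cos (\<alpha> + \<beta>))"
      using ac by (intro arccos_le_arccos) auto
    also have "\<dots> = \<alpha> + \<beta>" using range True by (simp add: arccos_cos)
    finally show ?thesis by (simp add: \<alpha>_def \<beta>_def)
  next
    case False
    have "arccos (a \<bullet> c) \<le> pi" using ac by (intro arccos_ubound) auto
    then show ?thesis using False by (simp add: \<alpha>_def \<beta>_def)
  qed
qed

text \<open>The spherical metric is the great-circle distance on the unit sphere, i.e. the
  path metric of \<open>2 |dz| / (1 + |z|\<^sup>2)\<close>; the topology is the one it induces.\<close>

instantiation riemann_sphere :: metric_space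
begin

definition dist_riemann_sphere :: "riemann_sphere \<Rightarrow> riemann_sphere \<Rightarrow> real" where
  "dist x y = arccos (stereo x \<bullet> stereo y)"

definition uniformity_riemann_sphere :: "(riemann_sphere \<times> riemann_sphere) filter" where
  "(uniformity :: (riemann_sphere \<times> riemann_sphere) filter) =
     (INF e\<in>{0 <..}. principal {(x, y). dist x y < e})"

definition open_riemann_sphere :: "riemann_sphere set \<Rightarrow> bool" where
  "open (U :: riemann_sphere set) \<longleftrightarrow> (\<forall>x\<in>U. eventually (\<lambda>(x', y). x' = x \<longrightarrow> y \<in> U) uniformity)"

instance
proof
  fix x y z :: riemann_sphere
  have bnd: "\<bar>stereo x \<bullet> stereo y\<bar> \<le> 1"
    using Cauchy_Schwarz_ineq2[of "stereo x" "stereo y"] by simp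
  show "dist x y = 0 \<longleftrightarrow> x = y"
  proof
    assume "dist x y = 0"
    then have "stereo x \<bullet> stereo y = 1"
      using cos_arccos_abs[OF bnd] by (simp add: dist_riemann_sphere_def)
    then have "(norm (stereo x - stereo y))\<^sup>2 = 0"
      by (simp add: power2_norm_eq_inner inner_diff_left inner_diff_right inner_stereo_self
          inner_commute)
    then show "x = y" using inj_stereo by (simp add: inj_eq)
  qed (simp add: dist_riemann_sphere_def inner_stereo_self)
  show "dist x y \<le> dist x z + dist y z"
    using arccos_inner_triangle[of "stereo x" "stereo z" "stereo y"]
    by (simp add: dist_riemann_sphere_def inner_commute)
qed (simp_all add: uniformity_riemann_sphere_def open_riemann_sphere_def)

end

text \<open>\<^const>\<open>setdist\<close> is \<open>0\<close> when one of the sets is empty; here the infimum over the empty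
  set is \<open>\<infinity>\<close>.\<close>

definition set_dist :: "'a::metric_space set \<Rightarrow> 'a set \<Rightarrow> ereal" where
  "set_dist A B = (INF a\<in>A. INF b\<in>B. ereal (dist a b))"


section \<open>Holomorphic maps\<close>

fun sphere_inverse :: "riemann_sphere \<Rightarrow> riemann_sphere" where
  "sphere_inverse Infty = Fin 0"
| "sphere_inverse (Fin w) = (if w = 0 then Infty else Fin (inverse w))"

fun fin_part :: "riemann_sphere \<Rightarrow> complex" where
  "fin_part (Fin w) = w"
| "fin_part Infty = 0"

text \<open>Holomorphy of a map from an open subset of the sphere to the sphere, read in the charts
  \<open>w\<close> and \<open>1/w\<close> (\<open>A\<close> selects the chart in the source, \<open>B\<close> the one in the target).\<close>

definition sphere_holomorphic_on :: "(riemann_sphere \<Rightarrow> riemann_sphere) \<Rightarrow> riemann_sphere set \<Rightarrow> bool"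
  (infixl "sphere'_holomorphic'_on" 50) where
  "h sphere_holomorphic_on V \<longleftrightarrow> continuous_on V h \<and>
     (\<forall>A \<in> {id, sphere_inverse}. \<forall>B \<in> {id, sphere_inverse}.
        (\<lambda>w. fin_part (B (h (A (Fin w))))) holomorphic_on
          {w. A (Fin w) \<in> V \<and> B (h (A (Fin w))) \<noteq> Infty})"

definition univalent_on :: "(riemann_sphere \<Rightarrow> riemann_sphere) \<Rightarrow> riemann_sphere set \<Rightarrow> bool" where
  "univalent_on h V \<longleftrightarrow> h sphere_holomorphic_on V \<and> inj_on h V"


section \<open>Transcendental meromorphic functions and rational maps\<close>

text \<open>Functions from a subset of the sphere to the sphere are partial maps; \<^const>\<open>None\<close> means
  undefined. A transcendental meromorphic function is undefined exactly at \<^const>\<open>Infty\<close>;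
  a rational map is defined everywhere.\<close>

type_synonym sphere_map = "riemann_sphere \<Rightarrow> riemann_sphere option"

definition rational_function :: "(complex \<Rightarrow> complex) \<Rightarrow> bool" where
  "rational_function g \<longleftrightarrow>
     (\<exists>p q :: complex poly. q \<noteq> 0 \<and> (\<forall>z. poly q z \<noteq> 0 \<longrightarrow> g z = poly p z / poly q z))"

fun meromorphic_map :: "(complex \<Rightarrow> complex) \<Rightarrow> sphere_map" where
  "meromorphic_map g (Fin z) = Some (if is_pole g z then Infty else Fin (g z))"
| "meromorphic_map g Infty = None"

definition transcendental_meromorphic :: "sphere_map \<Rightarrow> bool" where
  "transcendental_meromorphic f \<longleftrightarrow>
     (\<exists>g. g nicely_meromorphic_on UNIV \<and> \<not> rational_function g \<and> f = meromorphic_map g)"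

text \<open>The map \<open>p/q\<close> for coprime \<open>p\<close> and \<open>q\<close>. With \<open>d\<close> the larger of the two degrees, its value
  at infinity is the ratio of the coefficients of \<open>z\<^sup>d\<close>, which do not both vanish.\<close>

fun quotient_map :: "complex poly \<Rightarrow> complex poly \<Rightarrow> sphere_map" where
  "quotient_map p q (Fin z) =
     Some (if poly q z = 0 then Infty else Fin (poly p z / poly q z))"
| "quotient_map p q Infty =
     (let d = max (degree p) (degree q)
      in Some (if coeff q d = 0 then Infty else Fin (coeff p d / coeff q d)))"

definition rational_map_of_degree :: "nat \<Rightarrow> sphere_map \<Rightarrow> bool" where
  "rational_map_of_degree d f \<longleftrightarrow>
     (\<exists>p q. q \<noteq> 0 \<and> coprime p q \<and> d = max (degree p) (degree q) \<and> f = quotient_map p q)"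


section \<open>Iteration, Fatou and Julia sets\<close>

primrec iter :: "sphere_map \<Rightarrow> nat \<Rightarrow> sphere_map" where
  "iter f 0 z = Some z"
| "iter f (Suc n) z = Option.bind (iter f n z) f"

definition normal_family_on ::
  "riemann_sphere set \<Rightarrow> (riemann_sphere \<Rightarrow> riemann_sphere) set \<Rightarrow> bool" where
  "normal_family_on V F \<longleftrightarrow>
     (\<forall>s :: nat \<Rightarrow> _. range s \<subseteq> F \<longrightarrow>
        (\<exists>r l. strict_mono r \<and>
           (\<forall>K. compact K \<and> K \<subseteq> V \<longrightarrow> uniform_limit K (\<lambda>n. s (r n)) l sequentially)))"

definition fatou_set :: "sphere_map \<Rightarrow> riemann_sphere set" where
  "fatou_set f = {z. \<exists>V. open V \<and> z \<in> V \<and> (\<forall>n. \<forall>w\<in>V. iter f n w \<noteq> None) \<and>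
                      normal_family_on V (range (\<lambda>n w. the (iter f n w)))}"

definition julia_set :: "sphere_map \<Rightarrow> riemann_sphere set" where
  "julia_set f = - fatou_set f"


section \<open>Singular values and the post-singular set\<close>

definition orb :: "sphere_map \<Rightarrow> riemann_sphere \<Rightarrow> riemann_sphere set" where
  "orb f z = {w. \<exists>i. iter f i z = Some w}"

definition orb_set :: "sphere_map \<Rightarrow> riemann_sphere set \<Rightarrow> riemann_sphere set" where
  "orb_set f A = (\<Union>z\<in>A. orb f z)"

text \<open>All inverse branches are well-defined univalent maps on \<open>V\<close>: through every preimage \<open>w\<close> of
  a point of \<open>V\<close> there passes a univalent branch of the inverse defined on all of \<open>V\<close>.
  Points \<open>w\<close> in the domain that are critical, and branches that cannot be continued to a point
  of \<open>V\<close> (asymptotic values), violate this.\<close>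

definition inverse_branches_univalent_on :: "sphere_map \<Rightarrow> riemann_sphere set \<Rightarrow> bool" where
  "inverse_branches_univalent_on f V \<longleftrightarrow>
     (\<forall>w. \<forall>v\<in>V. f w = Some v \<longrightarrow>
        (\<exists>\<phi>. univalent_on \<phi> V \<and> (\<forall>u\<in>V. f (\<phi> u) = Some u) \<and> \<phi> v = w))"

definition singular_values :: "sphere_map \<Rightarrow> riemann_sphere set" where
  "singular_values f = - {z. \<exists>V. open V \<and> z \<in> V \<and> inverse_branches_univalent_on f V}"

definition postsingular_set :: "sphere_map \<Rightarrow> riemann_sphere set" where
  "postsingular_set f = closure (orb_set f (singular_values f))"


section \<open>Nice sets\<close>

definition nice :: "sphere_map \<Rightarrow> riemann_sphere set \<Rightarrow> bool" where
  "nice f U \<longleftrightarrow> open U \<and>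
     (\<forall>n>0. {v. \<exists>w \<in> frontier U. iter f n w = Some v} \<inter> U = {})"

end

theory Submission
  imports Defs "HOL-Computational_Algebra.Fundamental_Theorem_Algebra"
begin

text \<open>Rivera-Letelier's construction: for a small disc \<open>D\<close> about \<open>z\<close>, the component of \<open>z\<close> in the union of all
  \<open>f\<^sup>-\<^sup>n(D)\<close> is automatically nice, and filling its holes keeps it nice. It stays within the concentric
  disc of twice the radius provided that every pullback of that larger disc which meets it is much
  smaller (or fixes \<open>z\<close> and contracts). The pullbacks are univalent because \<open>D\<close> avoids the
  post-singular set, and they omit two fixed values, which makes them a normal family: a square
  root of a univalent function without zeros omits a third value, so Schottky's theorem applies. If
  infinitely many pullbacks near \<open>z\<close> failed to shrink, a disc about \<open>z\<close> would be mapped univalently by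
  all iterates, which would again form a normal family, contradicting that \<open>z\<close> lies in the Julia set.\<close>

text \<open>The exception for pullbacks fixing \<open>z\<close> is forced by periodic points: if
  \<open>z\<close> is periodic, the inverse branch along its cycle maps small discs about
  \<open>z\<close> into themselves, but it shrinks them only by a fixed factor, possibly close to 1.
  Outside this case, pullbacks that meet discs shrinking to \<open>z\<close> have constant limits
  and so shrink by any prescribed factor. The two omitted values must never reach the disc under a
  positive iterate. For a transcendental map they are \<open>Infty\<close>, where \<open>f\<close>
  is undefined, and a finite post-singular point; for a rational map, two post-singular points. With
  fewer such points, inverse branches would be defined on a whole plane: in the first case
  \<open>f\<close> would be affine, in the second two disjoint branches would contradict Liouville's
  theorem. Filling the holes needs care, because a pullback might carry a point of a hole outside.
  Infinitely many holes may accumulate, so a hole need not be relatively open in the complement of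
  the component; a compact, relatively open piece of that complement takes its place.\<close>

section \<open>The spherical metric, stereographic projection and the two standard charts\<close>

lemma abs_inner_stereo_le: "\<bar>stereo x \<bullet> stereo y\<bar> \<le> 1"
  using Cauchy_Schwarz_ineq2[of "stereo x" "stereo y"] by simp

lemma norm_stereo_diff_sq: "(norm (stereo x - stereo y))\<^sup>2 = 2 - 2 * cos (dist x y)"
  using cos_arccos_abs[OF abs_inner_stereo_le[of x y]]
  by (simp add: power2_norm_eq_inner inner_diff_left inner_diff_right inner_stereo_self
      inner_commute dist_riemann_sphere_def)

text \<open>A chord is no longer than its arc: for an arc of length \<open>d\<close> the chord is
  \<open>2 * |sin (d/2)|\<close>.\<close>

lemma norm_stereo_diff_le_dist: "norm (stereo x - stereo y) \<le> dist x y"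
proof -
  define d where "d = dist x y"
  have "cos d = 1 - 2 * (sin (d/2))\<^sup>2"
    using cos_double_sin[of "d/2"] by simp
  then have "(norm (stereo x - stereo y))\<^sup>2 = 4 * (sin (d/2))\<^sup>2"
    by (simp add: norm_stereo_diff_sq d_def)
  also have "\<dots> \<le> 4 * (d/2)\<^sup>2"
    using abs_sin_x_le_abs_x[of "d/2"] abs_le_square_iff[of "sin (d/2)" "d/2"] by linarith
  finally have "(norm (stereo x - stereo y))\<^sup>2 \<le> d\<^sup>2" by (simp add: power_divide)
  then show ?thesis unfolding d_def by (rule power2_le_imp_le) simp
qed

lemma continuous_on_stereo: "continuous_on S stereo"
  unfolding continuous_on_iff dist_norm
  using norm_stereo_diff_le_dist le_less_trans dist_norm by metis

text \<open>One direction is the chord estimate, the other the continuity of \<open>arccos\<close>.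
  Thus \<open>stereo\<close> is a homeomorphism onto its image, and continuity on the sphere can be
  checked in Euclidean space.\<close>

lemma tendsto_stereo_iff:
  "((\<lambda>x. stereo (F x)) \<longlongrightarrow> stereo l) G \<longleftrightarrow> (F \<longlongrightarrow> l) G"
proof
  assume "(F \<longlongrightarrow> l) G"
  then show "((\<lambda>x. stereo (F x)) \<longlongrightarrow> stereo l) G"
    by (rule continuous_on_tendsto_compose[OF continuous_on_stereo[of UNIV]]) auto
next
  assume "((\<lambda>x. stereo (F x)) \<longlongrightarrow> stereo l) G"
  then have "((\<lambda>x. stereo (F x) \<bullet> stereo l) \<longlongrightarrow> 1) G"
    using tendsto_inner[of "\<lambda>x. stereo (F x)" "stereo l" G "\<lambda>_. stereo l" "stereo l"]
    by (simp add: inner_stereo_self)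
  moreover have "stereo (F x) \<bullet> stereo l \<in> {-1..1}" for x
    using abs_inner_stereo_le[of "F x" l] unfolding abs_le_iff atLeastAtMost_iff by linarith
  ultimately have "((\<lambda>x. arccos (stereo (F x) \<bullet> stereo l)) \<longlongrightarrow> arccos 1) G"
    using continuous_on_tendsto_compose[OF continuous_on_arccos', of "\<lambda>x. stereo (F x) \<bullet> stereo l" 1 G] by simp
  then show "(F \<longlongrightarrow> l) G"
    by (subst tendsto_dist_iff) (simp add: dist_riemann_sphere_def)
qed

lemma continuous_on_stereo_iff: "continuous_on S (\<lambda>x. stereo (F x)) \<longleftrightarrow> continuous_on S F"
  by (simp add: continuous_on_def tendsto_stereo_iff)

lemma continuous_on_inv_stereo: "continuous_on (range stereo) (inv stereo)"
  by (subst continuous_on_stereo_iff[symmetric])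
    (rule continuous_on_eq[OF continuous_on_id], auto simp: inj_stereo)

lemma continuous_on_Fin: "continuous_on S Fin"
  by (subst continuous_on_stereo_iff[symmetric])
    (auto intro!: continuous_intros simp: add_nonneg_eq_0_iff)

lemma sphere_inverse_involution [simp]: "sphere_inverse (sphere_inverse x) = x"
  by (cases x) auto

text \<open>On the unit sphere, \<open>1/w\<close> is the half turn about the real axis, which makes
  its continuity evident even at 0 and \<open>Infty\<close>.\<close>

lemma stereo_sphere_inverse:
  "stereo (sphere_inverse x) = (cnj (fst (stereo x)), - snd (stereo x))"
proof (cases x)
  case (Fin w)
  show ?thesis
  proof (cases "w = 0")
    case False
    define t where "t = (cmod w)\<^sup>2"
    have t: "t > 0" using False by (simp add: t_def)
    have inv: "inverse w = (1 / t) *\<^sub>R cnj w"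
      using False complex_norm_square[of w]
      by (simp add: t_def scaleR_conv_of_real field_simps)
    have norm: "(cmod (inverse w))\<^sup>2 = 1 / t"
      by (simp only: t_def norm_inverse power_inverse inverse_eq_divide[symmetric])
    have *: "1 + 1 / t = (1 + t) / t" "1 / t - 1 = - (t - 1) / t"
      using t by (simp_all add: field_simps)
    have eq: "2 / (1 + 1 / t) * (1 / t) = 2 / (1 + t)"
      "(1 / t - 1) / (1 + 1 / t) = - ((t - 1) / (1 + t))"
      using t unfolding * by (simp_all add: minus_divide_left)
    have "stereo (sphere_inverse x) = ((2 / (1 + 1 / t)) *\<^sub>R (1 / t) *\<^sub>R cnj w, (1 / t - 1) / (1 + 1 / t))"
      using False unfolding Fin by (simp only: sphere_inverse.simps stereo.simps norm[unfolded inv] inv if_False)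
    also have "\<dots> = (cnj (fst (stereo x)), - snd (stereo x))"
      unfolding scaleR_scaleR eq by (simp add: Fin t_def scaleR_conv_of_real)
    finally show ?thesis .
  qed (use Fin in auto)
qed auto

lemma continuous_on_sphere_inverse: "continuous_on S sphere_inverse"
  by (subst continuous_on_stereo_iff[symmetric])
    (auto simp: stereo_sphere_inverse intro!: continuous_intros continuous_on_stereo)

text \<open>This is stereographic projection from the north pole; the formula is continuous wherever
  the last coordinate differs from 1.\<close>

lemma fin_part_conv_stereo:
  "x \<noteq> Infty \<Longrightarrow> fin_part x = (1 / (1 - snd (stereo x))) *\<^sub>R fst (stereo x)"
proof (cases x)
  case (Fin w)
  define t where "t = (cmod w)\<^sup>2"
  define c where "c = 2 / (1 + t)"
  have t: "1 + t > 0" by (simp add: t_def add_pos_nonneg)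
  then have c: "c \<noteq> 0" "1 - (t - 1) / (1 + t) = c" by (simp_all add: c_def field_simps)
  have "stereo x = (c *\<^sub>R w, (t - 1) / (1 + t))" by (simp add: Fin t_def c_def)
  then have "(1 / (1 - snd (stereo x))) *\<^sub>R fst (stereo x) = (1 / c) *\<^sub>R c *\<^sub>R w"
    by (simp only: fst_conv snd_conv c)
  then show ?thesis using c(1) Fin by (simp only: scaleR_scaleR fin_part.simps) simp
qed auto

lemma snd_stereo_eq_1_iff: "snd (stereo x) = 1 \<longleftrightarrow> x = Infty"
proof (cases x)
  case (Fin w)
  have "1 + (cmod w)\<^sup>2 \<noteq> 0" using zero_le_power2[of "cmod w"] by linarith
  then show ?thesis using Fin by (auto simp: field_simps)
qed auto

lemma continuous_on_fin_part: "continuous_on (- {Infty}) fin_part"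
  by (rule continuous_on_eq[where f = "\<lambda>x. (1 / (1 - snd (stereo x))) *\<^sub>R fst (stereo x)"])
    (auto simp: fin_part_conv_stereo snd_stereo_eq_1_iff intro!: continuous_intros continuous_on_stereo)

lemma open_Fin_image: "open A \<Longrightarrow> open (Fin ` A)"
proof -
  assume "open A"
  then have "open (fin_part -` A \<inter> - {Infty})"
    by (simp add: continuous_on_open_vimage[THEN iffD1, OF _ continuous_on_fin_part] open_Compl)
  moreover have "fin_part -` A \<inter> - {Infty} = Fin ` A"
    by (auto simp: image_iff) (metis fin_part.simps(1) riemann_sphere.exhaust)
  ultimately show ?thesis by simp
qed

lemma open_sphere_inverse_image: "open A \<Longrightarrow> open (sphere_inverse ` A)"
proof -
  assume "open A"
  then have "open (sphere_inverse -` A)"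
    by (intro open_vimage continuous_on_sphere_inverse)
  moreover have "sphere_inverse -` A = sphere_inverse ` A"
    by (auto simp: image_iff) (metis sphere_inverse_involution)
  ultimately show ?thesis by simp
qed


section \<open>Analytic maps from the plane to the sphere\<close>

text \<open>A local form of holomorphy that suits composition and gluing: near each point a single
  target chart is chosen in which the values are finite, so that poles never appear.\<close>

definition sph_analytic_on :: "(complex \<Rightarrow> riemann_sphere) \<Rightarrow> complex set \<Rightarrow> bool"
    (infixl "sph'_analytic'_on" 50) where
  "F sph_analytic_on A \<longleftrightarrow> (\<forall>w\<in>A. \<exists>B\<in>{id, sphere_inverse}. \<exists>g.
     g analytic_on {w} \<and> (\<forall>\<^sub>F x in nhds w. F x = B (Fin (g x))))"

lemma sph_analytic_onE:
  assumes "F sph_analytic_on A" "w \<in> A"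
  obtains B g r where "B \<in> {id, sphere_inverse}" "r > 0" "g holomorphic_on ball w r"
    "\<And>x. x \<in> ball w r \<Longrightarrow> F x = B (Fin (g x))"
proof -
  obtain B g where B: "B \<in> {id, sphere_inverse}" and g: "g analytic_on {w}"
    and ev: "\<forall>\<^sub>F x in nhds w. F x = B (Fin (g x))"
    using assms unfolding sph_analytic_on_def by blast
  obtain r1 where r1: "r1 > 0" "g holomorphic_on ball w r1"
    using g by (auto simp: analytic_on_def)
  obtain r2 where r2: "r2 > 0" "\<And>x. dist x w < r2 \<Longrightarrow> F x = B (Fin (g x))"
    using ev by (auto simp: eventually_nhds_metric)
  show ?thesis
  proof (rule that[of B "min r1 r2" g])
    show "g holomorphic_on ball w (min r1 r2)" by (rule holomorphic_on_subset[OF r1(2)]) auto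
  qed (use B r1 r2 in \<open>auto simp: dist_commute\<close>)
qed

lemma sph_analytic_onI:
  assumes "\<And>w. w \<in> A \<Longrightarrow> \<exists>B g U. B \<in> {id, sphere_inverse} \<and> open U \<and> w \<in> U \<and> g holomorphic_on U \<and>
     (\<forall>x\<in>U. F x = B (Fin (g x)))"
  shows "F sph_analytic_on A"
  unfolding sph_analytic_on_def
proof
  fix w assume "w \<in> A"
  from assms[OF this] obtain B g U where *: "B \<in> {id, sphere_inverse}" "open U" "w \<in> U"
    "g holomorphic_on U" "\<forall>x\<in>U. F x = B (Fin (g x))" by blast
  then have "g analytic_on {w}"
    using analytic_on_open analytic_on_subset by blast
  moreover have "\<forall>\<^sub>F x in nhds w. F x = B (Fin (g x))"
    using * eventually_nhds by blast
  ultimately show "\<exists>B\<in>{id, sphere_inverse}. \<exists>g.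
     g analytic_on {w} \<and> (\<forall>\<^sub>F x in nhds w. F x = B (Fin (g x)))" using * by blast
qed

lemma sph_analytic_on_subset: "F sph_analytic_on A \<Longrightarrow> B \<subseteq> A \<Longrightarrow> F sph_analytic_on B"
  unfolding sph_analytic_on_def by blast

lemma continuous_chart: "B \<in> {id, sphere_inverse} \<Longrightarrow> continuous_on S B"
  using continuous_on_sphere_inverse by (auto simp: id_def)

lemma sph_analytic_on_imp_continuous_on:
  assumes "F sph_analytic_on A" shows "continuous_on A F"
proof -
  have "isCont F w" if w: "w \<in> A" for w
  proof -
    obtain B g r where B: "B \<in> {id, sphere_inverse}" "r > 0" "g holomorphic_on ball w r"
      "\<And>x. x \<in> ball w r \<Longrightarrow> F x = B (Fin (g x))"
      by (rule sph_analytic_onE[OF assms w]) (rule that, assumption+)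
    have "continuous_on (ball w r) (\<lambda>x. B (Fin (g x)))"
      using continuous_on_compose2[OF continuous_chart[OF B(1), of UNIV]
        continuous_on_compose2[OF continuous_on_Fin[of UNIV] holomorphic_on_imp_continuous_on[OF B(3)]]]
      by auto
    then have "continuous_on (ball w r) F" by (rule continuous_on_eq) (simp add: B(4))
    then show ?thesis using \<open>r > 0\<close> by (simp add: continuous_on_eq_continuous_at)
  qed
  then show ?thesis by (simp add: continuous_at_imp_continuous_on)
qed

lemma sph_analytic_on_cong:
  assumes "open A" "\<And>w. w \<in> A \<Longrightarrow> F w = G w" "F sph_analytic_on A"
  shows "G sph_analytic_on A"
proof (rule sph_analytic_onI)
  fix w assume w: "w \<in> A"
  obtain B g r where B: "B \<in> {id, sphere_inverse}" "r > 0" "g holomorphic_on ball w r"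
      "\<And>x. x \<in> ball w r \<Longrightarrow> F x = B (Fin (g x))"
    by (rule sph_analytic_onE[OF assms(3) w]) (rule that, assumption+)
  have "\<forall>x\<in>ball w r \<inter> A. G x = B (Fin (g x))" using B(4) assms(2) by (metis IntE)
  moreover have "g holomorphic_on ball w r \<inter> A" using B(3) by (rule holomorphic_on_subset) auto
  ultimately show "\<exists>B g U. B \<in> {id, sphere_inverse} \<and> open U \<and> w \<in> U \<and> g holomorphic_on U \<and>
     (\<forall>x\<in>U. G x = B (Fin (g x)))"
    using B w assms(1) by (intro exI[of _ B] exI[of _ g] exI[of _ "ball w r \<inter> A"]) (simp add: open_Int)
qed

lemma sph_analytic_on_locally:
  assumes "\<And>w. w \<in> A \<Longrightarrow> \<exists>U. open U \<and> w \<in> U \<and> F sph_analytic_on U"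
  shows "F sph_analytic_on A"
  using assms unfolding sph_analytic_on_def by blast

lemma sph_analytic_on_Fin:
  assumes "g holomorphic_on A" "open A"
  shows "(\<lambda>w. Fin (g w)) sph_analytic_on A"
  by (rule sph_analytic_onI) (use assms in \<open>intro exI[of _ id] exI[of _ g] exI[of _ A], auto\<close>)

lemma sph_analytic_on_compose:
  assumes "F sph_analytic_on A" "g holomorphic_on B" "open B" "g ` B \<subseteq> A"
  shows "(\<lambda>w. F (g w)) sph_analytic_on B"
proof (rule sph_analytic_onI)
  fix w assume w: "w \<in> B"
  then have gw: "g w \<in> A" using assms(4) by auto
  obtain C h r where C: "C \<in> {id, sphere_inverse}" "r > 0" "h holomorphic_on ball (g w) r"
      "\<And>x. x \<in> ball (g w) r \<Longrightarrow> F x = C (Fin (h x))"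
    by (rule sph_analytic_onE[OF assms(1) gw]) (rule that, assumption+)
  define U where "U = g -` ball (g w) r \<inter> B"
  have "open U" unfolding U_def
    using continuous_on_open_vimage[OF assms(3)] holomorphic_on_imp_continuous_on[OF assms(2)] by blast
  moreover have "w \<in> U" using w C(2) by (simp add: U_def)
  moreover have "(h \<circ> g) holomorphic_on U"
    by (rule holomorphic_on_compose_gen[OF _ C(3)])
      (auto simp: U_def intro: holomorphic_on_subset[OF assms(2)])
  moreover have "\<forall>x\<in>U. F (g x) = C (Fin ((h \<circ> g) x))" using C(4) by (auto simp: U_def)
  ultimately show "\<exists>B' h U. B' \<in> {id, sphere_inverse} \<and> open U \<and> w \<in> U \<and> h holomorphic_on U \<and>
     (\<forall>x\<in>U. F (g x) = B' (Fin (h x)))" using C(1) by blast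
qed

text \<open>Only the source chart is quantified; the target chart is chosen point by point inside
  \<open>sph_analytic_on\<close>.\<close>

definition sph_selfmap_analytic_on :: "(riemann_sphere \<Rightarrow> riemann_sphere) \<Rightarrow> riemann_sphere set \<Rightarrow> bool" where
  "sph_selfmap_analytic_on h V \<longleftrightarrow>
     (\<forall>A\<in>{id, sphere_inverse}. (\<lambda>w. h (A (Fin w))) sph_analytic_on {w. A (Fin w) \<in> V})"

lemma sph_selfmap_analytic_on_compose:
  assumes "sph_selfmap_analytic_on h V" "F sph_analytic_on A" "open A" "F ` A \<subseteq> V"
  shows "(\<lambda>w. h (F w)) sph_analytic_on A"
proof (rule sph_analytic_on_locally)
  fix w assume w: "w \<in> A"
  obtain B g r where B: "B \<in> {id, sphere_inverse}" "r > 0" "g holomorphic_on ball w r"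
      "\<And>x. x \<in> ball w r \<Longrightarrow> F x = B (Fin (g x))"
    by (rule sph_analytic_onE[OF assms(2) w]) (rule that, assumption+)
  have "(\<lambda>x. h (B (Fin (g x)))) sph_analytic_on (ball w r \<inter> A)"
  proof (rule sph_analytic_on_compose[where A = "{w. B (Fin w) \<in> V}" and F = "\<lambda>w. h (B (Fin w))"])
    show "(\<lambda>w. h (B (Fin w))) sph_analytic_on {w. B (Fin w) \<in> V}"
      using assms(1) B(1) unfolding sph_selfmap_analytic_on_def by blast
    show "g holomorphic_on ball w r \<inter> A" using B(3) by (rule holomorphic_on_subset) auto
    show "g ` (ball w r \<inter> A) \<subseteq> {w. B (Fin w) \<in> V}"
      using B(4) assms(4) by force
  qed (use assms(3) in auto)
  then have "(\<lambda>x. h (F x)) sph_analytic_on (ball w r \<inter> A)"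
    by (rule sph_analytic_on_cong[rotated 2]) (use B assms in auto)
  then show "\<exists>U. open U \<and> w \<in> U \<and> (\<lambda>w. h (F w)) sph_analytic_on U"
    using B w assms(3) by (intro exI[of _ "ball w r \<inter> A"]) auto
qed

lemma Fin_fin_part: "x \<noteq> Infty \<Longrightarrow> Fin (fin_part x) = x"
  by (cases x) auto

lemma sphere_holomorphic_on_imp_analytic:
  assumes "h sphere_holomorphic_on V" "open V"
  shows "sph_selfmap_analytic_on h V"
  unfolding sph_selfmap_analytic_on_def
proof
  fix A :: "riemann_sphere \<Rightarrow> riemann_sphere" assume A: "A \<in> {id, sphere_inverse}"
  define W where "W = {w. A (Fin w) \<in> V}"
  have contA: "continuous_on UNIV (\<lambda>w. A (Fin w))"
    using continuous_on_compose2[OF continuous_chart[OF A, of UNIV] continuous_on_Fin] by auto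
  then have W: "open W" unfolding W_def
    using open_vimage[OF assms(2)] by (simp add: vimage_def)
  have conth: "continuous_on W (\<lambda>w. h (A (Fin w)))"
    using assms(1) continuous_on_compose2[OF _ continuous_on_subset[OF contA], of V h W]
    unfolding sphere_holomorphic_on_def W_def by auto
  show "(\<lambda>w. h (A (Fin w))) sph_analytic_on {w. A (Fin w) \<in> V}"
  proof (rule sph_analytic_onI)
    fix w assume w: "w \<in> {w. A (Fin w) \<in> V}"
    define B where "B = (if h (A (Fin w)) = Infty then sphere_inverse else id)"
    have B: "B \<in> {id, sphere_inverse}" "B (h (A (Fin w))) \<noteq> Infty" by (auto simp: B_def)
    define U where "U = (\<lambda>w. B (h (A (Fin w)))) -` (- {Infty}) \<inter> W"
    have "continuous_on W (\<lambda>w. B (h (A (Fin w))))"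
      using continuous_on_compose2[OF continuous_chart[OF B(1), of UNIV] conth] by auto
    then have "open U" unfolding U_def
      using continuous_on_open_vimage[OF W] open_Compl by blast
    moreover have "w \<in> U" using w B by (auto simp: U_def W_def)
    moreover have "(\<lambda>w. fin_part (B (h (A (Fin w))))) holomorphic_on U"
    proof -
      have "U = {w. A (Fin w) \<in> V \<and> B (h (A (Fin w))) \<noteq> Infty}" by (auto simp: U_def W_def)
      then show ?thesis using assms(1) A B(1) unfolding sphere_holomorphic_on_def by blast
    qed
    moreover have "\<forall>x\<in>U. h (A (Fin x)) = B (Fin (fin_part (B (h (A (Fin x))))))"
      using B(1) by (auto simp: U_def Fin_fin_part)
    ultimately show "\<exists>B g U. B \<in> {id, sphere_inverse} \<and> open U \<and> w \<in> U \<and> g holomorphic_on U \<and>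
     (\<forall>x\<in>U. h (A (Fin x)) = B (Fin (g x)))" using B(1)
      by (intro exI[of _ B] exI[of _ "\<lambda>w. fin_part (B (h (A (Fin w))))"] exI[of _ U]) auto
  qed
qed

text \<open>Injectivity passes to the local representatives, so the planar open mapping theorem
  applies to each of them, and the charts are open maps.\<close>

lemma open_image_sph_analytic:
  assumes F: "F sph_analytic_on A" and "open A" and inj: "inj_on F A"
  shows "open (F ` A)"
proof (subst open_subopen, rule ballI)
  fix y assume "y \<in> F ` A"
  then obtain w where w: "w \<in> A" "y = F w" by auto
  obtain B g r where B: "B \<in> {id, sphere_inverse}" "r > 0" "g holomorphic_on ball w r"
      "\<And>x. x \<in> ball w r \<Longrightarrow> F x = B (Fin (g x))"
    by (rule sph_analytic_onE[OF F w(1)]) (rule that, assumption+)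
  define U where "U = ball w r \<inter> A"
  have U: "open U" "w \<in> U" "U \<subseteq> A" using w \<open>open A\<close> B by (auto simp: U_def)
  have "inj_on g U"
  proof (rule inj_onI)
    fix a b assume "a \<in> U" "b \<in> U" "g a = g b"
    then show "a = b" using B(4)[of a] B(4)[of b] inj by (auto simp: U_def inj_on_def)
  qed
  then have "open (g ` U)"
    using B(3) U by (intro open_mapping_thm3) (auto simp: U_def intro: holomorphic_on_subset)
  then have "open (B ` Fin ` g ` U)"
    using B(1) open_Fin_image open_sphere_inverse_image by auto
  moreover have "B ` Fin ` g ` U = F ` U" using B(4) by (force simp: U_def)
  ultimately have "open (F ` U)" by simp
  then show "\<exists>T. open T \<and> y \<in> T \<and> T \<subseteq> F ` A"
    using U w by (intro exI[of _ "F ` U"]) auto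
qed


section \<open>Charts omitting one point\<close>

text \<open>A conformal isomorphism from the plane onto the complement of \<open>e\<close>.\<close>

fun chart :: "riemann_sphere \<Rightarrow> complex \<Rightarrow> riemann_sphere" where
  "chart Infty u = Fin u"
| "chart (Fin e) u = (if u = 0 then Infty else Fin (e + inverse u))"

fun coord :: "riemann_sphere \<Rightarrow> riemann_sphere \<Rightarrow> complex" where
  "coord Infty x = fin_part x"
| "coord (Fin e) (Fin y) = inverse (y - e)"
| "coord (Fin e) Infty = 0"

lemma coord_chart [simp]: "coord e (chart e u) = u"
  by (cases e) auto

lemma chart_coord [simp]: "x \<noteq> e \<Longrightarrow> chart e (coord e x) = x"
  by (cases e; cases x) auto

lemma chart_neq [simp]: "chart e u \<noteq> e"
  by (cases e) auto

lemma inj_chart: "inj (chart e)"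
  by (metis coord_chart injI)

lemma range_chart: "range (chart e) = - {e}"
  by auto (metis chart_coord rangeI)

lemma chart_analytic: "chart e sph_analytic_on UNIV"
proof (cases e)
  case Infty
  then have "chart e = (\<lambda>w. Fin w)" by auto
  then show ?thesis using sph_analytic_on_Fin[of "\<lambda>w. w" UNIV] by simp
next
  case (Fin a)
  show ?thesis
  proof (rule sph_analytic_onI)
    fix w :: complex
    show "\<exists>B g U. B \<in> {id, sphere_inverse} \<and> open U \<and> w \<in> U \<and> g holomorphic_on U \<and>
     (\<forall>x\<in>U. chart e x = B (Fin (g x)))"
    proof (cases "w = 0")
      case False
      then show ?thesis using Fin
        by (intro exI[of _ id] exI[of _ "\<lambda>u. a + inverse u"] exI[of _ "-{0}"])
          (auto intro!: holomorphic_intros simp: open_Compl)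
    next
      case True
      \<comment> \<open>Near \<open>u = 0\<close> the value is \<open>(1 + a * u) / u\<close>, so
        the chart \<open>1/w\<close> sees \<open>u / (1 + a * u)\<close>.\<close>
      define U where "U = {u. 1 + a * u \<noteq> 0}"
      have "open U" unfolding U_def by (intro open_Collect_neq continuous_intros)
      moreover have "\<forall>x\<in>U. chart e x = sphere_inverse (Fin (x / (1 + a * x)))"
        using Fin by (auto simp: U_def field_simps)
      moreover have "(\<lambda>x. x / (1 + a * x)) holomorphic_on U"
        by (auto intro!: holomorphic_intros simp: U_def)
      ultimately show ?thesis using True
        by (intro exI[of _ sphere_inverse] exI[of _ "\<lambda>x. x / (1 + a * x)"] exI[of _ U]) (auto simp: U_def)
    qed
  qed
qed

lemma continuous_on_chart: "continuous_on S (chart e)"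
  using sph_analytic_on_imp_continuous_on[OF chart_analytic] continuous_on_subset by blast

lemma open_chart_image: "open A \<Longrightarrow> open (chart e ` A)"
  by (meson chart_analytic inj_chart inj_on_subset open_image_sph_analytic
      sph_analytic_on_subset subset_UNIV)

lemma open_chart_vimage: "open V \<Longrightarrow> open {u. chart e u \<in> V}"
  using open_vimage[OF _ continuous_on_chart] by (auto simp: vimage_def)

lemma coord_vimage: "coord e -` A \<inter> - {e} = chart e ` A"
  by (auto simp: image_iff) (metis chart_coord)

lemma continuous_on_coord: "e \<notin> S \<Longrightarrow> continuous_on S (coord e)"
proof -
  have "continuous_on (- {e}) (coord e)"
    by (subst continuous_on_open_vimage) (auto simp: coord_vimage open_chart_image open_Compl)
  then show "e \<notin> S \<Longrightarrow> continuous_on S (coord e)" by (rule continuous_on_subset) auto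
qed

lemma holomorphic_on_coord:
  assumes "F sph_analytic_on A" "open A" "e \<notin> F ` A"
  shows "(\<lambda>w. coord e (F w)) holomorphic_on A"
proof -
  have "(\<lambda>w. coord e (F w)) analytic_on {w}" if w: "w \<in> A" for w
  proof -
    obtain B g r where B: "B \<in> {id, sphere_inverse}" "r > 0" "g holomorphic_on ball w r"
        "\<And>x. x \<in> ball w r \<Longrightarrow> F x = B (Fin (g x))"
      by (rule sph_analytic_onE[OF assms(1) w]) (rule that, assumption+)
    define U where "U = ball w r \<inter> A"
    have U: "open U" "w \<in> U" using w assms(2) B by (auto simp: U_def)
    have g: "g holomorphic_on U" using B(3) by (rule holomorphic_on_subset) (auto simp: U_def)
    have ne: "B (Fin (g x)) \<noteq> e" if "x \<in> U" for x
      using assms(3) B(4)[of x] that unfolding U_def by (metis IntE imageI)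
    have "(\<lambda>w. coord e (F w)) holomorphic_on U"
    proof (cases "B = id")
      case True
      show ?thesis
      proof (cases e)
        case Infty
        have "(\<lambda>w. g w) holomorphic_on U" using g by simp
        then show ?thesis by (rule holomorphic_transform) (auto simp: Infty B True U_def)
      next
        case (Fin a)
        have "(\<lambda>w. inverse (g w - a)) holomorphic_on U"
          using ne by (intro holomorphic_intros g) (auto simp: True Fin)
        then show ?thesis by (rule holomorphic_transform) (auto simp: Fin B True U_def)
      qed
    next
      case False
      then have B': "B = sphere_inverse" using B(1) by auto
      show ?thesis
      proof (cases e)
        case Infty
        have *: "g x \<noteq> 0" if "x \<in> U" for x using ne[OF that] by (auto simp: B' Infty split: if_splits)
        have "(\<lambda>w. inverse (g w)) holomorphic_on U" using g * by (intro holomorphic_intros)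
        then show ?thesis by (rule holomorphic_transform) (use * in \<open>auto simp: Infty B B' U_def\<close>)
      next
        case (Fin a)
        have *: "1 - a * g x \<noteq> 0" if "x \<in> U" for x
        proof
          assume "1 - a * g x = 0"
          then have "g x * a = 1" by (simp add: mult.commute)
          then have "g x \<noteq> 0" "inverse (g x) = a" using inverse_unique[of "g x" a] by auto
          then show False using ne[OF that] by (simp add: Fin B')
        qed
        \<comment> \<open>The coordinate \<open>1 / (1/g - a)\<close> equals this quotient, which
          also gives the right value 0 where \<open>g\<close> vanishes, that is, at
          \<open>Infty\<close>.\<close>
        have "(\<lambda>w. g w / (1 - a * g w)) holomorphic_on U" using g * by (intro holomorphic_intros)
        then show ?thesis
        proof (rule holomorphic_transform)
          fix x assume x: "x \<in> U"
          show "g x / (1 - a * g x) = coord e (F x)"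
          proof (cases "g x = 0")
            case False
            then have "inverse (g x) - a = (1 - a * g x) / g x" by (simp add: field_simps)
            then show ?thesis using x B(4)[of x] False by (simp add: U_def Fin B')
          qed (use x B(4)[of x] in \<open>simp add: U_def Fin B'\<close>)
        qed
      qed
    qed
    then show ?thesis using U analytic_on_open analytic_on_subset by blast
  qed
  then show ?thesis
    using analytic_imp_holomorphic analytic_on_analytic_at by blast
qed

text \<open>The omitted point \<open>e\<close> plays the part of infinity in the coordinate plane,
  so coordinates that escape mean convergence to \<open>e\<close> on the sphere.\<close>

lemma tendsto_chart_at_infinity: "(chart e \<longlongrightarrow> e) at_infinity"
proof (cases e)
  case Infty
  have "((\<lambda>u. sphere_inverse (Fin (inverse u))) \<longlongrightarrow> sphere_inverse (Fin 0)) at_infinity"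
    by (intro continuous_on_tendsto_compose[OF continuous_on_sphere_inverse[of UNIV]]
        continuous_on_tendsto_compose[OF continuous_on_Fin[of UNIV]] tendsto_inverse_0) auto
  moreover have "\<forall>\<^sub>F u in at_infinity. sphere_inverse (Fin (inverse u)) = chart e u"
    using Infty by (auto simp: eventually_at_infinity intro!: exI[of _ 1])
  ultimately show ?thesis using Infty tendsto_cong by fastforce
next
  case (Fin a)
  have "((\<lambda>u. Fin (a + inverse u)) \<longlongrightarrow> Fin (a + 0)) at_infinity"
    by (intro continuous_on_tendsto_compose[OF continuous_on_Fin[of UNIV]]
        tendsto_add tendsto_const tendsto_inverse_0) auto
  moreover have "\<forall>\<^sub>F u in at_infinity. Fin (a + inverse u) = chart e u"
    using Fin by (auto simp: eventually_at_infinity intro!: exI[of _ 1])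
  ultimately show ?thesis using Fin tendsto_cong by fastforce
qed

section \<open>Iteration of analytic partial maps of the sphere\<close>

lemma sph_selfmap_analytic_on_imp_continuous_on:
  assumes "sph_selfmap_analytic_on h V" "open V"
  shows "continuous_on V h"
proof -
  have "isCont h x" if x: "x \<in> V" for x
  proof -
    obtain e where e: "x \<noteq> e" by (metis riemann_sphere.distinct(1))
    define A where "A = {u. chart e u \<in> V}"
    have A: "open A" unfolding A_def by (rule open_chart_vimage[OF assms(2)])
    have "(\<lambda>u. h (chart e u)) sph_analytic_on A"
      by (rule sph_selfmap_analytic_on_compose[OF assms(1) sph_analytic_on_subset[OF chart_analytic] A])
        (auto simp: A_def)
    then have "continuous_on A (\<lambda>u. h (chart e u))" by (rule sph_analytic_on_imp_continuous_on)
    then have "continuous_on (V - {e}) (\<lambda>x. h (chart e (coord e x)))"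
      by (rule continuous_on_compose2[OF _ continuous_on_coord]) (auto simp: A_def)
    then have "continuous_on (V - {e}) h"
      by (rule continuous_on_eq) auto
    then show ?thesis using x e assms(2)
      by (simp add: continuous_on_eq_continuous_at open_Diff)
  qed
  then show ?thesis by (simp add: continuous_at_imp_continuous_on)
qed

lemma iter_add: "iter f (m + n) x = Option.bind (iter f m x) (iter f n)"
proof (induction n)
  case (Suc n)
  then show ?case by (cases "iter f m x") auto
qed (cases "iter f m x", auto)

lemma iter_Suc_left: "iter f (Suc n) x = Option.bind (f x) (iter f n)"
  using iter_add[of f 1 n x] by simp

lemma iter_add_SomeE:
  assumes "iter f (m + n) x = Some y"
  obtains u where "iter f m x = Some u" "iter f n u = Some y"
  using assms by (auto simp: iter_add bind_eq_Some_conv)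

lemma iter_defined_mono: "iter f n x \<noteq> None \<Longrightarrow> m \<le> n \<Longrightarrow> iter f m x \<noteq> None"
  using iter_add[of f m "n - m" x] by (cases "iter f m x") auto

text \<open>The common ground of rational and transcendental maps. The construction uses nothing
  else about \<open>f\<close>, once two points that never reach the disc are known.\<close>

locale analytic_sphere_map =
  fixes f :: sphere_map
  assumes open_domain: "open {x. f x \<noteq> None}"
    and analytic: "sph_selfmap_analytic_on (\<lambda>x. the (f x)) {x. f x \<noteq> None}"
begin

lemma continuous: "continuous_on {x. f x \<noteq> None} (\<lambda>x. the (f x))"
  using sph_selfmap_analytic_on_imp_continuous_on[OF analytic open_domain] .

lemma iter_open_continuous:
  "open {x. iter f n x \<noteq> None} \<and> continuous_on {x. iter f n x \<noteq> None} (\<lambda>x. the (iter f n x))"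
proof (induction n)
  case (Suc n)
  define D where "D = {x. iter f n x \<noteq> None}"
  have D: "open D" "continuous_on D (\<lambda>x. the (iter f n x))" using Suc by (auto simp: D_def)
  have eq: "{x. iter f (Suc n) x \<noteq> None} = (\<lambda>x. the (iter f n x)) -` {x. f x \<noteq> None} \<inter> D"
    by (auto simp: D_def bind_eq_Some_conv)
  have "open {x. iter f (Suc n) x \<noteq> None}" unfolding eq
    using D continuous_on_open_vimage[OF D(1)] open_domain by blast
  moreover have "continuous_on {x. iter f (Suc n) x \<noteq> None} (\<lambda>x. the (f (the (iter f n x))))"
    by (rule continuous_on_compose2[OF continuous continuous_on_subset[OF D(2)]])
      (use eq in blast)+
  then have "continuous_on {x. iter f (Suc n) x \<noteq> None} (\<lambda>x. the (iter f (Suc n) x))"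
    by (rule continuous_on_eq) (auto simp: bind_eq_Some_conv)
  ultimately show ?case by blast
qed (simp add: continuous_on_id)

lemmas open_iter_domain = iter_open_continuous[THEN conjunct1]
lemmas continuous_iter = iter_open_continuous[THEN conjunct2]

lemma open_iter_vimage:
  assumes "open D" shows "open {x. \<exists>v\<in>D. iter f n x = Some v}"
proof -
  have "{x. \<exists>v\<in>D. iter f n x = Some v} = (\<lambda>x. the (iter f n x)) -` D \<inter> {x. iter f n x \<noteq> None}"
    by force
  then show ?thesis
    using continuous_on_open_vimage[THEN iffD1, OF open_iter_domain continuous_iter] assms by simp
qed

lemma iter_compose_analytic:
  assumes F: "F sph_analytic_on A" "open A" and "\<And>w. w \<in> A \<Longrightarrow> iter f n (F w) \<noteq> None"
  shows "(\<lambda>w. the (iter f n (F w))) sph_analytic_on A"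
  using assms(3)
proof (induction n)
  case (Suc n)
  have *: "iter f n (F w) \<noteq> None \<and> f (the (iter f n (F w))) \<noteq> None" if "w \<in> A" for w
    using Suc.prems[OF that] by (cases "iter f n (F w)") auto
  have "(\<lambda>w. the (f (the (iter f n (F w))))) sph_analytic_on A"
    by (rule sph_selfmap_analytic_on_compose[OF analytic Suc.IH F(2)]) (use * in auto)
  then show ?case
    by (rule sph_analytic_on_cong[OF F(2), rotated]) (use * in \<open>force simp: bind_eq_Some_conv\<close>)
qed (simp add: F)

lemma closed_postsingular: "closed (postsingular_set f)"
  by (simp add: postsingular_set_def)

lemma singular_values_subset: "singular_values f \<subseteq> postsingular_set f"
proof -
  have "singular_values f \<subseteq> orb_set f (singular_values f)"
    unfolding orb_set_def orb_def using iter.simps(1) by blast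
  then show ?thesis unfolding postsingular_set_def using closure_subset by blast
qed

text \<open>The orbit set is forward invariant as far as \<open>f\<close> is defined; continuity on
  the open domain carries this over to the closure.\<close>

lemma postsingular_invariant:
  assumes "x \<in> postsingular_set f" "f x = Some y"
  shows "y \<in> postsingular_set f"
proof -
  define Q where "Q = orb_set f (singular_values f)"
  define D where "D = {x. f x \<noteq> None}"
  have Q: "the (f x) \<in> Q" if "x \<in> Q" "x \<in> D" for x
  proof -
    obtain s n where "s \<in> singular_values f" "iter f n s = Some x"
      using \<open>x \<in> Q\<close> unfolding Q_def orb_set_def orb_def by blast
    moreover obtain v where "f x = Some v" using \<open>x \<in> D\<close> by (auto simp: D_def)
    ultimately have "iter f (Suc n) s = Some v" "s \<in> singular_values f" by simp_all
    then show ?thesis using \<open>f x = Some v\<close> unfolding Q_def orb_set_def orb_def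
      by (simp del: iter.simps) blast
  qed
  have x: "x \<in> D" "x \<in> closure Q" using assms by (auto simp: D_def Q_def postsingular_set_def)
  have "isCont (\<lambda>x. the (f x)) x"
    using continuous open_domain x by (auto simp: D_def continuous_on_eq_continuous_at)
  have "the (f x) \<in> closure Q"
  proof (rule ccontr)
    assume "the (f x) \<notin> closure Q"
    then have "open (- closure Q)" "the (f x) \<in> - closure Q" by auto
    moreover have "((\<lambda>y. the (f y)) \<longlongrightarrow> the (f x)) (nhds x)"
      using \<open>isCont _ x\<close> tendsto_at_iff_tendsto_nhds[of "\<lambda>y. the (f y)" x] by (simp add: isCont_def)
    ultimately have "\<forall>\<^sub>F y in nhds x. the (f y) \<in> - closure Q"
      by (rule topological_tendstoD[rotated])
    moreover have "\<forall>\<^sub>F y in nhds x. y \<in> D"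
      using open_domain x eventually_nhds_in_open D_def by blast
    ultimately have "\<forall>\<^sub>F y in nhds x. y \<in> D \<and> the (f y) \<notin> closure Q" by eventually_elim auto
    then obtain W where W: "open W" "x \<in> W" "\<And>y. y \<in> W \<Longrightarrow> y \<in> D \<and> the (f y) \<notin> closure Q"
      by (auto simp: eventually_nhds)
    then obtain y where "y \<in> W \<inter> Q" using x(2) by (metis disjoint_iff open_Int_closure_eq_empty Int_iff)
    then show False using W(3)[of y] Q[of y] closure_subset[of Q] by blast
  qed
  then show ?thesis using assms(2) by (simp add: Q_def postsingular_set_def)
qed

lemma postsingular_invariant_iter:
  "x \<in> postsingular_set f \<Longrightarrow> iter f n x = Some y \<Longrightarrow> y \<in> postsingular_set f"
  by (induction n arbitrary: y) (auto simp: bind_eq_Some_conv dest: postsingular_invariant)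

lemma local_inverse_branches:
  assumes "v \<notin> singular_values f"
  obtains V where "open V" "v \<in> V" "V \<inter> singular_values f = {}"
    "\<And>w u. u \<in> V \<Longrightarrow> f w = Some u \<Longrightarrow> \<exists>\<psi>. sph_selfmap_analytic_on \<psi> V \<and> inj_on \<psi> V \<and>
        (\<forall>x\<in>V. f (\<psi> x) = Some x) \<and> \<psi> u = w"
proof -
  obtain V where V: "open V" "v \<in> V" "inverse_branches_univalent_on f V"
    using assms by (auto simp: singular_values_def)
  then have "V \<inter> singular_values f = {}" by (auto simp: singular_values_def)
  then show ?thesis
  proof (rule that[OF V(1,2)])
    fix w u assume "u \<in> V" "f w = Some u"
    with V(3) obtain \<psi> where "univalent_on \<psi> V" "\<forall>x\<in>V. f (\<psi> x) = Some x" "\<psi> u = w"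
      unfolding inverse_branches_univalent_on_def by blast
    then show "\<exists>\<psi>. sph_selfmap_analytic_on \<psi> V \<and> inj_on \<psi> V \<and>
        (\<forall>x\<in>V. f (\<psi> x) = Some x) \<and> \<psi> u = w"
      using V(1) unfolding univalent_on_def
      by (intro exI[of _ \<psi>]) (auto intro: sphere_holomorphic_on_imp_analytic)
  qed
qed

end

section \<open>Rational maps and transcendental meromorphic functions are analytic maps of the
  sphere\<close>

lemma sph_analytic_on_quotient:
  assumes "P holomorphic_on A" "Q holomorphic_on A" "open A" "\<And>w. w \<in> A \<Longrightarrow> P w \<noteq> 0 \<or> Q w \<noteq> 0"
  shows "(\<lambda>w. if Q w = 0 then Infty else Fin (P w / Q w)) sph_analytic_on A"
proof (rule sph_analytic_onI)
  fix w assume w: "w \<in> A"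
  have op: "open (g -` (- {0}) \<inter> A)" if "g holomorphic_on A" for g :: "complex \<Rightarrow> complex"
    using continuous_on_open_vimage[THEN iffD1, OF assms(3) holomorphic_on_imp_continuous_on[OF that]]
    by (simp add: open_Compl)
  show "\<exists>B g U. B \<in> {id, sphere_inverse} \<and> open U \<and> w \<in> U \<and> g holomorphic_on U \<and>
     (\<forall>x\<in>U. (if Q x = 0 then Infty else Fin (P x / Q x)) = B (Fin (g x)))"
  proof (cases "Q w = 0")
    case True
    have "(\<lambda>x. Q x / P x) holomorphic_on P -` (- {0}) \<inter> A"
      using assms by (auto intro!: holomorphic_intros intro: holomorphic_on_subset)
    then show ?thesis using op[OF assms(1)] w True assms(4)[OF w]
      by (intro exI[of _ sphere_inverse] exI[of _ "\<lambda>x. Q x / P x"] exI[of _ "P -` (- {0}) \<inter> A"]) auto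
  next
    case False
    have "(\<lambda>x. P x / Q x) holomorphic_on Q -` (- {0}) \<inter> A"
      using assms by (auto intro!: holomorphic_intros intro: holomorphic_on_subset)
    then show ?thesis using op[OF assms(2)] w False
      by (intro exI[of _ id] exI[of _ "\<lambda>x. P x / Q x"] exI[of _ "Q -` (- {0}) \<inter> A"]) auto
  qed
qed

lemma coeff_max_degree_neq_0:
  assumes "q \<noteq> 0"
  shows "coeff p (max (degree p) (degree q)) \<noteq> 0 \<or> coeff q (max (degree p) (degree q)) \<noteq> 0"
proof (cases "degree p \<le> degree q")
  case True
  then show ?thesis using assms by (simp add: max_def)
next
  case False
  then have "p \<noteq> 0" by auto
  then show ?thesis using False by (simp add: max_def)
qed

lemma quotient_map_analytic:
  assumes "q \<noteq> 0" "coprime p q"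
  shows "analytic_sphere_map (quotient_map p q)"
proof
  define f where "f = quotient_map p q"
  have f_not_None: "f x \<noteq> None" for x by (cases x) (auto simp: f_def Let_def)
  have polyh: "poly r holomorphic_on A" for r :: "complex poly" and A
    unfolding holomorphic_on_def
    by (meson field_differentiable_at_within field_differentiable_def poly_DERIV)
  show "open {x. quotient_map p q x \<noteq> None}" using f_not_None by (simp add: f_def)
  have 1: "(\<lambda>w. the (f (Fin w))) sph_analytic_on UNIV"
    using sph_analytic_on_quotient[of "poly p" UNIV "poly q"] coprime_poly_0[OF assms(2)]
      polyh by (simp add: f_def)
  define d where "d = max (degree p) (degree q)"
  \<comment> \<open>The polynomial \<open>w^d * r(1/w)\<close>. Padding both polynomials to the
    common degree \<open>d\<close> makes \<open>rev p / rev q\<close> the map read in the coordinate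
    \<open>1/z\<close>, with the coefficients of \<open>z^d\<close> as its data at 0.\<close>
  define rev where "rev r w = poly (reflect_poly r) w * w ^ (d - degree r)" for r :: "complex poly" and w
  have rev: "rev r w = w ^ d * poly r (inverse w)" if "w \<noteq> 0" "degree r \<le> d" for r w
    using that by (simp add: rev_def poly_reflect_poly_nz power_add[symmetric] mult.assoc[symmetric]
        mult.commute[of _ "poly r _"] mult.left_commute)
  have rev0: "rev r 0 = coeff r d" if "degree r \<le> d" for r
    using that by (cases "degree r = d") (auto simp: rev_def poly_0_coeff_0 power_0_left coeff_eq_0)
  have lead: "coeff p d \<noteq> 0 \<or> coeff q d \<noteq> 0"
    unfolding d_def by (rule coeff_max_degree_neq_0[OF assms(1)])
  have le: "degree p \<le> d" "degree q \<le> d" by (auto simp: d_def)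
  have "(\<lambda>w. if rev q w = 0 then Infty else Fin (rev p w / rev q w)) sph_analytic_on UNIV"
  proof (rule sph_analytic_on_quotient)
    fix w
    show "rev p w \<noteq> 0 \<or> rev q w \<noteq> 0"
      using lead rev0 rev le coprime_poly_0[OF assms(2), of "inverse w"]
      by (cases "w = 0") auto
  qed (auto simp: rev_def intro!: holomorphic_intros polyh)
  moreover have "(\<lambda>w. if rev q w = 0 then Infty else Fin (rev p w / rev q w)) =
      (\<lambda>w. the (f (sphere_inverse (Fin w))))"
    using le by (auto simp: fun_eq_iff f_def rev rev0 Let_def d_def[symmetric])
  ultimately have 2: "(\<lambda>w. the (f (sphere_inverse (Fin w)))) sph_analytic_on UNIV" by simp
  show "sph_selfmap_analytic_on (\<lambda>x. the (quotient_map p q x)) {x. quotient_map p q x \<noteq> None}"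
    unfolding sph_selfmap_analytic_on_def f_def[symmetric] using 1 2
    by (auto simp: f_not_None simp del: sphere_inverse.simps)
qed

lemma nicely_meromorphic_sph_analytic:
  assumes g: "g nicely_meromorphic_on UNIV"
  shows "(\<lambda>w. if is_pole g w then Infty else Fin (g w)) sph_analytic_on UNIV"
proof (rule sph_analytic_onI)
  fix w :: complex
  show "\<exists>B h U. B \<in> {id, sphere_inverse} \<and> open U \<and> w \<in> U \<and> h holomorphic_on U \<and>
     (\<forall>x\<in>U. (if is_pole g x then Infty else Fin (g x)) = B (Fin (h x)))"
  proof (cases "is_pole g w")
    case False
    then have "g analytic_on {w}" using nicely_meromorphic_on_imp_analytic_at[OF g] by auto
    then obtain U where U: "open U" "w \<in> U" "g holomorphic_on U"
      by (meson analytic_at)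
    then have "\<not> is_pole g x" if "x \<in> U" for x using not_is_pole_holomorphic that by blast
    then show ?thesis using U by (intro exI[of _ id] exI[of _ g] exI[of _ U]) auto
  next
    case True
    \<comment> \<open>A nicely meromorphic function takes the default value 0 at a pole, and
      \<open>inverse 0 = 0\<close> is exactly the value that removes the singularity of
      \<open>1/g\<close> there.\<close>
    have gw: "g w = 0"
      using g True unfolding nicely_meromorphic_on_def
      by (metis UNIV_I not_tendsto_and_filterlim_at_infinity trivial_limit_at is_pole_def)
    have "g meromorphic_on {w}" using g meromorphic_on_subset unfolding nicely_meromorphic_on_def by blast
    then have "isolated_singularity_at g w"
      by (simp add: meromorphic_at_iff)
    then obtain r1 where r1: "r1 > 0" "g analytic_on ball w r1 - {w}"
      unfolding isolated_singularity_at_def by blast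
    have "\<forall>\<^sub>F x in at w. g x \<noteq> 0" using True by (rule non_zero_neighbour_pole)
    then obtain r2 where r2: "r2 > 0" "\<And>x. x \<noteq> w \<Longrightarrow> dist x w < r2 \<Longrightarrow> g x \<noteq> 0"
      unfolding eventually_at by auto
    define U where "U = ball w (min r1 r2)"
    have U: "open U" "w \<in> U" using r1 r2 by (auto simp: U_def)
    have gh: "g holomorphic_on U - {w}"
      using analytic_imp_holomorphic[OF r1(2)] by (rule holomorphic_on_subset) (auto simp: U_def)
    have nz: "g x \<noteq> 0" if "x \<in> U - {w}" for x using r2(2)[of x] that by (auto simp: U_def dist_commute)
    have np: "\<not> is_pole g x" if "x \<in> U - {w}" for x
      using not_is_pole_holomorphic[OF _ that gh] U by (simp add: open_Diff)
    have hh: "(\<lambda>x. inverse (g x)) holomorphic_on U - {w}"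
      using nz by (intro holomorphic_intros gh) auto
    have "((\<lambda>x. inverse (g x)) \<longlongrightarrow> 0) (at w)"
      using True unfolding is_pole_def using tendsto_inverse_0 filterlim_compose by blast
    then have "isCont (\<lambda>x. inverse (g x)) w" using gw by (simp add: isCont_def)
    moreover have "isCont (\<lambda>x. inverse (g x)) x" if "x \<in> U - {w}" for x
      using holomorphic_on_imp_continuous_on[OF hh] U that
      by (metis continuous_on_eq_continuous_at open_delete)
    ultimately have "continuous_on U (\<lambda>x. inverse (g x))"
      by (metis DiffI continuous_at_imp_continuous_on singletonD)
    then have "(\<lambda>x. inverse (g x)) holomorphic_on U"
      using no_isolated_singularity[OF _ hh U(1)] by auto
    then show ?thesis using U True nz np gw
      by (intro exI[of _ sphere_inverse] exI[of _ "\<lambda>x. inverse (g x)"] exI[of _ U]) auto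
  qed
qed

lemma meromorphic_map_analytic:
  assumes "g nicely_meromorphic_on UNIV"
  shows "analytic_sphere_map (meromorphic_map g)"
proof
  define f where "f = meromorphic_map g"
  have dom: "{x. f x \<noteq> None} = - {Infty}"
  proof -
    have "f x \<noteq> None \<longleftrightarrow> x \<noteq> Infty" for x by (cases x) (auto simp: f_def)
    then show ?thesis by auto
  qed
  then show "open {x. meromorphic_map g x \<noteq> None}" by (simp add: f_def open_Compl)
  have 1: "(\<lambda>w. the (f (Fin w))) sph_analytic_on UNIV"
    using nicely_meromorphic_sph_analytic[OF assms] by (simp add: f_def)
  have "(\<lambda>w. the (f (Fin (inverse w)))) sph_analytic_on (- {0})"
    by (rule sph_analytic_on_compose[OF 1]) (auto intro!: holomorphic_intros simp: open_Compl)
  then have 2: "(\<lambda>w. the (f (sphere_inverse (Fin w)))) sph_analytic_on (- {0})"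
    by (rule sph_analytic_on_cong[rotated 2]) (auto simp: open_Compl)
  have "{w. Fin w \<in> - {Infty}} = UNIV" "{w. sphere_inverse (Fin w) \<in> - {Infty}} = - {0}" by auto
  then show "sph_selfmap_analytic_on (\<lambda>x. the (meromorphic_map g x)) {x. meromorphic_map g x \<noteq> None}"
    unfolding sph_selfmap_analytic_on_def f_def[symmetric] dom using 1 2
    by (simp del: sphere_inverse.simps)
qed

section \<open>Lifting through inverse branches\<close>

lemma openin_stereo_image:
  assumes "open T" "T \<subseteq> B"
  shows "openin (top_of_set (stereo ` B)) (stereo ` T)"
proof -
  have "stereo ` T = stereo ` B \<inter> inv stereo -` T"
    using assms(2) inj_stereo by (auto simp: image_iff)
  then show ?thesis
    using continuous_openin_preimage_gen[OF continuous_on_subset[OF continuous_on_inv_stereo] assms(1), of "stereo ` B"]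
    by auto
qed

context analytic_sphere_map
begin

text \<open>If \<open>\<psi>2 x = \<psi>1 y\<close>, applying \<open>f\<close> and the injectivity
  of \<open>F\<close> give \<open>x = y\<close>. So the set of agreement is the preimage under
  \<open>\<psi>2\<close> of the open image of \<open>\<psi>1\<close>, hence open; it is closed by
  continuity.\<close>

lemma sections_eq:
  fixes F :: "'a::metric_space \<Rightarrow> riemann_sphere"
  assumes "connected T" "open T"
    and "continuous_on T \<psi>1" "continuous_on T \<psi>2" "\<And>W. open W \<Longrightarrow> W \<subseteq> T \<Longrightarrow> open (\<psi>1 ` W)"
    and f: "\<And>x. x \<in> T \<Longrightarrow> f (\<psi>1 x) = Some (F x)" "\<And>x. x \<in> T \<Longrightarrow> f (\<psi>2 x) = Some (F x)"
    and inj: "inj_on F T"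
    and "u \<in> T" "\<psi>1 u = \<psi>2 u" "x \<in> T"
  shows "\<psi>1 x = \<psi>2 x"
proof -
  define E where "E = {x \<in> T. \<psi>1 x = \<psi>2 x}"
  have "E = T \<inter> \<psi>2 -` (\<psi>1 ` T)"
  proof -
    have "\<psi>1 x = \<psi>2 x" if "x \<in> T" "y \<in> T" "\<psi>2 x = \<psi>1 y" for x y
      using f[OF that(1)] f[OF that(2)] that inj by (simp add: inj_on_eq_iff)
    then have "x \<in> E" if "x \<in> T" "\<psi>2 x \<in> \<psi>1 ` T" for x
      using that unfolding E_def by blast
    moreover have "\<psi>2 x \<in> \<psi>1 ` T" "x \<in> T" if "x \<in> E" for x
      using that unfolding E_def by (metis (mono_tags, lifting) imageI mem_Collect_eq)+
    ultimately show ?thesis by blast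
  qed
  then have "openin (top_of_set T) E"
    using continuous_openin_preimage_gen[OF assms(4)] assms(5)[OF assms(2)] by simp
  moreover have "closedin (top_of_set T) E"
  proof -
    have "E = T \<inter> (\<lambda>x. dist (\<psi>1 x) (\<psi>2 x)) -` {0}" by (auto simp: E_def)
    moreover have "continuous_on T (\<lambda>x. dist (\<psi>1 x) (\<psi>2 x))"
      by (intro continuous_intros assms)
    ultimately show ?thesis using continuous_closedin_preimage[of T "\<lambda>x. dist (\<psi>1 x) (\<psi>2 x)" "{0}"] by auto
  qed
  ultimately have "E = T"
    using assms(1,9,10) unfolding connected_clopen E_def by blast
  then show ?thesis using assms(11) by (auto simp: E_def)
qed

text \<open>The neighbourhood is shrunk to a disc in a chart: over a connected set, two sections
  that meet are equal, which makes the sheets of the covering disjoint.\<close>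

lemma connected_inverse_branches:
  assumes "v \<notin> singular_values f"
  obtains T where "open T" "connected T" "v \<in> T" "T \<inter> singular_values f = {}"
    "\<And>w u. u \<in> T \<Longrightarrow> f w = Some u \<Longrightarrow> \<exists>\<psi>. sph_selfmap_analytic_on \<psi> T \<and> continuous_on T \<psi> \<and>
        (\<forall>W. open W \<and> W \<subseteq> T \<longrightarrow> open (\<psi> ` W)) \<and> (\<forall>x\<in>T. f (\<psi> x) = Some x) \<and> \<psi> u = w"
proof -
  obtain V where V: "open V" "v \<in> V" "V \<inter> singular_values f = {}"
    and br: "\<And>w u. u \<in> V \<Longrightarrow> f w = Some u \<Longrightarrow> \<exists>\<psi>. sph_selfmap_analytic_on \<psi> V \<and> inj_on \<psi> V \<and>
        (\<forall>x\<in>V. f (\<psi> x) = Some x) \<and> \<psi> u = w"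
    using local_inverse_branches[OF assms] by metis
  obtain e where e: "v \<noteq> e" by (metis riemann_sphere.distinct(1))
  have "open {u. chart e u \<in> V}" "coord e v \<in> {u. chart e u \<in> V}"
    using open_chart_vimage[OF V(1)] e V(2) by auto
  then obtain \<delta> where \<delta>: "\<delta> > 0" "ball (coord e v) \<delta> \<subseteq> {u. chart e u \<in> V}"
    using open_contains_ball by blast
  define T where "T = chart e ` ball (coord e v) \<delta>"
  have T: "open T" "connected T" "v \<in> T" "T \<subseteq> V"
  proof -
    show "open T" unfolding T_def by (intro open_chart_image) auto
    show "connected T" unfolding T_def
      by (intro connected_continuous_image continuous_on_chart) auto
    show "v \<in> T" unfolding T_def using \<delta>(1) e by (auto simp: image_iff intro!: bexI[of _ "coord e v"])
    show "T \<subseteq> V" using \<delta>(2) by (auto simp: T_def)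
  qed
  show ?thesis
  proof (rule that[OF T(1-3)])
    show "T \<inter> singular_values f = {}" using T V by blast
    fix w u assume u: "u \<in> T" "f w = Some u"
    obtain \<psi> where \<psi>: "sph_selfmap_analytic_on \<psi> V" "inj_on \<psi> V" "\<forall>x\<in>V. f (\<psi> x) = Some x" "\<psi> u = w"
      using br[OF subsetD[OF T(4) u(1)] u(2)] by blast
    have an: "sph_selfmap_analytic_on \<psi> T"
      using \<psi>(1) T(4) unfolding sph_selfmap_analytic_on_def
      by (metis (mono_tags, lifting) Collect_mono sph_analytic_on_subset subsetD)
    have "open (\<psi> ` W)" if W: "open W" "W \<subseteq> T" for W
    proof -
      define A where "A = {u. chart e u \<in> W}"
      have A: "open A" unfolding A_def by (rule open_chart_vimage[OF W(1)])
      have img: "chart e ` A = W" using W(2) by (auto simp: A_def T_def)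
      have "(\<lambda>u. \<psi> (chart e u)) sph_analytic_on A"
        by (rule sph_selfmap_analytic_on_compose[OF an sph_analytic_on_subset[OF chart_analytic] A])
          (use img W in auto)
      moreover have "inj_on (\<psi> \<circ> chart e) A"
        by (rule comp_inj_on)
          (use inj_chart[of e] inj_on_subset in blast, use \<psi>(2) img W(2) T(4) inj_on_subset in blast)
      then have "inj_on (\<lambda>u. \<psi> (chart e u)) A" by (simp add: o_def)
      ultimately have "open ((\<lambda>u. \<psi> (chart e u)) ` A)"
        using open_image_sph_analytic A by blast
      then show ?thesis using image_image[of \<psi> "chart e" A] img by simp
    qed
    then show "\<exists>\<psi>. sph_selfmap_analytic_on \<psi> T \<and> continuous_on T \<psi> \<and>
        (\<forall>W. open W \<and> W \<subseteq> T \<longrightarrow> open (\<psi> ` W)) \<and> (\<forall>x\<in>T. f (\<psi> x) = Some x) \<and> \<psi> u = w"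
      using an \<psi> T(1,4) sph_selfmap_analytic_on_imp_continuous_on[OF an] by (intro exI[of _ \<psi>]) auto
  qed
qed

definition regular_domain :: "riemann_sphere set" where
  "regular_domain = {x. \<exists>v. f x = Some v \<and> v \<notin> singular_values f}"

text \<open>A covering map must be onto, whereas an open set of values that are never attained
  satisfies the condition on inverse branches vacuously. Hence the restriction to attained
  values.\<close>

definition regular_range :: "riemann_sphere set" where
  "regular_range = {v. v \<notin> singular_values f \<and> (\<exists>x. f x = Some v)}"

text \<open>The library's covering space lifting theorem is stated for subsets of normed vector spaces,
  so the sphere is embedded by \<^const>\<open>stereo\<close>.\<close>

lemma covering_space_regular:
  "covering_space (stereo ` regular_domain) (\<lambda>a. stereo (the (f (inv stereo a)))) (stereo ` regular_range)"
    (is "covering_space ?C ?p ?S")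
proof
  have inv [simp]: "inv stereo (stereo x) = x" for x using inj_stereo by simp
  have "regular_domain \<subseteq> {x. f x \<noteq> None}" by (auto simp: regular_domain_def)
  then have "continuous_on regular_domain (\<lambda>x. the (f x))" using continuous continuous_on_subset by blast
  then have "continuous_on ?C (\<lambda>a. the (f (inv stereo a)))"
    by (rule continuous_on_compose2[OF _ continuous_on_subset[OF continuous_on_inv_stereo]]) auto
  then show contp: "continuous_on ?C ?p" by (simp add: continuous_on_stereo_iff)
  show "?p ` ?C = ?S"
    by (force simp: regular_domain_def regular_range_def image_iff)
  fix y assume "y \<in> ?S"
  then obtain v where v: "y = stereo v" "v \<in> regular_range" by auto
  then have "v \<notin> singular_values f" by (simp add: regular_range_def)
  then obtain T where T: "open T" "connected T" "v \<in> T" "T \<inter> singular_values f = {}"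
    and br: "\<And>w u. u \<in> T \<Longrightarrow> f w = Some u \<Longrightarrow> \<exists>\<psi>. sph_selfmap_analytic_on \<psi> T \<and> continuous_on T \<psi> \<and>
        (\<forall>W. open W \<and> W \<subseteq> T \<longrightarrow> open (\<psi> ` W)) \<and> (\<forall>x\<in>T. f (\<psi> x) = Some x) \<and> \<psi> u = w"
    using connected_inverse_branches by metis
  define sec where "sec \<psi> \<longleftrightarrow> continuous_on T \<psi> \<and>
        (\<forall>W. open W \<and> W \<subseteq> T \<longrightarrow> open (\<psi> ` W)) \<and> (\<forall>x\<in>T. f (\<psi> x) = Some x)" for \<psi>
  have br: "\<exists>\<psi>. sec \<psi> \<and> \<psi> u = w" if "u \<in> T" "f w = Some u" for u w
    using br[OF that] unfolding sec_def by blast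
  obtain x0 where x0: "f x0 = Some v" using v by (auto simp: regular_range_def)
  obtain \<psi>0 where "sec \<psi>0" using br[OF T(3) x0] by blast
  then have TS: "T \<subseteq> regular_range" using T(4) by (fastforce simp: regular_range_def sec_def)
  have secim: "\<psi> ` T \<subseteq> regular_domain" if "sec \<psi>" for \<psi>
    using that T(4) by (auto simp: regular_domain_def sec_def)
  define VV where "VV = {stereo ` \<psi> ` T |\<psi>. sec \<psi>}"
  show "\<exists>T'. y \<in> T' \<and> openin (top_of_set ?S) T' \<and>
     (\<exists>v. \<Union> v = ?C \<inter> ?p -` T' \<and> (\<forall>u\<in>v. openin (top_of_set ?C) u) \<and> pairwise disjnt v \<and>
       (\<forall>u\<in>v. \<exists>q. homeomorphism u T' ?p q))"
  proof (intro exI[of _ "stereo ` T"] conjI exI[of _ VV])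
    show "y \<in> stereo ` T" using v T by auto
    show "openin (top_of_set ?S) (stereo ` T)" by (rule openin_stereo_image[OF T(1) TS])
    show "\<Union> VV = ?C \<inter> ?p -` stereo ` T"
    proof (intro equalityI subsetI)
      fix a assume "a \<in> \<Union> VV"
      then obtain \<psi> u where "sec \<psi>" "u \<in> T" "a = stereo (\<psi> u)" by (auto simp: VV_def)
      moreover from this have "f (\<psi> u) = Some u" by (simp add: sec_def)
      ultimately show "a \<in> ?C \<inter> ?p -` stereo ` T" using secim by auto
    next
      fix a assume "a \<in> ?C \<inter> ?p -` stereo ` T"
      then obtain x u where x: "x \<in> regular_domain" "a = stereo x" "stereo (the (f x)) = stereo u" "u \<in> T"
        by auto
      then have "f x = Some u" using inj_stereo by (auto simp: regular_domain_def inj_eq)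
      then obtain \<psi> where "sec \<psi>" "\<psi> u = x" using br x by blast
      then show "a \<in> \<Union> VV" using x by (auto simp: VV_def)
    qed
    show "\<forall>u\<in>VV. openin (top_of_set ?C) u"
    proof
      fix U assume "U \<in> VV"
      then obtain \<psi> where "sec \<psi>" "U = stereo ` \<psi> ` T" by (auto simp: VV_def)
      then show "openin (top_of_set ?C) U"
        using openin_stereo_image[of "\<psi> ` T" regular_domain] secim T(1) by (auto simp: sec_def)
    qed
    show "pairwise disjnt VV"
    proof (rule pairwiseI)
      fix U U' assume "U \<in> VV" "U' \<in> VV" "U \<noteq> U'"
      then obtain \<psi> \<psi>' where *: "sec \<psi>" "U = stereo ` \<psi> ` T" "sec \<psi>'" "U' = stereo ` \<psi>' ` T"
        by (auto simp: VV_def)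
      show "disjnt U U'"
      proof (rule ccontr)
        assume "\<not> disjnt U U'"
        then obtain u u' where u: "u \<in> T" "u' \<in> T" "\<psi> u = \<psi>' u'"
          using * inj_stereo by (auto simp: disjnt_iff inj_eq)
        have s: "continuous_on T \<psi>" "continuous_on T \<psi>'" "\<And>W. open W \<Longrightarrow> W \<subseteq> T \<Longrightarrow> open (\<psi> ` W)"
          "\<And>x. x \<in> T \<Longrightarrow> f (\<psi> x) = Some x" "\<And>x. x \<in> T \<Longrightarrow> f (\<psi>' x) = Some x"
          using *(1,3) unfolding sec_def by blast+
        have "u = u'" using s(4)[OF u(1)] s(5)[OF u(2)] u(3) by simp
        then have "\<psi> x = \<psi>' x" if "x \<in> T" for x
          using u(3) by (intro sections_eq[OF T(2,1) s inj_on_id2 u(1) _ that]) simp_all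
        then have "\<psi> ` T = \<psi>' ` T" by (rule image_cong[OF refl])
        then show False using * \<open>U \<noteq> U'\<close> by simp
      qed
    qed
    show "\<forall>u\<in>VV. \<exists>q. homeomorphism u (stereo ` T) ?p q"
    proof
      fix U assume "U \<in> VV"
      then obtain \<psi> where \<psi>: "sec \<psi>" "U = stereo ` \<psi> ` T" by (auto simp: VV_def)
      have f\<psi>: "f (\<psi> u) = Some u" if "u \<in> T" for u using \<psi> that by (auto simp: sec_def)
      have "homeomorphism U (stereo ` T) ?p (\<lambda>b. stereo (\<psi> (inv stereo b)))"
      proof (rule homeomorphismI)
        show "continuous_on U ?p"
          by (rule continuous_on_subset[OF contp]) (use \<psi> secim in auto)
        have "continuous_on (stereo ` T) (\<lambda>b. \<psi> (inv stereo b))"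
          using \<psi> unfolding sec_def
          by (intro continuous_on_compose2[of T \<psi>, OF _ continuous_on_subset[OF continuous_on_inv_stereo]]) auto
        then show "continuous_on (stereo ` T) (\<lambda>b. stereo (\<psi> (inv stereo b)))"
          by (simp add: continuous_on_stereo_iff)
      qed (use \<psi> f\<psi> in auto)
      then show "\<exists>q. homeomorphism U (stereo ` T) ?p q" by blast
    qed
  qed
qed

text \<open>One preimage of one point yields a section over a whole neighbourhood, so both the
  attained and the unattained regular values form open sets, and a connected set of regular values
  cannot contain both kinds.\<close>

lemma connected_image_subset_regular_range:
  assumes "continuous_on A F" "connected A" "F ` A \<inter> singular_values f = {}"
    and "w0 \<in> A" "f x0 = Some (F w0)"
  shows "F ` A \<subseteq> regular_range"
proof -
  define N where "N = {v. v \<notin> singular_values f \<and> (\<nexists>x. f x = Some v)}"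
  have nb: "\<exists>T. open T \<and> v \<in> T \<and> (T \<subseteq> regular_range \<or> T \<subseteq> N)" if v: "v \<notin> singular_values f" for v
  proof -
    obtain T where T: "open T" "v \<in> T" "T \<inter> singular_values f = {}"
      and br: "\<And>w u. u \<in> T \<Longrightarrow> f w = Some u \<Longrightarrow> \<exists>\<psi>. sph_selfmap_analytic_on \<psi> T \<and> continuous_on T \<psi> \<and>
        (\<forall>W. open W \<and> W \<subseteq> T \<longrightarrow> open (\<psi> ` W)) \<and> (\<forall>x\<in>T. f (\<psi> x) = Some x) \<and> \<psi> u = w"
      using connected_inverse_branches[OF v] by metis
    then have "T \<subseteq> regular_range" if "u \<in> T" "f w = Some u" for u w
      using br[OF that] T(3) unfolding regular_range_def by blast
    moreover have "T \<subseteq> N" if "\<nexists>u w. u \<in> T \<and> f w = Some u" using T(3) that by (auto simp: N_def)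
    ultimately show ?thesis using T by blast
  qed
  have "N \<inter> regular_range = {}" by (auto simp: N_def regular_range_def)
  have "open regular_range"
  proof (subst open_subopen, rule ballI)
    fix v assume v: "v \<in> regular_range"
    then obtain T where "open T" "v \<in> T" "T \<subseteq> regular_range \<or> T \<subseteq> N"
      using nb[of v] by (auto simp: regular_range_def)
    then show "\<exists>T. open T \<and> v \<in> T \<and> T \<subseteq> regular_range"
      using v \<open>N \<inter> regular_range = {}\<close> by blast
  qed
  moreover have "open N"
  proof (subst open_subopen, rule ballI)
    fix v assume v: "v \<in> N"
    then obtain T where "open T" "v \<in> T" "T \<subseteq> regular_range \<or> T \<subseteq> N"
      using nb[of v] by (auto simp: N_def)
    then show "\<exists>T. open T \<and> v \<in> T \<and> T \<subseteq> N"
      using v \<open>N \<inter> regular_range = {}\<close> by blast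
  qed
  moreover have "connected (F ` A)" using assms by (intro connected_continuous_image)
  moreover have "F ` A \<subseteq> regular_range \<union> N" using assms(3) by (auto simp: N_def regular_range_def)
  moreover have "F w0 \<in> regular_range" using assms by (auto simp: regular_range_def)
  ultimately have "F ` A \<inter> N = {}"
    using connectedD[of "F ` A" regular_range N] assms(4) \<open>N \<inter> regular_range = {}\<close> by blast
  then show ?thesis using \<open>F ` A \<subseteq> regular_range \<union> N\<close> by blast
qed

text \<open>The lift exists because \<open>A\<close> is simply connected and \<open>f\<close> is a
  covering over its regular range. It is analytic because locally it is a local inverse branch
  composed with \<open>F\<close>.\<close>

lemma lift_inverse_branch:
  assumes A: "open A" "simply_connected A" and F: "F sph_analytic_on A" "F ` A \<inter> singular_values f = {}"
    and w0: "w0 \<in> A" "f x0 = Some (F w0)"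
  obtains G where "G sph_analytic_on A" "\<And>w. w \<in> A \<Longrightarrow> f (G w) = Some (F w)" "G w0 = x0"
proof -
  have inv [simp]: "inv stereo (stereo x) = x" for x using inj_stereo by simp
  have contF: "continuous_on A F" by (rule sph_analytic_on_imp_continuous_on[OF F(1)])
  have range: "F ` A \<subseteq> regular_range"
    using connected_image_subset_regular_range[OF contF _ F(2) w0] A(2) simply_connected_imp_connected by blast
  obtain h where h: "continuous_on A h" "h \<in> A \<rightarrow> stereo ` regular_domain" "h w0 = stereo x0"
    "\<And>y. y \<in> A \<Longrightarrow> stereo (the (f (inv stereo (h y)))) = stereo (F y)"
  proof (rule covering_space_lift_strong[OF covering_space_regular _ w0(1) A(2)
        open_imp_locally_path_connected[OF A(1)], of "stereo x0" "\<lambda>w. stereo (F w)"])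
    show "stereo x0 \<in> stereo ` regular_domain" using w0 F(2) by (auto simp: regular_domain_def)
    show "continuous_on A (\<lambda>w. stereo (F w))" using contF by (simp add: continuous_on_stereo_iff)
    show "(\<lambda>w. stereo (F w)) \<in> A \<rightarrow> stereo ` regular_range" using range by auto
  qed (use w0 in auto)
  define G where "G w = inv stereo (h w)" for w
  have "continuous_on A G" unfolding G_def
    by (rule continuous_on_compose2[OF continuous_on_inv_stereo h(1)]) (use h(2)[unfolded Pi_iff] in blast)
  have G: "f (G w) = Some (F w)" if w: "w \<in> A" for w
  proof -
    obtain x where "x \<in> regular_domain" "h w = stereo x" using funcset_mem[OF h(2) w] by blast
    then show ?thesis using h(4)[OF w] inj_stereo by (auto simp: G_def regular_domain_def inj_eq)
  qed
  have "G sph_analytic_on A"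
  proof (rule sph_analytic_on_locally)
    fix w1 assume w1: "w1 \<in> A"
    have "F w1 \<notin> singular_values f" using F(2) w1 by auto
    then obtain T where T: "open T" "F w1 \<in> T"
      and br: "\<And>w u. u \<in> T \<Longrightarrow> f w = Some u \<Longrightarrow> \<exists>\<psi>. sph_selfmap_analytic_on \<psi> T \<and> continuous_on T \<psi> \<and>
        (\<forall>W. open W \<and> W \<subseteq> T \<longrightarrow> open (\<psi> ` W)) \<and> (\<forall>x\<in>T. f (\<psi> x) = Some x) \<and> \<psi> u = w"
      using connected_inverse_branches by metis
    obtain \<psi> where \<psi>: "sph_selfmap_analytic_on \<psi> T" "open (\<psi> ` T)" "\<And>x. x \<in> T \<Longrightarrow> f (\<psi> x) = Some x" "\<psi> (F w1) = G w1"
      using br[OF T(2) G[OF w1]] T(1) by blast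
    \<comment> \<open>On this set \<open>G\<close> stays in the sheet \<open>\<psi>\<close> through
      \<open>G w1\<close>, and applying \<open>f\<close> identifies the point of the sheet as
      \<open>\<psi> (F w)\<close>.\<close>
    define U where "U = (F -` T \<inter> A) \<inter> (G -` (\<psi> ` T) \<inter> A)"
    have "open U" unfolding U_def
      using continuous_on_open_vimage[THEN iffD1, OF A(1) contF] T(1)
        continuous_on_open_vimage[THEN iffD1, OF A(1) \<open>continuous_on A G\<close>] \<psi>(2) by (intro open_Int[of "_ \<inter> _"]) simp_all
    have "w1 \<in> U" using w1 T \<psi>(4)[symmetric] by (auto simp: U_def)
    have "\<psi> (F w) = G w" if w: "w \<in> U" for w
    proof -
      obtain u where u: "u \<in> T" "G w = \<psi> u" using w by (auto simp: U_def)
      then have "F w = u" using \<psi>(3)[OF u(1)] G[of w] w by (auto simp: U_def)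
      then show ?thesis using u by simp
    qed
    moreover have "(\<lambda>w. \<psi> (F w)) sph_analytic_on U"
      by (rule sph_selfmap_analytic_on_compose[OF \<psi>(1) sph_analytic_on_subset[OF F(1)] \<open>open U\<close>])
        (auto simp: U_def)
    ultimately have "G sph_analytic_on U" using \<open>open U\<close> by (rule_tac sph_analytic_on_cong)
    then show "\<exists>U. open U \<and> w1 \<in> U \<and> G sph_analytic_on U" using \<open>open U\<close> \<open>w1 \<in> U\<close> by blast
  qed
  then show ?thesis using that[of G] G h(3) by (simp add: G_def)
qed

text \<open>Forward invariance of the post-singular set means that a lift of a map avoiding it
  avoids it too, so lifting can be repeated.\<close>

lemma lift_iter_inverse_branch:
  assumes A: "open A" "simply_connected A"
    and "F sph_analytic_on A" "F ` A \<inter> postsingular_set f = {}"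
    and "w0 \<in> A" "iter f n x0 = Some (F w0)"
  obtains G where "G sph_analytic_on A" "\<And>w. w \<in> A \<Longrightarrow> iter f n (G w) = Some (F w)" "G w0 = x0"
proof -
  have "\<exists>G. G sph_analytic_on A \<and> (\<forall>w\<in>A. iter f n (G w) = Some (F w)) \<and> G w0 = x0"
    using assms(3-)
  proof (induction n arbitrary: F)
    case 0
    then show ?case by (intro exI[of _ F]) auto
  next
    case (Suc n)
    obtain y0 where y0: "iter f n x0 = Some y0" "f y0 = Some (F w0)"
      using Suc.prems by (auto simp: bind_eq_Some_conv)
    have "F ` A \<inter> singular_values f = {}" using Suc.prems(2) singular_values_subset by blast
    then obtain F1 where F1: "F1 sph_analytic_on A" "\<And>w. w \<in> A \<Longrightarrow> f (F1 w) = Some (F w)" "F1 w0 = y0"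
      using lift_inverse_branch[OF A Suc.prems(1) _ Suc.prems(3) y0(2)] by metis
    have "F1 ` A \<inter> postsingular_set f = {}"
      using F1(2) Suc.prems(2) postsingular_invariant by blast
    then obtain G where "G sph_analytic_on A" "\<forall>w\<in>A. iter f n (G w) = Some (F1 w)" "G w0 = x0"
      using Suc.IH[OF F1(1) _ Suc.prems(3)] F1(3) y0(1) by auto
    then show ?case using F1(2) by (intro exI[of _ G]) auto
  qed
  then show ?thesis using that by blast
qed

end

section \<open>Normality of injective maps omitting two values\<close>

text \<open>A square root of an injective function without zeros, normalised to be 1 at 0, also omits the
  value -1, so Schottky's theorem applies to it.\<close>

lemma injective_nonzero_bound:
  obtains M :: real where "M > 0"
    "\<And>g R w. \<lbrakk>g holomorphic_on ball 0 R; inj_on g (ball 0 R); \<And>x. x \<in> ball 0 R \<Longrightarrow> g x \<noteq> 0;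
       norm w \<le> R / 4; R > 0\<rbrakk> \<Longrightarrow> norm (g w) \<le> M * norm (g 0)"
proof
  \<comment> \<open>The bound of Schottky's theorem for an initial value of norm at most 1 and
    points of norm at most 1/2. It is squared below because it controls a square root.\<close>
  define M0 :: real where "M0 = exp (pi * exp (pi * (2 + 2 * 1 + 12 * (1/2) / (1 - 1/2))))"
  show "M0\<^sup>2 > 0" by (simp add: M0_def)
  fix g R and w :: complex
  assume g: "g holomorphic_on ball 0 R" "inj_on g (ball 0 R)" "\<And>x. x \<in> ball 0 R \<Longrightarrow> g x \<noteq> 0"
    and w: "norm w \<le> R / 4" "R > 0"
  have "simply_connected (ball (0::complex) R)" by (simp add: convex_imp_simply_connected)
  then obtain h where h: "h holomorphic_on ball 0 R" "\<And>z. z \<in> ball 0 R \<Longrightarrow> g z = (h z)\<^sup>2"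
    using g simply_connected_eq_holomorphic_sqrt[of "ball 0 R"] by blast
  \<comment> \<open>The sign and scale give \<open>H 0 = -1\<close> and turn the omitted value
    \<open>- h 0\<close> into 1. The factor \<open>R/2\<close> brings the closed unit disc inside
    the domain and sends \<open>norm w \<le> R/4\<close> to radius 1/2.\<close>
  define H where "H u = - h (of_real (R/2) * u) / h 0" for u
  have inb: "of_real (R/2) * u \<in> ball 0 R" if "u \<in> cball 0 1" for u :: complex
  proof -
    have "norm (of_real (R/2) * u) = R/2 * norm u" using w by (simp add: norm_mult)
    also have "\<dots> \<le> R/2 * 1" using that w by (intro mult_left_mono) auto
    finally show ?thesis using w by simp
  qed
  have z: "0 \<in> ball 0 R" using w by simp
  have h0: "h 0 \<noteq> 0" using h(2)[OF z] g(3)[OF z] by auto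
  have "norm (H (w / of_real (R/2))) \<le> M0" unfolding M0_def
  proof (rule Schottky[where f = H and r = 1 and t = "1/2"])
    show "H holomorphic_on cball 0 1" unfolding H_def
      by (intro holomorphic_intros holomorphic_on_compose_gen[OF _ h(1), unfolded o_def] h0)
        (use inb in auto)
    show "norm (H 0) \<le> 1" using h0 by (simp add: H_def)
    show "norm (w / of_real (R/2)) \<le> 1/2" using w by (simp add: norm_divide field_simps)
    fix u :: complex assume u: "u \<in> cball 0 1"
    define x where "x = of_real (R/2) * u"
    have x: "x \<in> ball 0 R" using inb[OF u] by (simp add: x_def)
    have "h x \<noteq> 0" using g(3)[OF x] h(2)[OF x] by auto
    moreover have "h x \<noteq> - h 0"
    proof
      assume eq: "h x = - h 0"
      then have "g x = g 0" using h(2)[OF x] h(2)[OF z] by simp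
      then have "x = 0" using g(2) x z by (auto simp: inj_on_def)
      then show False using eq h0 by simp
    qed
    moreover have "- h x = H u * h 0" using h0 by (simp add: H_def x_def)
    ultimately show "\<not> (H u = 0 \<or> H u = 1)" by (auto simp: minus_equation_iff)
  qed auto
  moreover have wR: "w \<in> ball 0 R" using w by auto
  moreover have "of_real (R/2) * (w / of_real (R/2)) = w" using w by simp
  ultimately have "norm (h w) \<le> M0 * norm (h 0)"
    using h0 by (simp add: H_def norm_divide divide_le_eq)
  then have "(norm (h w))\<^sup>2 \<le> (M0 * norm (h 0))\<^sup>2" by (intro power_mono) auto
  then show "norm (g w) \<le> M0\<^sup>2 * norm (g 0)"
    using h(2)[OF wR] h(2)[OF z] by (simp add: norm_power power_mult_distrib)
qed

lemma uniform_limit_compose_uniformly_continuous: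
  fixes h :: "'b::metric_space \<Rightarrow> 'c::metric_space"
  assumes "uniform_limit S F g sequentially" "uniformly_continuous_on U h"
    and "\<And>n x. x \<in> S \<Longrightarrow> F n x \<in> U" "\<And>x. x \<in> S \<Longrightarrow> g x \<in> U"
  shows "uniform_limit S (\<lambda>n x. h (F n x)) (\<lambda>x. h (g x)) sequentially"
proof (rule uniform_limitI)
  fix e :: real assume "e > 0"
  then obtain d where d: "d > 0" "\<And>x y. x \<in> U \<Longrightarrow> y \<in> U \<Longrightarrow> dist y x < d \<Longrightarrow> dist (h y) (h x) < e"
    using assms(2) unfolding uniformly_continuous_on_def by metis
  from uniform_limitD[OF assms(1) d(1)]
  show "\<forall>\<^sub>F n in sequentially. \<forall>x\<in>S. dist (h (F n x)) (h (g x)) < e"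
    by eventually_elim (use d assms in blast)
qed

text \<open>In a coordinate with \<open>e1\<close> at 0 and \<open>e2\<close> at infinity,
  \<open>injective_nonzero_bound\<close> applies to each function and to its reciprocal, so its size
  near 0 is comparable to its size at 0 with one constant for all \<open>n\<close>. Either the sizes
  at 0 are bounded along a subsequence, and Montel's theorem applies, or they tend to infinity and
  the maps converge uniformly to \<open>e2\<close>. The radius \<open>R/8\<close> leaves a compact
  disc inside the one of radius \<open>R/4\<close>.\<close>

theorem injective_omitting_two_normal:
  fixes F :: "nat \<Rightarrow> complex \<Rightarrow> riemann_sphere"
  assumes F: "\<And>n. F n sph_analytic_on ball 0 R" and inj: "\<And>n. inj_on (F n) (ball 0 R)"
    and omit: "\<And>n. e1 \<notin> F n ` ball 0 R" "\<And>n. e2 \<notin> F n ` ball 0 R" "e1 \<noteq> e2" and R: "R > 0"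
  obtains r l where "strict_mono r" "uniform_limit (cball 0 (R/8)) (\<lambda>n. F (r n)) l sequentially"
proof -
  obtain M where M: "M > 0"
    "\<And>g R w. \<lbrakk>g holomorphic_on ball 0 R; inj_on g (ball 0 R); \<And>x. x \<in> ball 0 R \<Longrightarrow> g x \<noteq> 0;
       norm w \<le> R / 4; R > 0\<rbrakk> \<Longrightarrow> norm (g w) \<le> M * norm (g 0)"
    using injective_nonzero_bound by metis
  define c where "c = coord e2 e1"
  define G where "G n w = coord e2 (F n w) - c" for n w
  have Fne: "F n x \<noteq> e2" "F n x \<noteq> e1" if "x \<in> ball 0 R" for n x
    using omit that by (metis imageI)+
  have FG: "F n w = chart e2 (G n w + c)" if "w \<in> ball 0 R" for n w
    using Fne[OF that] by (simp add: G_def)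
  have G1: "G n holomorphic_on ball 0 R" for n
    unfolding G_def using holomorphic_on_coord[OF F _ omit(2)] by (intro holomorphic_intros) auto
  have G2: "inj_on (G n) (ball 0 R)" for n
    using inj[of n] FG[of _ n] by (simp add: inj_on_def)
  have G3: "G n x \<noteq> 0" if "x \<in> ball 0 R" for n x
  proof
    assume "G n x = 0"
    then have "F n x = chart e2 c" using FG[OF that] by simp
    also have "\<dots> = e1" using omit(3) by (simp add: c_def)
    finally show False using Fne[OF that] by simp
  qed
  have up: "norm (G n w) \<le> M * norm (G n 0)" if "norm w \<le> R/4" for n w
    by (rule M(2)[OF G1 G2 G3 that R])
  have low: "norm (G n 0) \<le> M * norm (G n w)" if "norm w \<le> R/4" for n w
  proof -
    have "norm (inverse (G n w)) \<le> M * norm (inverse (G n 0))"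
    proof (rule M(2)[OF _ _ _ that R])
      show "(\<lambda>w. inverse (G n w)) holomorphic_on ball 0 R"
        by (intro holomorphic_intros G1 G3)
      show "inj_on (\<lambda>w. inverse (G n w)) (ball 0 R)" using G2[of n] by (simp add: inj_on_def)
    qed (use G3 in auto)
    then have "inverse (norm (G n w)) \<le> M * inverse (norm (G n 0))" by (simp only: norm_inverse)
    moreover have "norm (G n w) > 0" "norm (G n 0) > 0" using G3 that R by auto
    ultimately show ?thesis by (simp add: inverse_eq_divide pos_le_divide_eq pos_divide_le_eq)
  qed
  show ?thesis
  proof (cases "\<exists>B. infinite {n. norm (G n 0) \<le> B}")
    case True
    then obtain B where B: "infinite {n. norm (G n 0) \<le> B}" by blast
    define r0 where "r0 = enumerate {n. norm (G n 0) \<le> B}"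
    have r0: "strict_mono r0" unfolding r0_def using B by (rule strict_mono_enumerate)
    have r0B: "norm (G (r0 n) 0) \<le> B" for n
      using enumerate_in_set[OF B, of n] by (simp add: r0_def)
    have bd: "norm (G (r0 n) w) \<le> M * B" if "norm w \<le> R/4" for n w
      using up[OF that, of "r0 n"] mult_left_mono[OF r0B[of n], of M] M(1) by linarith
    obtain g r where gr: "strict_mono (r :: nat \<Rightarrow> nat)"
      "\<And>K. \<lbrakk>compact K; K \<subseteq> ball 0 (R/4)\<rbrakk> \<Longrightarrow> uniform_limit K ((\<lambda>n. G (r0 n)) \<circ> r) g sequentially"
      "\<And>x. x \<in> ball 0 (R/4) \<Longrightarrow> ((\<lambda>n. G (r0 (r n)) x) \<longlonglongrightarrow> g x)"
    proof (rule Montel[of "ball 0 (R/4)" "range (\<lambda>n. G (r0 n))" "\<lambda>n. G (r0 n)"])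
      show "h holomorphic_on ball 0 (R/4)" if "h \<in> range (\<lambda>n. G (r0 n))" for h
        using that holomorphic_on_subset[OF G1, of "ball 0 (R/4)"] R subset_ball[of "R/4" R] by auto
      show "\<exists>B. \<forall>h\<in>range (\<lambda>n. G (r0 n)). \<forall>z\<in>K. norm (h z) \<le> B" if "compact K" "K \<subseteq> ball 0 (R/4)" for K
        using bd that by (intro exI[of _ "M * B"]) (auto simp: subset_iff less_imp_le)
    qed (auto simp: o_def)
    \<comment> \<open>A compact disc containing all values; the chart is uniformly continuous on it
      and so preserves uniform convergence.\<close>
    define U where "U = cball (0::complex) (M * B + norm c)"
    have ucont: "uniformly_continuous_on U (chart e2)"
      unfolding U_def by (intro compact_uniformly_continuous continuous_on_chart) auto
    have ul: "uniform_limit (cball 0 (R/8)) (\<lambda>n w. G (r0 (r n)) w + c) (\<lambda>w. g w + c) sequentially"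
      using gr(2)[of "cball 0 (R/8)"] R
      by (intro uniform_limit_intros) (auto simp: o_def subset_iff)
    have bdU: "G (r0 n) x + c \<in> U" if "x \<in> cball 0 (R/8)" for n x
      using norm_triangle_ineq[of "G (r0 n) x" c] bd[of x n] that R by (simp add: U_def)
    have gU: "g x + c \<in> U" if "x \<in> cball 0 (R/8)" for x
    proof (rule closed_sequentially)
      show "(\<lambda>n. G (r0 (r n)) x + c) \<longlonglongrightarrow> g x + c"
        using that R by (intro tendsto_intros gr(3)) auto
    qed (use bdU[OF that] in \<open>auto simp: U_def\<close>)
    have "uniform_limit (cball 0 (R/8)) (\<lambda>n w. chart e2 (G (r0 (r n)) w + c))
        (\<lambda>w. chart e2 (g w + c)) sequentially"
      by (rule uniform_limit_compose_uniformly_continuous[OF ul ucont bdU gU])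
    then have "uniform_limit (cball 0 (R/8)) (\<lambda>n. F (r0 (r n))) (\<lambda>w. chart e2 (g w + c)) sequentially"
      by (rule uniform_limit_cong'[THEN iffD1, rotated 2]) (use FG R in auto)
    then show ?thesis using that[of "r0 \<circ> r"] strict_mono_o[OF r0 gr(1)] by (simp add: o_def)
  next
    case False
    \<comment> \<open>Each bound holds for finitely many \<open>n\<close> only, so the values at 0
      tend to infinity along the whole sequence; the lower estimate spreads this over the
      disc.\<close>
    have "uniform_limit (cball 0 (R/8)) F (\<lambda>_. e2) sequentially"
    proof (rule uniform_limitI)
      fix \<epsilon> :: real assume "\<epsilon> > 0"
      then obtain B where B: "\<And>u. norm u \<ge> B \<Longrightarrow> dist (chart e2 u) e2 < \<epsilon>"
        using tendstoD[OF tendsto_chart_at_infinity[of e2]] by (auto simp: eventually_at_infinity)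
      have "finite {n. norm (G n 0) \<le> M * (B + norm c)}" using False by blast
      then have "\<forall>\<^sub>F n in sequentially. n \<notin> {n. norm (G n 0) \<le> M * (B + norm c)}"
        by (simp add: cofinite_eq_sequentially[symmetric] eventually_cofinite)
      then show "\<forall>\<^sub>F n in sequentially. \<forall>x\<in>cball 0 (R/8). dist (F n x) e2 < \<epsilon>"
      proof eventually_elim
        case (elim n)
        show ?case
        proof
          fix x :: complex assume x: "x \<in> cball 0 (R/8)"
          have "M * (B + norm c) \<le> M * norm (G n x)"
            using elim low[of x n] x R by auto
          then have "B + norm c \<le> norm (G n x)" using M(1) by simp
          then have "B \<le> norm (G n x + c)" using norm_diff_ineq[of "G n x" c] by linarith
          then show "dist (F n x) e2 < \<epsilon>" using B FG[of x n] x R by auto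
        qed
      qed
    qed
    then show ?thesis using that[of id] by (simp add: strict_mono_def)
  qed
qed

section \<open>The post-singular set is not too small\<close>

text \<open>The difference quotient \<open>k\<close> at 0 has no zeros, and for
  \<open>norm w \<ge> 1\<close> injectivity keeps \<open>\<gamma> w\<close> at a distance from
  \<open>\<gamma> 0\<close>. So \<open>1/k\<close> is entire of at most linear growth, hence affine;
  being free of zeros, it is constant.\<close>

lemma injective_entire_imp_affine:
  assumes "\<gamma> holomorphic_on UNIV" "inj \<gamma>"
  obtains a b where "a \<noteq> 0" "\<And>w. \<gamma> w = a * w + b"
proof -
  define k where "k w = (if w = 0 then deriv \<gamma> 0 else (\<gamma> w - \<gamma> 0) / w)" for w
  have k: "k holomorphic_on UNIV"
    using pole_lemma_open[OF assms(1) open_UNIV, of 0] by (simp add: k_def[abs_def] cong: if_cong)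
  have "deriv \<gamma> 0 \<noteq> 0"
    using holomorphic_injective_imp_regular[of \<gamma> UNIV 0] assms by auto
  then have k0: "k w \<noteq> 0" for w
    using assms(2) by (auto simp: k_def inj_eq)
  define h where "h w = inverse (k w)" for w
  have h: "h holomorphic_on UNIV" unfolding h_def by (intro holomorphic_intros k k0)
  have "open (\<gamma> ` ball 0 1)"
    by (rule open_mapping_thm3) (use assms holomorphic_on_subset inj_on_subset in blast)+
  then obtain \<delta> where \<delta>: "\<delta> > 0" "ball (\<gamma> 0) \<delta> \<subseteq> \<gamma> ` ball 0 1"
    unfolding open_contains_ball by (metis centre_in_ball imageI zero_less_one)
  have bd: "norm (h w) \<le> (1 / \<delta>) * norm w ^ 1" if "1 \<le> norm w" for w
  proof -
    have "\<gamma> w \<notin> \<gamma> ` ball 0 1" using that assms(2) by (auto simp: inj_eq)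
    then have "\<delta> \<le> norm (\<gamma> w - \<gamma> 0)" using \<delta> by (force simp: dist_norm norm_minus_commute)
    moreover have "h w = w / (\<gamma> w - \<gamma> 0)" using that by (auto simp: h_def k_def)
    ultimately show ?thesis using \<delta>(1)
      by (auto simp: norm_divide intro!: divide_left_mono mult_pos_pos)
  qed
  have hl: "h w = h 0 + deriv h 0 * w" for w
    using Liouville_polynomial[OF h, of 1 "1/\<delta>" 1 w] bd by simp
  have "deriv h 0 = 0"
  proof (rule ccontr)
    assume "deriv h 0 \<noteq> 0"
    then have "h (- h 0 / deriv h 0) = 0" using hl[of "- h 0 / deriv h 0"] by simp
    then show False using k0 by (simp add: h_def)
  qed
  then have "k w = k 0" for w using hl[of w] by (simp add: h_def)
  then have "\<gamma> w = k 0 * w + \<gamma> 0" for w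
  proof (cases "w = 0")
    case False
    then have "(\<gamma> w - \<gamma> 0) / w = k 0" using \<open>k w = k 0\<close> by (simp add: k_def)
    then show ?thesis using False by (simp add: field_simps)
  qed auto
  then show ?thesis using that k0 by blast
qed

text \<open>The complement of \<open>a\<close> is a plane without singular values; since it is
  simply connected, every local inverse branch extends to all of it.\<close>

lemma (in analytic_sphere_map) lift_chart:
  assumes S: "singular_values f \<subseteq> {a}" and x: "f x = Some (chart a u)"
  obtains G where "G sph_analytic_on UNIV" "\<And>w. f (G w) = Some (chart a w)" "G u = x"
proof -
  have "range (chart a) \<inter> singular_values f = {}" using S range_chart[of a] by blast
  then show ?thesis
  proof (rule lift_inverse_branch[OF open_UNIV convex_imp_simply_connected[OF convex_UNIV] chart_analytic _ UNIV_I x])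
    fix G assume "G sph_analytic_on UNIV" "\<And>w. w \<in> UNIV \<Longrightarrow> f (G w) = Some (chart a w)" "G u = x"
    then show thesis using that[of G] by simp
  qed
qed

text \<open>Otherwise there is a global inverse branch \<open>\<gamma>\<close> on the plane. It is
  entire because \<open>f\<close> is undefined at \<open>Infty\<close>, and injective because
  \<open>g\<close> undoes it. Hence it is affine and onto, and \<open>g\<close> is its affine
  inverse.\<close>

lemma transcendental_finite_postsingular_point:
  assumes g: "g nicely_meromorphic_on UNIV" "\<not> rational_function g" and f: "f = meromorphic_map g"
  obtains p where "p \<in> postsingular_set f" "p \<noteq> Infty"
proof (rule ccontr)
  assume "\<not> thesis"
  then have P: "postsingular_set f \<subseteq> {Infty}" using that by blast
  interpret analytic_sphere_map f unfolding f by (rule meromorphic_map_analytic[OF g(1)])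
  have "g meromorphic_on {0}" using g meromorphic_on_subset unfolding nicely_meromorphic_on_def by blast
  then have "eventually (\<lambda>w. \<not> is_pole g w) (at 0)"
    using eventually_not_pole by (simp add: meromorphic_at_iff)
  then obtain w where "\<not> is_pole g w" using eventually_happens[of _ "at (0::complex)"] by auto
  then have "f (Fin w) = Some (chart Infty (g w))" by (simp add: f)
  then obtain G where G: "G sph_analytic_on UNIV" "\<And>u. f (G u) = Some (chart Infty u)"
    using lift_chart[OF order_trans[OF singular_values_subset P]] by metis
  have ne: "G u \<noteq> Infty" for u using G(2)[of u] by (auto simp: f)
  define \<gamma> where "\<gamma> u = coord Infty (G u)" for u
  have G\<gamma>: "G u = Fin (\<gamma> u)" for u using chart_coord[OF ne[of u]] by (simp add: \<gamma>_def)
  have g\<gamma>: "g (\<gamma> u) = u" for u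
    using G(2)[of u] by (auto simp: G\<gamma> f split: if_splits)
  have "inj \<gamma>" by (metis g\<gamma> injI)
  moreover have "\<gamma> holomorphic_on UNIV"
    unfolding \<gamma>_def by (rule holomorphic_on_coord[OF G(1)]) (simp, metis imageE ne)
  ultimately obtain a b where ab: "a \<noteq> 0" "\<And>w. \<gamma> w = a * w + b"
    using injective_entire_imp_affine by metis
  have "g x = (x - b) / a" for x
    using g\<gamma>[of "(x - b) / a"] ab by simp
  then have "g x = poly [:- b / a, 1 / a:] x / poly 1 x" for x
    using ab by (simp add: field_simps)
  then have "rational_function g" unfolding rational_function_def
    by (intro exI[of _ "[:- b / a, 1 / a:]"] exI[of _ "1 :: complex poly"]) simp
  then show False using g(2) by simp
qed

text \<open>For all but finitely many \<open>v\<close> the polynomial \<open>p - v * q\<close> has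
  full degree, at least 2, and only simple roots.\<close>

lemma quotient_map_two_preimages:
  assumes q: "q \<noteq> 0" "coprime p q" and d: "max (degree p) (degree q) \<ge> 2"
  obtains v x1 x2 where "v \<noteq> a" "x1 \<noteq> x2" "quotient_map p q x1 = Some v" "quotient_map p q x2 = Some v"
proof -
  define d where "d = max (degree p) (degree q)"
  \<comment> \<open>The numerator of the derivative of \<open>p/q\<close>; it vanishes at every
    multiple root of \<open>p - v * q\<close>.\<close>
  define W where "W = pderiv p * q - p * pderiv q"
  have W: "W \<noteq> 0"
  proof
    assume "W = 0"
    then have eq: "pderiv p * q = p * pderiv q" by (simp add: W_def)
    \<comment> \<open>At a root of \<open>q\<close> the derivative \<open>pderiv q\<close> has one
      order less than \<open>q\<close>, and \<open>p\<close> does not vanish there, so the two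
      products have different orders.\<close>
    have "degree q = 0"
    proof (rule ccontr)
      assume deg: "degree q \<noteq> 0"
      then obtain x where x: "poly q x = 0"
        using fundamental_theorem_of_algebra[of q] by (auto simp: constant_degree)
      have q': "pderiv q \<noteq> 0" using deg by (simp add: pderiv_eq_0_iff)
      have px: "poly p x \<noteq> 0" using coprime_poly_0[OF q(2), of x] x by simp
      then have nz: "p * pderiv q \<noteq> 0" using q' by auto
      have "order x (p * pderiv q) = order x (pderiv q)"
        using order_mult[OF nz, of x] order_0I[OF px] by simp
      moreover have "order x (pderiv p * q) \<ge> order x q" using order_mult[of "pderiv p" q x] nz eq by simp
      moreover have "order x q = Suc (order x (pderiv q))"
        by (rule order_pderiv) (use q' q(1) x order_root[of q x] in auto)
      ultimately show False using eq by simp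
    qed
    moreover from this have "pderiv q = 0" by (simp add: pderiv_eq_0_iff)
    with eq q(1) have "pderiv p = 0" by simp
    then have "degree p = 0" by (simp add: pderiv_eq_0_iff)
    ultimately show False using d by simp
  qed
  \<comment> \<open>The excluded values cover the forbidden point \<open>a\<close>, the value at
    infinity, for which the degree of \<open>p - v * q\<close> drops, and the critical
    values.\<close>
  define bad where "bad = {fin_part a, coeff p d / coeff q d} \<union> (\<lambda>x. poly p x / poly q x) ` {x. poly W x = 0}"
  have "finite bad" using poly_roots_finite[OF W] by (simp add: bad_def)
  then obtain v where v: "v \<notin> bad" using ex_new_if_finite[OF infinite_UNIV_char_0] by blast
  define r where "r = p - smult v q"
  have lead: "coeff p d \<noteq> 0 \<or> coeff q d \<noteq> 0"
    unfolding d_def by (rule coeff_max_degree_neq_0[OF q(1)])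
  have "coeff r d \<noteq> 0"
    using lead v by (auto simp: r_def bad_def field_simps)
  then have deg: "2 \<le> degree r" using d le_degree[of r d] unfolding d_def by linarith
  have nq: "poly q x \<noteq> 0" if "poly r x = 0" for x
    using that coprime_poly_0[OF q(2), of x] by (auto simp: r_def)
  have "rsquarefree r" unfolding rsquarefree_roots
  proof (intro allI notI)
    fix x assume x: "poly r x = 0 \<and> poly (pderiv r) x = 0"
    then have "poly p x = v * poly q x" "poly (pderiv p) x = v * poly (pderiv q) x"
      by (simp_all add: r_def pderiv_diff pderiv_smult)
    then have "poly W x = 0" "v = poly p x / poly q x" using nq[of x] x by (simp_all add: W_def)
    then show False using v by (auto simp: bad_def)
  qed
  then have "r = smult (lead_coeff r) (\<Prod>z|poly r z = 0. [:-z, 1:])"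
    by (simp add: complex_poly_decompose_rsquarefree)
  then have "degree r \<le> degree (\<Prod>z|poly r z = 0. [:-z, 1:])"
    by (metis degree_smult_le)
  also have "\<dots> \<le> (\<Sum>z|poly r z = 0. degree [:-z, 1:])"
    using degree_prod_sum_le[of "{z. poly r z = 0}" "\<lambda>z. [:-z, 1:]"] poly_roots_finite[of r] deg
    by (cases "r = 0") (auto simp: o_def)
  also have "\<dots> = card {z. poly r z = 0}" by simp
  finally have card: "\<not> card {z. poly r z = 0} \<le> Suc 0" using deg by simp
  then have "finite {z. poly r z = 0}" using card.infinite by fastforce
  then obtain x1 x2 where x: "x1 \<noteq> x2" "poly r x1 = 0" "poly r x2 = 0"
    using card card_le_Suc0_iff_eq by blast
  have "quotient_map p q (Fin x) = Some (Fin v)" if "poly r x = 0" for x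
    using nq[OF that] that by (simp add: r_def field_simps)
  moreover have "Fin v \<noteq> a" using v by (auto simp: bad_def)
  ultimately show ?thesis using that[of "Fin v" "Fin x1" "Fin x2"] x by simp
qed

text \<open>If only \<open>a\<close> were post-singular, two preimages of one value would give two
  inverse branches on the complement of \<open>a\<close>, with disjoint images by uniqueness of
  sections. The image of \<open>G2\<close> is open, so \<open>G1\<close> omits a neighbourhood of
  the point \<open>e\<close>; in a coordinate with \<open>e\<close> at infinity it is bounded, hence
  constant, although it is injective.\<close>

lemma rational_two_postsingular_points:
  assumes q: "q \<noteq> 0" "coprime p q" and d: "max (degree p) (degree q) \<ge> 2" and f: "f = quotient_map p q"
  obtains e1 e2 where "e1 \<in> postsingular_set f" "e2 \<in> postsingular_set f" "e1 \<noteq> e2"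
proof (rule ccontr)
  assume "\<not> thesis"
  then have "\<exists>a. postsingular_set f \<subseteq> {a}" using that by blast
  then obtain a where P: "postsingular_set f \<subseteq> {a}" by blast
  interpret analytic_sphere_map f unfolding f by (rule quotient_map_analytic[OF q])
  obtain v x1 x2 where v: "v \<noteq> a" "x1 \<noteq> x2" "f x1 = Some v" "f x2 = Some v"
    using quotient_map_two_preimages[OF q d] f by metis
  have "\<exists>G. G sph_analytic_on UNIV \<and> (\<forall>u. f (G u) = Some (chart a u)) \<and> G (coord a v) = x"
    if "f x = Some v" for x
  proof -
    have "f x = Some (chart a (coord a v))" using that v(1) by simp
    from lift_chart[OF order_trans[OF singular_values_subset P] this] show ?thesis by blast
  qed
  from this[OF v(3)] this[OF v(4)]
  obtain G1 G2 where G: "G1 sph_analytic_on UNIV" "G2 sph_analytic_on UNIV"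
    "\<And>u. f (G1 u) = Some (chart a u)" "\<And>u. f (G2 u) = Some (chart a u)"
    "G1 (coord a v) = x1" "G2 (coord a v) = x2"
    by blast
  have inj: "inj G1" "inj G2"
    using G(3,4) inj_chart[of a] by (metis injI injD option.inject)+
  have op: "open (G1 ` A)" if "open A" for A
    by (rule open_image_sph_analytic[OF sph_analytic_on_subset[OF G(1)] that inj_on_subset[OF inj(1)]]) auto
  have disj: "G1 u \<noteq> G2 u'" for u u'
  proof
    assume eq: "G1 u = G2 u'"
    then have "u = u'" using G(3)[of u] G(4)[of u'] inj_chart[of a] by (simp add: inj_eq)
    with eq have "G1 u = G2 u" by simp
    have "G1 (coord a v) = G2 (coord a v)"
    proof (rule sections_eq[where T = UNIV and F = "chart a" and u = u])
      show "continuous_on UNIV G1" by (rule sph_analytic_on_imp_continuous_on[OF G(1)])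
      show "continuous_on UNIV G2" by (rule sph_analytic_on_imp_continuous_on[OF G(2)])
      show "open (G1 ` W)" if "open W" for W by (rule op[OF that])
      show "f (G1 x) = Some (chart a x)" "f (G2 x) = Some (chart a x)" for x by (rule G)+
    qed (simp_all add: \<open>G1 u = G2 u\<close> inj_chart connected_UNIV)
    then show False using G(5,6) v(2) by simp
  qed
  define e where "e = G2 0"
  have "open (range G2)" by (rule open_image_sph_analytic[OF G(2) open_UNIV inj(2)])
  then have "\<forall>\<^sub>F u in at_infinity. chart e u \<in> range G2"
    using topological_tendstoD[OF tendsto_chart_at_infinity[of e]] by (simp add: e_def)
  then obtain B where B: "\<And>u. norm u \<ge> B \<Longrightarrow> chart e u \<in> range G2"
    by (auto simp: eventually_at_infinity)
  define \<gamma> where "\<gamma> u = coord e (G1 u)" for u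
  have ne: "G1 u \<noteq> e" for u using disj by (simp add: e_def)
  have "\<gamma> holomorphic_on UNIV" unfolding \<gamma>_def
    by (rule holomorphic_on_coord[OF G(1)]) (simp, metis imageE ne)
  moreover have "bounded (range \<gamma>)"
  proof (rule boundedI)
    fix y assume "y \<in> range \<gamma>"
    then obtain u where "y = \<gamma> u" by auto
    then have "chart e y \<notin> range G2" using ne[of u] disj by (auto simp: \<gamma>_def)
    then show "norm y \<le> B" using B[of y] by linarith
  qed
  ultimately obtain c where "\<And>u. \<gamma> u = c" using Liouville_theorem[of \<gamma>] unfolding constant_on_def by blast
  then have "G1 0 = G1 1" using ne by (metis \<gamma>_def chart_coord)
  then show False using inj(1) by (metis injD zero_neq_one)
qed

section \<open>Inverse branches of iterates near a point of the Julia set\<close>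

text \<open>A uniform form of Hurwitz's theorem. If it failed, there would be values
  \<open>v j\<close> tending to \<open>g z0\<close> and omitted by functions of a subsequence; after
  subtracting them, zero-free functions would converge to \<open>g - g z0\<close>, which is not
  constant and vanishes at \<open>z0\<close>.\<close>

lemma eventually_ball_subset_image:
  assumes S: "open S" "connected S" and hol: "\<And>n::nat. \<psi> n holomorphic_on S" and g: "g holomorphic_on S"
    and lim: "\<And>K. compact K \<Longrightarrow> K \<subseteq> S \<Longrightarrow> uniform_limit K \<psi> g sequentially"
    and nonconst: "\<not> g constant_on S" and z0: "z0 \<in> S"
  obtains \<eta> where "\<eta> > 0" "\<forall>\<^sub>F n in sequentially. ball (g z0) \<eta> \<subseteq> \<psi> n ` S"
proof (rule ccontr)
  note ex = that
  assume "\<not> thesis"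
  have freq: "\<exists>\<^sub>F n in sequentially. \<not> ball (g z0) \<eta> \<subseteq> \<psi> n ` S" if e: "\<eta> > 0" for \<eta>
  proof (rule ccontr)
    assume "\<not> ?thesis"
    then have "\<forall>\<^sub>F n in sequentially. ball (g z0) \<eta> \<subseteq> \<psi> n ` S" by (simp add: not_frequently)
    then show False using ex[OF e] \<open>\<not> thesis\<close> by blast
  qed
  have "\<exists>n>N. \<exists>v. dist (g z0) v < 1 / Suc j \<and> v \<notin> \<psi> n ` S" for N j
  proof -
    have "\<exists>n\<ge>Suc N. \<not> ball (g z0) (1 / Suc j) \<subseteq> \<psi> n ` S"
      using freq[of "1 / Suc j"] by (simp add: frequently_sequentially)
    then show ?thesis by (auto simp: Suc_le_eq)
  qed
  then obtain nn vv where nv: "\<And>N j. nn N j > N" "\<And>N j. dist (g z0) (vv N j) < 1 / Suc j"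
    "\<And>N j. vv N j \<notin> \<psi> (nn N j) ` S" by metis
  \<comment> \<open>Each step takes an index beyond the previous one, so that the omitted values
    come from a genuine subsequence.\<close>
  define k where "k = rec_nat 0 (\<lambda>j prev. nn prev j)"
  have kS: "k (Suc j) = nn (k j) j" for j by (simp add: k_def)
  define r where "r j = k (Suc j)" for j
  define v where "v j = vv (k j) j" for j
  have r: "strict_mono r"
    unfolding strict_mono_Suc_iff r_def using nv(1) by (metis kS)
  have "(\<lambda>j. dist (v j) (g z0)) \<longlonglongrightarrow> 0"
  proof (rule tendsto_sandwich[OF _ _ tendsto_const LIMSEQ_inverse_real_of_nat])
    show "\<forall>\<^sub>F j in sequentially. dist (v j) (g z0) \<le> inverse (real (Suc j))"
      using nv(2) by (intro always_eventually) (simp add: v_def dist_commute less_imp_le inverse_eq_divide)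
  qed simp
  then have v: "v \<longlonglongrightarrow> g z0" using tendsto_dist_iff by blast
  have "g z0 - g z0 \<noteq> 0"
  proof (rule Hurwitz_no_zeros[OF S, where \<F> = "\<lambda>j w. \<psi> (r j) w - v j" and g = "\<lambda>w. g w - g z0"])
    show "(\<lambda>w. \<psi> (r j) w - v j) holomorphic_on S" for j by (intro holomorphic_intros hol)
    show "(\<lambda>w. g w - g z0) holomorphic_on S" by (intro holomorphic_intros g)
    show "\<not> (\<lambda>w. g w - g z0) constant_on S"
      using nonconst unfolding constant_on_def by (metis diff_add_cancel)
    show "\<psi> (r j) w - v j \<noteq> 0" if "w \<in> S" for j w
      using nv(3)[of "k j" j] that unfolding r_def v_def kS by (metis imageI right_minus_eq)
    show "uniform_limit K (\<lambda>j w. \<psi> (r j) w - v j) (\<lambda>w. g w - g z0) sequentially"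
      if "compact K" "K \<subseteq> S" for K
    proof (intro uniform_limit_intros)
      show "uniform_limit K (\<lambda>j. \<psi> (r j)) g sequentially"
        using filterlim_compose[OF lim[OF that] filterlim_subseq[OF r]] by simp
      show "uniform_limit K (\<lambda>j w. v j) (\<lambda>w. g z0) sequentially"
        by (rule uniform_limitI) (use tendstoD[OF v] in \<open>auto elim: eventually_mono\<close>)
    qed
  qed (rule z0)
  then show False by simp
qed

lemma Lipschitz_of_bounded_holomorphic:
  fixes g :: "complex \<Rightarrow> complex"
  assumes g: "g holomorphic_on ball 0 t" and bd: "\<And>w. w \<in> ball 0 t \<Longrightarrow> norm (g w) \<le> B"
    and xy: "x \<in> ball 0 (t/2)" "y \<in> ball 0 (t/2)"
  shows "norm (g x - g y) \<le> (2 * B / t) * norm (x - y)"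
proof (rule field_differentiable_bound[where S = "ball 0 (t/2)" and f' = "deriv g"])
  have t: "t > 0" using xy norm_ge_zero[of x] unfolding mem_ball_0 by linarith
  have sub: "ball 0 (t/2) \<subseteq> ball (0::complex) t" using t by (intro subset_ball) simp
  show "(g has_field_derivative deriv g z) (at z within ball 0 (t/2))" if "z \<in> ball 0 (t/2)" for z
    using holomorphic_derivI[OF g open_ball, of z] that sub has_field_derivative_at_within by blast
  show "norm (deriv g z) \<le> 2 * B / t" if z: "z \<in> ball 0 (t/2)" for z
  proof (rule field_le_epsilon)
    fix \<epsilon> :: real assume \<epsilon>: "\<epsilon> > 0"
    \<comment> \<open>Cauchy's inequality is applied with the closed disc of radius \<open>s\<close>
      inside the domain; the bound for \<open>t/2\<close> is obtained by letting \<open>s\<close>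
      increase to \<open>t/2\<close>.\<close>
    have *: "norm ((deriv ^^ 1) g z) \<le> fact 1 * B / s ^ 1" if s: "0 < s" "s < t/2" for s
    proof (rule Cauchy_inequality)
      have sb: "cball z s \<subseteq> ball 0 t"
      proof
        fix u assume "u \<in> cball z s"
        then show "u \<in> ball 0 t" using z s norm_triangle_ineq4[of u "u - z"] norm_triangle_ineq2[of u z]
          by (auto simp: dist_norm norm_minus_commute)
      qed
      show "g holomorphic_on ball z s"
        by (rule holomorphic_on_subset[OF g]) (use sb in auto)
      show "continuous_on (cball z s) g"
        by (rule holomorphic_on_imp_continuous_on[OF holomorphic_on_subset[OF g sb]])
      show "norm (g x) \<le> B" if "norm (z - x) = s" for x
        using bd sb that by (auto simp: dist_norm)
    qed (use s in auto)
    have "((\<lambda>s. B / s) \<longlongrightarrow> B / (t/2)) (at_left (t/2))"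
      using t by (intro tendsto_intros) auto
    moreover have "\<forall>\<^sub>F s in at_left (t/2). norm (deriv g z) \<le> B / s"
      unfolding eventually_at_left_field using t *
      by (intro exI[of _ 0]) auto
    ultimately have "norm (deriv g z) \<le> B / (t/2)"
      using tendsto_lowerbound by (metis trivial_limit_at_left_real)
    then show "norm (deriv g z) \<le> 2 * B / t + \<epsilon>" using \<epsilon> by (simp add: mult.commute)
  qed
qed (use xy in auto)

text \<open>The point of the Julia set is \<open>chart e0 c\<close>, which becomes the origin of a
  plane coordinate. A point where \<open>f\<close> is undefined serves as an omitted value just as
  well as a post-singular one, since it has no forward images; this is the case of
  \<open>Infty\<close> for transcendental maps.\<close>

locale julia_disc = analytic_sphere_map +
  fixes e0 :: riemann_sphere and c :: complex and R :: real and e1 e2 :: riemann_sphere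
  assumes R: "R > 0"
    and disc: "(\<lambda>w. chart e0 (c + w)) ` ball 0 R \<inter> postsingular_set f = {}"
    and e12: "e1 \<noteq> e2" "e1 \<in> postsingular_set f \<or> f e1 = None" "e2 \<in> postsingular_set f \<or> f e2 = None"
    and julia: "chart e0 c \<in> julia_set f"
begin

definition C :: "complex \<Rightarrow> riemann_sphere" where
  "C w = chart e0 (c + w)"

definition coC :: "riemann_sphere \<Rightarrow> complex" where
  "coC x = coord e0 x - c"

lemma coC_C [simp]: "coC (C w) = w"
  by (simp add: C_def coC_def)

lemma C_coC: "x \<noteq> e0 \<Longrightarrow> C (coC x) = x"
  by (simp add: C_def coC_def)

lemma C_eq_iff [simp]: "C w = C w' \<longleftrightarrow> w = w'"
  by (metis coC_C)

lemma C_neq [simp]: "C w \<noteq> e0" "e0 \<noteq> C w"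
  unfolding C_def by (rule chart_neq, rule chart_neq[symmetric])

lemma C_analytic: "C sph_analytic_on A" if "open A" for A
  unfolding C_def[abs_def]
  by (rule sph_analytic_on_compose[OF chart_analytic]) (auto intro!: holomorphic_intros that)

lemma continuous_on_C: "continuous_on A C"
  using sph_analytic_on_imp_continuous_on[OF C_analytic[OF open_UNIV]] continuous_on_subset by blast

lemma open_C_image: "open A \<Longrightarrow> open (C ` A)"
  by (rule open_image_sph_analytic[OF C_analytic]) (auto simp: inj_on_def)

lemma continuous_on_coC: "e0 \<notin> A \<Longrightarrow> continuous_on A coC"
  unfolding coC_def[abs_def] by (intro continuous_intros continuous_on_coord)

lemma continuous_on_coC_Compl: "continuous_on (- {e0}) coC"
  by (rule continuous_on_coC) simp

lemma holomorphic_on_coC: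
  assumes "F sph_analytic_on A" "open A" "e0 \<notin> F ` A"
  shows "(\<lambda>w. coC (F w)) holomorphic_on A"
  unfolding coC_def by (intro holomorphic_intros holomorphic_on_coord assms)

lemma C_notin: "w \<in> ball 0 R \<Longrightarrow> C w \<notin> postsingular_set f"
  using disc unfolding C_def by blast

definition branch :: "nat \<Rightarrow> (complex \<Rightarrow> riemann_sphere) \<Rightarrow> bool" where
  "branch m \<phi> \<longleftrightarrow> \<phi> sph_analytic_on ball 0 R \<and> (\<forall>w\<in>ball 0 R. iter f m (\<phi> w) = Some (C w))"

lemma branchD: "branch m \<phi> \<Longrightarrow> w \<in> ball 0 R \<Longrightarrow> iter f m (\<phi> w) = Some (C w)"
  by (simp add: branch_def)

lemma branch_exists:
  assumes "iter f m x0 = Some (C w0)" "w0 \<in> ball 0 R"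
  obtains \<phi> where "branch m \<phi>" "\<phi> w0 = x0"
proof (rule lift_iter_inverse_branch[OF open_ball convex_imp_simply_connected[OF convex_ball]
      C_analytic[OF open_ball] _ assms(2) assms(1)])
  show "C ` ball 0 R \<inter> postsingular_set f = {}" using C_notin by blast
  fix G assume "G sph_analytic_on ball 0 R" "\<And>w. w \<in> ball 0 R \<Longrightarrow> iter f m (G w) = Some (C w)" "G w0 = x0"
  then show thesis using that[of G] by (simp add: branch_def)
qed

text \<open>The iterate recovers the parameter from the value, so two branches of the same order can
  share a value only at the same parameter. This gives injectivity and, later, the identification of
  recurring branches.\<close>

lemma branch_eqD:
  "branch m \<phi> \<Longrightarrow> branch m \<phi>' \<Longrightarrow> w \<in> ball 0 R \<Longrightarrow> w' \<in> ball 0 R \<Longrightarrow> \<phi> w = \<phi>' w' \<Longrightarrow> w = w'"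
  by (metis C_eq_iff branchD option.inject)

lemma branch_inj: "branch m \<phi> \<Longrightarrow> inj_on \<phi> (ball 0 R)"
  by (rule inj_onI) (metis branch_eqD)

lemma branch_open: "branch m \<phi> \<Longrightarrow> open A \<Longrightarrow> A \<subseteq> ball 0 R \<Longrightarrow> open (\<phi> ` A)"
  by (rule open_image_sph_analytic)
    (auto simp: branch_def intro: sph_analytic_on_subset inj_on_subset[OF branch_inj])

lemma branch_continuous: "branch m \<phi> \<Longrightarrow> A \<subseteq> ball 0 R \<Longrightarrow> continuous_on A \<phi>"
  by (meson branch_def continuous_on_subset sph_analytic_on_imp_continuous_on)

text \<open>The condition \<open>n \<ge> 1\<close> matters: \<open>Infty\<close> itself may lie in
  the disc when \<open>f\<close> is undefined there.\<close>

lemma never_reaches_disc: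
  assumes "e \<in> postsingular_set f \<or> f e = None" "iter f n e = Some (C w)" "w \<in> ball 0 R" "n \<ge> 1"
  shows False
proof (cases "e \<in> postsingular_set f")
  case True
  then show ?thesis using postsingular_invariant_iter assms C_notin by blast
next
  case False
  then have "f e = None" using assms by blast
  then show ?thesis using assms(2,4) iter_Suc_left[of f "n - 1" e] by simp
qed

lemma branch_omits:
  assumes "branch m \<phi>" "m \<ge> 1" "e = e1 \<or> e = e2" shows "e \<notin> \<phi> ` ball 0 R"
proof
  assume "e \<in> \<phi> ` ball 0 R"
  then obtain w where "w \<in> ball 0 R" "e = \<phi> w" by auto
  then show False using never_reaches_disc[of e m w] branchD[OF assms(1)] assms e12 by auto
qed

text \<open>If a fixed disc about the point is mapped into the given disc by infinitely many iterates, each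
  having an inverse branch there, then every iterate is injective on it and omits \<open>e1\<close> and \<open>e2\<close>, so the
  point would be in the Fatou set.\<close>

lemma no_expanding_branches:
  assumes \<eta>: "\<eta> > 0" and br: "\<And>N. \<exists>m\<ge>N. \<exists>\<phi>. branch m \<phi> \<and> C ` ball 0 \<eta> \<subseteq> \<phi> ` ball 0 R"
  shows False
proof -
  have ret: "\<exists>m\<ge>N. \<exists>\<phi>. branch m \<phi> \<and> (\<forall>w\<in>ball 0 \<eta>. \<exists>u\<in>ball 0 R. C w = \<phi> u \<and> iter f m (C w) = Some (C u))" for N
  proof -
    obtain m \<phi> where m: "m \<ge> N" "branch m \<phi>" "C ` ball 0 \<eta> \<subseteq> \<phi> ` ball 0 R" using br by blast
    have "\<exists>u\<in>ball 0 R. C w = \<phi> u \<and> iter f m (C w) = Some (C u)" if "w \<in> ball 0 \<eta>" for w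
    proof -
      obtain u where "u \<in> ball 0 R" "C w = \<phi> u" using m(3) \<open>w \<in> ball 0 \<eta>\<close> by blast
      then show ?thesis using branchD[OF m(2)] by auto
    qed
    then show ?thesis using m by blast
  qed
  have def: "iter f n (C w) \<noteq> None" if "w \<in> ball 0 \<eta>" for n w
    using ret[of n] that iter_defined_mono by (metis option.distinct(1))
  define T where "T n w = the (iter f n (C w))" for n w
  have T: "iter f n (C w) = Some (T n w)" if "w \<in> ball 0 \<eta>" for n w
    using def[OF that] by (simp add: T_def)
  have T_an: "T n sph_analytic_on ball 0 \<eta>" for n
    unfolding T_def[abs_def] by (rule iter_compose_analytic[OF C_analytic[OF open_ball] open_ball def])
  \<comment> \<open>A later iterate of order \<open>m\<close> factors through \<open>T n\<close> and
    is injective on the disc because its inverse branch covers the disc.\<close>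
  have T_inj: "inj_on (T n) (ball 0 \<eta>)" for n
  proof (rule inj_onI)
    fix w w' assume w: "w \<in> ball 0 \<eta>" "w' \<in> ball 0 \<eta>" "T n w = T n w'"
    obtain m \<phi> where m: "m \<ge> n"
      "\<forall>w\<in>ball 0 \<eta>. \<exists>u\<in>ball 0 R. C w = \<phi> u \<and> iter f m (C w) = Some (C u)" using ret by blast
    obtain u u' where u: "C w = \<phi> u" "iter f m (C w) = Some (C u)" "C w' = \<phi> u'" "iter f m (C w') = Some (C u')"
      using m(2) w by meson
    have "iter f m (C w) = iter f m (C w')"
      using iter_add[of f n "m - n" "C w"] iter_add[of f n "m - n" "C w'"] m(1) w T by simp
    then have "\<phi> u = \<phi> u'" using u by simp
    then show "w = w'" using u by (metis C_eq_iff)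
  qed
  have T_omit: "e \<notin> T n ` ball 0 \<eta>" if e: "e = e1 \<or> e = e2" for e n
  proof
    assume "e \<in> T n ` ball 0 \<eta>"
    then obtain w where w: "w \<in> ball 0 \<eta>" "e = T n w" by auto
    \<comment> \<open>The order must exceed \<open>n\<close>, so that at least one step remains from
      the value \<open>e\<close> to the disc.\<close>
    obtain m \<phi> where m: "m \<ge> Suc n"
      "\<forall>w\<in>ball 0 \<eta>. \<exists>u\<in>ball 0 R. C w = \<phi> u \<and> iter f m (C w) = Some (C u)" using ret by blast
    obtain u where u: "u \<in> ball 0 R" "iter f m (C w) = Some (C u)" using m(2) w by meson
    have "iter f (m - n) e = Some (C u)"
      using iter_add[of f n "m - n" "C w"] m(1) w T u by simp
    moreover have "e \<in> postsingular_set f \<or> f e = None" using e e12(2,3) by auto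
    moreover have "1 \<le> m - n" using m(1) by linarith
    ultimately show False using never_reaches_disc[of e "m - n" u] u(1) by blast
  qed
  define V where "V = C ` ball 0 (\<eta>/8)"
  have sub: "ball 0 (\<eta>/8) \<subseteq> ball (0::complex) \<eta>" using \<eta> by (intro subset_ball) simp
  have "normal_family_on V (range (\<lambda>n w. the (iter f n w)))"
    unfolding normal_family_on_def
  proof (intro allI impI)
    fix s :: "nat \<Rightarrow> riemann_sphere \<Rightarrow> riemann_sphere"
    assume "range s \<subseteq> range (\<lambda>n w. the (iter f n w))"
    then have "\<forall>j. \<exists>n. s j = (\<lambda>w. the (iter f n w))" by blast
    then obtain N where N: "\<And>j. s j = (\<lambda>w. the (iter f (N j) w))" by metis
    obtain r l where r: "strict_mono r" and l: "uniform_limit (cball 0 (\<eta>/8)) (\<lambda>n. T (N (r n))) l sequentially"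
      using injective_omitting_two_normal[of "\<lambda>j. T (N j)" \<eta> e1 e2] T_an T_inj T_omit e12(1) \<eta> by blast
    have "uniform_limit K (\<lambda>n. s (r n)) (\<lambda>x. l (coC x)) sequentially" if "K \<subseteq> V" for K
    proof (rule uniform_limitI)
      fix \<epsilon> :: real assume "\<epsilon> > 0"
      from uniform_limitD[OF l this]
      show "\<forall>\<^sub>F n in sequentially. \<forall>x\<in>K. dist (s (r n) x) (l (coC x)) < \<epsilon>"
      proof eventually_elim
        case (elim n)
        show ?case
        proof
          fix x assume "x \<in> K"
          then obtain w where "x = C w" "w \<in> ball 0 (\<eta>/8)" using \<open>K \<subseteq> V\<close> by (auto simp: V_def)
          then show "dist (s (r n) x) (l (coC x)) < \<epsilon>" using elim by (auto simp: N T_def)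
        qed
      qed
    qed
    then show "\<exists>r l. strict_mono r \<and>
        (\<forall>K. compact K \<and> K \<subseteq> V \<longrightarrow> uniform_limit K (\<lambda>n. s (r n)) l sequentially)"
      using r by blast
  qed
  moreover have "open V" unfolding V_def by (rule open_C_image) simp
  moreover have "chart e0 c \<in> V"
  proof -
    have "C 0 \<in> V" using \<eta> by (auto simp: V_def)
    then show ?thesis by (simp add: C_def)
  qed
  moreover have "\<forall>n. \<forall>w\<in>V. iter f n w \<noteq> None" using def sub by (auto simp: V_def)
  ultimately have "chart e0 c \<in> fatou_set f" unfolding fatou_set_def by blast
  then show False using julia by (simp add: julia_set_def)
qed

text \<open>The base points \<open>w k\<close> move because a branch that is only known to meet a
  small disc need not fix the centre. As they shrink to 0 and their images to the centre, the limit
  does fix 0, and near 0 the branches can be read in the plane coordinate.\<close>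

lemma branch_sequence_limit:
  assumes br: "\<And>k. branch (m k) (\<phi> k)" "\<And>k. m k \<ge> 1"
    and w: "w \<longlonglongrightarrow> 0" "\<And>k. w k \<in> ball 0 R" "(\<lambda>k. \<phi> k (w k)) \<longlonglongrightarrow> C 0"
  obtains r t g where "strict_mono r" "0 < t" "t \<le> R" "g 0 = 0" "g holomorphic_on ball 0 t"
    "\<And>k. e0 \<notin> \<phi> (r k) ` ball 0 t"
    "\<And>k. (\<lambda>w. coC (\<phi> (r k) w)) holomorphic_on ball 0 t"
    "uniform_limit (ball 0 t) (\<lambda>k w. coC (\<phi> (r k) w)) g sequentially"
proof -
  have an: "\<phi> k sph_analytic_on ball 0 R" for k using br by (simp add: branch_def)
  have om1: "e1 \<notin> \<phi> k ` ball 0 R" and om2: "e2 \<notin> \<phi> k ` ball 0 R" for k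
    using branch_omits[OF br] by simp_all
  obtain r l where r: "strict_mono r" and l: "uniform_limit (cball 0 (R/8)) (\<lambda>k. \<phi> (r k)) l sequentially"
    using injective_omitting_two_normal[where F = \<phi>, OF an branch_inj[OF br(1)] om1 om2 e12(1) R]
    by metis
  have sub: "cball 0 (R/8) \<subseteq> ball (0::complex) R" using R by auto
  have contl: "continuous_on (cball 0 (R/8)) l"
    by (rule uniform_limit_theorem[OF _ l])
      (use branch_continuous[OF br(1) sub] in \<open>auto intro!: always_eventually\<close>)
  have z: "0 \<in> cball 0 (R/8)" using R by simp
  have wr: "(\<lambda>k. w (r k)) \<longlonglongrightarrow> 0" using LIMSEQ_subseq_LIMSEQ[OF w(1) r] by (simp add: o_def)
  have win: "\<forall>\<^sub>F k in sequentially. w (r k) \<in> cball 0 (R/8)"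
  proof -
    have "\<forall>\<^sub>F k in sequentially. dist (w (r k)) 0 < R/8" using tendstoD[OF wr, of "R/8"] R by simp
    then show ?thesis by eventually_elim simp
  qed
  have l0: "l 0 = C 0"
  proof -
    have "(\<lambda>k. l (w (r k))) \<longlonglongrightarrow> l 0"
      by (rule continuous_on_tendsto_compose[OF contl wr z win])
    moreover have "(\<lambda>k. dist (l (w (r k))) (\<phi> (r k) (w (r k)))) \<longlonglongrightarrow> 0"
    proof (rule tendstoI)
      fix \<epsilon> :: real assume "\<epsilon> > 0"
      from uniform_limitD[OF l this] win
      show "\<forall>\<^sub>F k in sequentially. dist (dist (l (w (r k))) (\<phi> (r k) (w (r k)))) 0 < \<epsilon>"
        by eventually_elim (simp add: dist_commute)
    qed
    ultimately have "(\<lambda>k. dist (l (w (r k))) (\<phi> (r k) (w (r k))) + dist (l (w (r k))) (l 0)) \<longlonglongrightarrow> 0"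
      using tendsto_add[of _ 0 sequentially _ 0] tendsto_dist_iff[of "\<lambda>k. l (w (r k))" "l 0"] by simp
    then have "(\<lambda>k. dist (\<phi> (r k) (w (r k))) (l 0)) \<longlonglongrightarrow> 0"
      by (rule tendsto_sandwich[OF _ _ tendsto_const, rotated 2])
        (auto intro!: always_eventually simp: dist_triangle3)
    then have "(\<lambda>k. \<phi> (r k) (w (r k))) \<longlonglongrightarrow> l 0"
      by (subst tendsto_dist_iff)
    moreover have "(\<lambda>k. \<phi> (r k) (w (r k))) \<longlonglongrightarrow> C 0"
      using LIMSEQ_subseq_LIMSEQ[OF w(3) r] by (simp add: o_def)
    ultimately show ?thesis using LIMSEQ_unique by blast
  qed
  have "open (C ` ball 0 1)" by (rule open_C_image) simp
  moreover have "C 0 \<in> C ` ball 0 1" by simp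
  ultimately obtain \<epsilon> where \<epsilon>: "\<epsilon> > 0" "ball (C 0) \<epsilon> \<subseteq> C ` ball 0 1"
    unfolding open_contains_ball by blast
  obtain t0 where t0: "t0 > 0" "\<And>x. x \<in> cball 0 (R/8) \<Longrightarrow> dist x 0 < t0 \<Longrightarrow> dist (l x) (l 0) < \<epsilon>/2"
    using contl z \<epsilon>(1) unfolding continuous_on_iff by (meson half_gt_zero)
  \<comment> \<open>On this disc the limit stays within \<open>\<epsilon>/2\<close> of
    \<open>C 0\<close>, so all late branches take values in the coordinate unit disc. Its closure is
    compact and misses \<open>e0\<close>, hence \<open>coC\<close> is uniformly continuous
    there.\<close>
  define t where "t = min t0 (R/8)"
  have t: "t > 0" "t \<le> R" "ball 0 t \<subseteq> cball 0 (R/8)" "ball 0 t \<subseteq> ball (0::complex) R"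
    using t0 R by (auto simp: t_def)
  have lt: "dist (C 0) (l x) < \<epsilon>/2" if "x \<in> ball 0 t" for x
    using t0(2)[of x] that l0 t(3) by (auto simp: t_def dist_commute)
  have "\<forall>\<^sub>F k in sequentially. \<forall>x\<in>ball 0 t. \<phi> (r k) x \<in> C ` ball 0 1"
    using uniform_limitD[OF l half_gt_zero[OF \<epsilon>(1)]]
  proof eventually_elim
    case (elim k)
    show ?case
    proof
      fix x :: complex assume x: "x \<in> ball 0 t"
      have "dist (\<phi> (r k) x) (l x) < \<epsilon>/2" using elim x t(3) by blast
      then have "dist (C 0) (\<phi> (r k) x) < \<epsilon>"
        using lt[OF x] dist_triangle2[of "C 0" "\<phi> (r k) x" "l x"] by linarith
      then show "\<phi> (r k) x \<in> C ` ball 0 1" using \<epsilon>(2) by auto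
    qed
  qed
  then obtain k0 where k0: "\<And>k x. k \<ge> k0 \<Longrightarrow> x \<in> ball 0 t \<Longrightarrow> \<phi> (r k) x \<in> C ` ball 0 1"
    unfolding eventually_sequentially by blast
  \<comment> \<open>The finitely many early branches, which may leave the coordinate disc, are
    dropped.\<close>
  define r' where "r' k = r (k + k0)" for k
  have r': "strict_mono r'" using r by (simp add: r'_def strict_mono_def)
  have im: "\<phi> (r' k) x \<in> C ` ball 0 1" if "x \<in> ball 0 t" for k x
    using k0[OF _ that, of "k + k0"] by (simp add: r'_def)
  define g where "g x = coC (l x)" for x
  have ul: "uniform_limit (ball 0 t) (\<lambda>k w. coC (\<phi> (r' k) w)) g sequentially"
    unfolding g_def[abs_def]
  proof (rule uniform_limit_compose_uniformly_continuous[where U = "C ` cball 0 1"])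
    show "uniform_limit (ball 0 t) (\<lambda>k. \<phi> (r' k)) l sequentially"
      using uniform_limit_on_subset[OF l t(3)] unfolding r'_def
      by (rule filterlim_compose) (rule filterlim_add_const_nat_at_top)
    show "uniformly_continuous_on (C ` cball 0 1) coC"
      by (intro compact_uniformly_continuous continuous_on_coC compact_continuous_image continuous_on_C)
        auto
    show "\<phi> (r' k) x \<in> C ` cball 0 1" if "x \<in> ball 0 t" for k x
      by (rule subsetD[OF image_mono[OF ball_subset_cball] im[OF that]])
    show "l x \<in> C ` cball 0 1" if "x \<in> ball 0 t" for x
    proof -
      have "l x \<in> ball (C 0) \<epsilon>" using lt[OF that] \<epsilon>(1) by simp
      then have "l x \<in> C ` ball 0 1" using \<epsilon>(2) by (rule subsetD[rotated])
      then show ?thesis by (rule subsetD[OF image_mono[OF ball_subset_cball]])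
    qed
  qed
  have ne: "e0 \<notin> \<phi> (r' k) ` ball 0 t" for k
    using im[of _ k] by (metis (no_types, lifting) C_neq imageE)
  have hol: "(\<lambda>w. coC (\<phi> (r' k) w)) holomorphic_on ball 0 t" for k
    by (rule holomorphic_on_coC[OF sph_analytic_on_subset[OF an t(4)] open_ball ne])
  have "g holomorphic_on ball 0 t"
  proof (rule holomorphic_uniform_sequence[OF open_ball hol])
    fix x :: complex assume "x \<in> ball 0 t"
    then obtain d where "d > 0" "cball x d \<subseteq> ball 0 t"
      using open_contains_cball[of "ball (0::complex) t"] by blast
    then show "\<exists>d>0. cball x d \<subseteq> ball 0 t \<and>
        uniform_limit (cball x d) (\<lambda>k w. coC (\<phi> (r' k) w)) g sequentially"
      using uniform_limit_on_subset[OF ul] by blast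
  qed
  then show ?thesis
    using that[OF r' t(1,2) _ _ ne hol ul] l0 by (simp add: g_def)
qed


text \<open>If the limit were not constant, \<open>eventually_ball_subset_image\<close> would give
  one disc about the origin covered by branches of arbitrarily large order, which
  \<open>no_expanding_branches\<close> forbids. This is how the Julia set enters the shrinking of
  pullbacks.\<close>

lemma unbounded_iterates_constant_limit:
  assumes br: "\<And>k::nat. branch (m k) (\<phi> k)" and unb: "\<And>N. \<exists>\<^sub>F k in sequentially. m k \<ge> N"
    and t: "0 < t" "t \<le> R" and ne: "\<And>k. e0 \<notin> \<phi> k ` ball 0 t"
    and hol: "\<And>k. (\<lambda>w. coC (\<phi> k w)) holomorphic_on ball 0 t"
    and g: "g holomorphic_on ball 0 t" "g 0 = 0"
    and ul: "uniform_limit (ball 0 t) (\<lambda>k w. coC (\<phi> k w)) g sequentially"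
  shows "g constant_on ball 0 t"
proof (rule ccontr)
  assume "\<not> g constant_on ball 0 t"
  note nonconst = this
  have z: "0 \<in> ball 0 t" using t by simp
  have ulK: "uniform_limit K (\<lambda>k w. coC (\<phi> k w)) g sequentially" if "compact K" "K \<subseteq> ball 0 t" for K
    by (rule uniform_limit_on_subset[OF ul that(2)])
  obtain \<eta> where \<eta>: "\<eta> > 0"
    "\<forall>\<^sub>F k in sequentially. ball (g 0) \<eta> \<subseteq> (\<lambda>w. coC (\<phi> k w)) ` ball 0 t"
    by (rule eventually_ball_subset_image[OF open_ball connected_ball hol g(1) ulK nonconst z])
      (assumption | rule that)+
  show False
  proof (rule no_expanding_branches[OF \<eta>(1)])
    fix N
    have "\<exists>\<^sub>F k in sequentially. m k \<ge> N \<and> ball 0 \<eta> \<subseteq> (\<lambda>w. coC (\<phi> k w)) ` ball 0 t"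
      using frequently_eventually_frequently[OF unb[of N] \<eta>(2)] g(2) by simp
    then obtain k where k: "m k \<ge> N" "ball 0 \<eta> \<subseteq> (\<lambda>w. coC (\<phi> k w)) ` ball 0 t"
      using frequently_ex by blast
    have "C w \<in> \<phi> k ` ball 0 R" if "w \<in> ball 0 \<eta>" for w
    proof -
      obtain u where u: "u \<in> ball 0 t" "w = coC (\<phi> k u)" using k(2) \<open>w \<in> ball 0 \<eta>\<close> by blast
      then have "C w = \<phi> k u" using ne[of k] by (metis C_coC imageI)
      then show ?thesis using u t by auto
    qed
    then show "\<exists>m\<ge>N. \<exists>\<phi>. branch m \<phi> \<and> C ` ball 0 \<eta> \<subseteq> \<phi> ` ball 0 R"
      using k(1) br[of k] by blast
  qed
qed

lemma iter_chart_holomorphic: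
  assumes "iter f n (C 0) = Some (C 0)"
  obtains s where "s > 0" "\<And>w. w \<in> ball 0 s \<Longrightarrow> iter f n (C w) = Some (C (coC (the (iter f n (C w)))))"
    "(\<lambda>w. coC (the (iter f n (C w)))) holomorphic_on ball 0 s"
proof -
  define D where "D = {x. \<exists>v\<in>- {e0}. iter f n x = Some v}"
  have "open D" unfolding D_def by (rule open_iter_vimage) (simp add: open_Compl)
  then have "open (C -` D)" by (rule open_vimage) (rule continuous_on_C)
  moreover have "0 \<in> C -` D" using assms C_neq by (auto simp: D_def)
  ultimately obtain s where s: "s > 0" "ball 0 s \<subseteq> C -` D" unfolding open_contains_ball by blast
  have D: "\<exists>v. iter f n (C w) = Some v \<and> v \<noteq> e0" if "w \<in> ball 0 s" for w
    using s(2) that by (auto simp: D_def)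
  show ?thesis
  proof (rule that[OF s(1)])
    show "iter f n (C w) = Some (C (coC (the (iter f n (C w)))))" if "w \<in> ball 0 s" for w
      using D[OF that] C_coC by auto
    show "(\<lambda>w. coC (the (iter f n (C w)))) holomorphic_on ball 0 s"
    proof (rule holomorphic_on_coC[OF iter_compose_analytic[OF C_analytic[OF open_ball] open_ball] open_ball])
      show "iter f n (C w) \<noteq> None" if "w \<in> ball 0 s" for w using D[OF that] by auto
      show "e0 \<notin> (\<lambda>w. the (iter f n (C w))) ` ball 0 s" using D by fastforce
    qed
  qed
qed

lemma iter_chart_deriv_power:
  assumes fix0: "iter f m (C 0) = Some (C 0)"
    and \<mu>: "((\<lambda>w. coC (the (iter f m (C w)))) has_field_derivative \<mu>) (at 0)"
  shows "iter f (m * j) (C 0) = Some (C 0) \<and>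
    ((\<lambda>w. coC (the (iter f (m * j) (C w)))) has_field_derivative \<mu> ^ j) (at 0)"
proof (induction j)
  case (Suc j)
  define \<Phi> where "\<Phi> n w = coC (the (iter f n (C w)))" for n w
  have IH: "iter f (m * j) (C 0) = Some (C 0)" "(\<Phi> (m * j) has_field_derivative \<mu> ^ j) (at 0)"
    using Suc by (auto simp: \<Phi>_def[abs_def])
  have \<Phi>0: "\<Phi> (m * j) 0 = 0" using IH(1) by (simp add: \<Phi>_def)
  have fix': "iter f (m * Suc j) (C 0) = Some (C 0)"
    using iter_add[of f "m * j" m "C 0"] IH(1) fix0 by (simp add: add.commute)
  obtain s where s: "s > 0" "\<And>w. w \<in> ball 0 s \<Longrightarrow> iter f (m * j) (C w) = Some (C (\<Phi> (m * j) w))"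
    using iter_chart_holomorphic[OF IH(1)] unfolding \<Phi>_def by metis
  have "((\<lambda>w. \<Phi> m (\<Phi> (m * j) w)) has_field_derivative \<mu> * \<mu> ^ j) (at 0)"
    by (rule DERIV_chain2[OF _ IH(2)]) (use \<mu> \<Phi>0 in \<open>simp add: \<Phi>_def[abs_def]\<close>)
  then have "(\<Phi> (m * Suc j) has_field_derivative \<mu> * \<mu> ^ j) (at 0)"
  proof (rule has_field_derivative_transform_within_open[OF _ open_ball])
    show "0 \<in> ball 0 s" using s(1) by simp
    fix w :: complex assume w: "w \<in> ball 0 s"
    have "iter f (m * Suc j) (C w) = iter f m (C (\<Phi> (m * j) w))"
      using iter_add[of f "m * j" m "C w"] s(2)[OF w] by (simp add: add.commute)
    then show "\<Phi> m (\<Phi> (m * j) w) = \<Phi> (m * Suc j) w" by (simp only: \<Phi>_def)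
  qed
  then have "(\<Phi> (m * Suc j) has_field_derivative \<mu> ^ Suc j) (at 0)" by simp
  then show ?case using fix' by (simp only: \<Phi>_def[abs_def])
next
  case 0
  show ?case by (simp add: DERIV_ident)
qed

lemma iter_branch_deriv_inverse:
  assumes \<psi>: "\<psi> holomorphic_on ball 0 s" "s > 0" "\<psi> 0 = 0"
    and inv: "\<And>w. w \<in> ball 0 s \<Longrightarrow> iter f n (C (\<psi> w)) = Some (C w)"
    and \<nu>: "((\<lambda>w. coC (the (iter f n (C w)))) has_field_derivative \<nu>) (at 0)"
  shows "\<nu> * deriv \<psi> 0 = 1"
proof -
  have "(\<psi> has_field_derivative deriv \<psi> 0) (at 0)"
    by (rule holomorphic_derivI[OF \<psi>(1) open_ball]) (use \<psi>(2) in simp)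
  then have "((\<lambda>w. coC (the (iter f n (C (\<psi> w))))) has_field_derivative \<nu> * deriv \<psi> 0) (at 0)"
    by (rule DERIV_chain2[rotated]) (use \<nu> \<psi>(3) in simp)
  then have "((\<lambda>w. w) has_field_derivative \<nu> * deriv \<psi> 0) (at 0)"
    by (rule has_field_derivative_transform_within_open[of _ _ _ "ball 0 s"]) (use \<psi>(2) inv in auto)
  then show ?thesis using DERIV_unique DERIV_ident by blast
qed

text \<open>A periodic point of the Julia set off the post-singular set is repelling.\<close>

lemma fixed_branch_deriv:
  assumes br: "branch m \<phi>" "m \<ge> 1" and g: "g holomorphic_on ball 0 s" "g 0 = 0" "0 < s" "s \<le> R"
    and \<phi>g: "\<And>w. w \<in> ball 0 s \<Longrightarrow> \<phi> w = C (g w)"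
  shows "norm (deriv g 0) < 1"
proof (rule ccontr)
  assume "\<not> norm (deriv g 0) < 1"
  then have ge1: "norm (deriv g 0) \<ge> 1" by simp
  have z: "0 \<in> ball 0 R" using R by simp
  have fix0: "iter f m (C 0) = Some (C 0)"
    using branchD[OF br(1) z] \<phi>g[of 0] g by simp
  obtain s1 where "s1 > 0" "(\<lambda>w. coC (the (iter f m (C w)))) holomorphic_on ball 0 s1"
    using iter_chart_holomorphic[OF fix0] by metis
  then obtain \<mu> where \<mu>: "((\<lambda>w. coC (the (iter f m (C w)))) has_field_derivative \<mu>) (at 0)"
    using holomorphic_derivI[OF _ open_ball] by (metis centre_in_ball)
  have "iter f m (C (g w)) = Some (C w)" if "w \<in> ball 0 s" for w
    using branchD[OF br(1), of w] \<phi>g[OF that] that g(4) by auto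
  then have "\<mu> * deriv g 0 = 1" by (rule iter_branch_deriv_inverse[OF g(1,3,2) _ \<mu>])
  then have \<mu>1: "norm \<mu> \<le> 1"
    using ge1 by (metis mult_le_cancel_left1 mult_right_le_one_le norm_ge_zero norm_mult norm_one
        order_trans zero_less_one mult.commute mult_left_mono mult_1_right)
  have pow: "iter f (m * j) (C 0) = Some (C 0)"
    "((\<lambda>w. coC (the (iter f (m * j) (C w)))) has_field_derivative \<mu> ^ j) (at 0)" for j
    using iter_chart_deriv_power[OF fix0 \<mu>] by blast+
  \<comment> \<open>The branches fixing the centre for all multiples of \<open>m\<close> have
    inverse powers of \<open>\<mu>\<close> as derivatives at 0, so norm at least 1; yet their orders
    tend to infinity, so their limit is constant.\<close>
  have "\<exists>\<xi>. branch (m * Suc k) \<xi> \<and> \<xi> 0 = C 0" for k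
    using branch_exists[OF pow(1) z] by metis
  then obtain \<xi> where \<xi>: "\<And>k. branch (m * Suc k) (\<xi> k)" "\<And>k. \<xi> k 0 = C 0" by metis
  obtain r t h where rt: "strict_mono r" "0 < t" "t \<le> R" "h 0 = 0" "h holomorphic_on ball 0 t"
    "\<And>k. e0 \<notin> \<xi> (r k) ` ball 0 t"
    "\<And>k. (\<lambda>w. coC (\<xi> (r k) w)) holomorphic_on ball 0 t"
    "uniform_limit (ball 0 t) (\<lambda>k w. coC (\<xi> (r k) w)) h sequentially"
  proof (rule branch_sequence_limit[of "\<lambda>k. m * Suc k" \<xi> "\<lambda>k. 0"])
    show "1 \<le> m * Suc k" for k using br(2) by simp
  qed (use \<xi> R in auto)
  have "h constant_on ball 0 t"
  proof (rule unbounded_iterates_constant_limit[OF \<xi>(1) _ rt(2,3,6,7,5,4,8)])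
    fix N
    have "N \<le> m * Suc (r k)" if "k \<ge> N" for k
    proof -
      have "N \<le> Suc (r k)" using seq_suble[OF rt(1), of k] that by linarith
      also have "\<dots> \<le> m * Suc (r k)" using mult_le_mono1[OF br(2), of "Suc (r k)"] by simp
      finally show ?thesis .
    qed
    then have "\<forall>\<^sub>F k in sequentially. N \<le> m * Suc (r k)"
      unfolding eventually_sequentially by blast
    then show "\<exists>\<^sub>F k in sequentially. N \<le> m * Suc (r k)"
      by (rule eventually_frequently[OF sequentially_bot])
  qed
  then have h: "h w = 0" if "w \<in> ball 0 t" for w
    using that rt(2,4) unfolding constant_on_def by (metis centre_in_ball)
  have "\<forall>\<^sub>F k in sequentially. \<forall>w\<in>ball 0 t. dist (coC (\<xi> (r k) w)) (h w) < t / 4"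
    by (rule uniform_limitD[OF rt(8)]) (use rt(2) in simp)
  then obtain k where k': "\<forall>w\<in>ball 0 t. dist (coC (\<xi> (r k) w)) (h w) < t / 4"
    using eventually_happens'[OF sequentially_bot] by blast
  have k: "norm (coC (\<xi> (r k) w)) < t / 4" if "w \<in> ball 0 t" for w
    using bspec[OF k' that] h[OF that] by simp
  define \<psi> where "\<psi> w = coC (\<xi> (r k) w)" for w
  have \<psi>: "\<psi> holomorphic_on ball 0 t" "\<psi> 0 = 0" using rt(7) \<xi>(2) by (simp_all add: \<psi>_def[abs_def])
  have C\<psi>: "C (\<psi> w) = \<xi> (r k) w" if "w \<in> ball 0 t" for w
    using rt(6)[of k] that by (metis C_coC \<psi>_def imageI)
  have "\<mu> ^ Suc (r k) * deriv \<psi> 0 = 1"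
  proof (rule iter_branch_deriv_inverse[OF \<psi>(1) rt(2) \<psi>(2) _ pow(2)])
    show "iter f (m * Suc (r k)) (C (\<psi> w)) = Some (C w)" if "w \<in> ball 0 t" for w
      using branchD[OF \<xi>(1), of w "r k"] C\<psi>[OF that] that rt(3) by auto
  qed
  then have "norm (\<mu> ^ Suc (r k)) * norm (deriv \<psi> 0) = 1" by (metis norm_mult norm_one)
  moreover have "norm (\<mu> ^ Suc (r k)) \<le> 1" using \<mu>1 by (simp add: norm_power power_le_one del: power_Suc)
  ultimately have d1: "norm (deriv \<psi> 0) \<ge> 1"
    by (metis mult_left_le_one_le norm_ge_zero)
  \<comment> \<open>Values below \<open>t/4\<close> on the circle of radius \<open>t/2\<close> make
    the derivative at most 1/2, against the lower bound 1.\<close>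
  have "norm ((deriv ^^ 1) \<psi> 0) \<le> fact 1 * (t / 4) / (t / 2) ^ 1"
  proof (rule Cauchy_inequality)
    show "\<psi> holomorphic_on ball 0 (t/2)"
      by (rule holomorphic_on_subset[OF \<psi>(1)]) (use rt(2) in \<open>auto intro: subset_ball\<close>)
    show "continuous_on (cball 0 (t/2)) \<psi>"
      by (rule holomorphic_on_imp_continuous_on[OF holomorphic_on_subset[OF \<psi>(1)]]) (use rt(2) in auto)
    show "norm (\<psi> x) \<le> t / 4" if "norm (0 - x) = t / 2" for x
      using k[of x] that rt(2) by (simp add: \<psi>_def)
  qed (use rt(2) in auto)
  then show False using d1 rt(2) by simp
qed

text \<open>The radius \<open>r/2\<close> serves twice. A pullback inside such a disc that meets the
  disc of radius \<open>r\<close> about 0 stays within \<open>r + r/2 + r/2 = 2 * r\<close>, and it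
  is too small to contain the disc of radius \<open>r\<close>. The first alternative is the inverse
  branch along the cycle of a periodic centre.\<close>

definition good :: "real \<Rightarrow> bool" where
  "good r \<longleftrightarrow> (\<forall>m\<ge>1. \<forall>\<phi>. branch m \<phi> \<longrightarrow> \<phi> ` ball 0 (2 * r) \<inter> C ` ball 0 (2 * r) \<noteq> {} \<longrightarrow>
     \<phi> 0 = C 0 \<and> \<phi> ` ball 0 (2 * r) \<subseteq> C ` ball 0 (2 * r) \<or>
     (\<exists>x. \<phi> ` ball 0 (2 * r) \<subseteq> C ` ball x (r / 2)))"

text \<open>Otherwise a null sequence of radii comes with violating branches, which have a limit
  \<open>g\<close> along a subsequence. If \<open>g\<close> is constant, the branches shrink by a
  large factor and meet the second alternative of \<open>good\<close>. If not, their orders stay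
  bounded, so one order recurs; its branches agree with \<open>g\<close> near 0, and
  \<open>fixed_branch_deriv\<close> yields a contraction fixing 0, the first alternative.\<close>

lemma good_radius_exists:
  assumes "\<rho> > 0"
  obtains r where "0 < r" "r < \<rho>" "2 * r < R" "good r"
proof (rule ccontr)
  assume no: "\<not> thesis"
  define \<rho>' where "\<rho>' = min \<rho> (R / 2)"
  have \<rho>': "\<rho>' > 0" using assms R by (simp add: \<rho>'_def)
  \<comment> \<open>The shift by 2 makes every \<open>q k\<close> strictly smaller than
    \<open>\<rho>'\<close>, the first one included.\<close>
  define q where "q k = \<rho>' / real (k + 2)" for k :: nat
  have q: "0 < q k" "q k < \<rho>" "2 * q k < R" for k
  proof -
    show "0 < q k" using \<rho>' by (simp add: q_def)
    have "q k < \<rho>'" using \<rho>' by (simp add: q_def pos_divide_less_eq)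
    then show "q k < \<rho>" "2 * q k < R" by (auto simp: \<rho>'_def)
  qed
  have q0: "q \<longlonglongrightarrow> 0" unfolding q_def
    by (rule real_tendsto_divide_at_top[OF tendsto_const])
      (intro filterlim_compose[OF filterlim_real_sequentially] filterlim_add_const_nat_at_top)
  have ng: "\<not> good (q k)" for k using no that[OF q] by blast
  have "\<exists>m \<phi>. m \<ge> 1 \<and> branch m \<phi> \<and>
      \<phi> ` ball 0 (2 * q k) \<inter> C ` ball 0 (2 * q k) \<noteq> {} \<and>
      \<not> (\<phi> 0 = C 0 \<and> \<phi> ` ball 0 (2 * q k) \<subseteq> C ` ball 0 (2 * q k)) \<and>
      (\<forall>x. \<not> \<phi> ` ball 0 (2 * q k) \<subseteq> C ` ball x (q k / 2))" for k
    using ng[of k] unfolding good_def not_all not_imp de_Morgan_disj not_ex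
    by (elim exE conjE) (intro exI conjI; assumption)
  then obtain m \<phi> where m\<phi>: "\<And>k. m k \<ge> 1 \<and> branch (m k) (\<phi> k) \<and>
      \<phi> k ` ball 0 (2 * q k) \<inter> C ` ball 0 (2 * q k) \<noteq> {} \<and>
      \<not> (\<phi> k 0 = C 0 \<and> \<phi> k ` ball 0 (2 * q k) \<subseteq> C ` ball 0 (2 * q k)) \<and>
      (\<forall>x. \<not> \<phi> k ` ball 0 (2 * q k) \<subseteq> C ` ball x (q k / 2))"
    by metis
  note br = m\<phi>[THEN conjunct1] m\<phi>[THEN conjunct2, THEN conjunct1]
  note meet = m\<phi>[THEN conjunct2, THEN conjunct2, THEN conjunct1]
  note bad1 = m\<phi>[THEN conjunct2, THEN conjunct2, THEN conjunct2, THEN conjunct1]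
  note bad2 = m\<phi>[THEN conjunct2, THEN conjunct2, THEN conjunct2, THEN conjunct2, THEN spec]
  have "\<exists>w u. w \<in> ball 0 (2 * q k) \<and> u \<in> ball 0 (2 * q k) \<and> \<phi> k w = C u" for k
  proof -
    from meet[of k] obtain x where x: "x \<in> \<phi> k ` ball 0 (2 * q k)" "x \<in> C ` ball 0 (2 * q k)"
      unfolding ex_in_conv[symmetric] Int_iff by (elim exE conjE)
    from x(1) obtain w where w: "x = \<phi> k w" "w \<in> ball 0 (2 * q k)" by (rule imageE)
    from x(2) obtain u where u: "x = C u" "u \<in> ball 0 (2 * q k)" by (rule imageE)
    show ?thesis using w u by (intro exI[of _ w] exI[of _ u]) simp
  qed
  then obtain w u where wu: "\<And>k. w k \<in> ball 0 (2 * q k)" "\<And>k. u k \<in> ball 0 (2 * q k)" "\<And>k. \<phi> k (w k) = C (u k)"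
    by metis
  have small: "v \<longlonglongrightarrow> 0" if "\<And>k. v k \<in> ball 0 (2 * q k)" for v :: "nat \<Rightarrow> complex"
  proof (rule Lim_null_comparison)
    show "\<forall>\<^sub>F k in sequentially. norm (v k) \<le> 2 * q k"
      using that by (auto intro!: always_eventually less_imp_le)
    show "(\<lambda>k. 2 * q k) \<longlonglongrightarrow> 0" using tendsto_mult_right_zero[OF q0, of 2] by simp
  qed
  have "(\<lambda>k. C (u k)) \<longlonglongrightarrow> C 0"
    by (rule continuous_on_tendsto_compose[OF continuous_on_C[of UNIV] small[OF wu(2)]]) auto
  then have lim: "(\<lambda>k. \<phi> k (w k)) \<longlonglongrightarrow> C 0" by (simp add: wu(3))
  have wR: "w k \<in> ball 0 R" for k using wu(1)[of k] q(3)[of k] by simp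
  obtain r t g where rt: "strict_mono r" "0 < t" "t \<le> R" "g 0 = 0" "g holomorphic_on ball 0 t"
    "\<And>k. e0 \<notin> \<phi> (r k) ` ball 0 t"
    "\<And>k. (\<lambda>w. coC (\<phi> (r k) w)) holomorphic_on ball 0 t"
    "uniform_limit (ball 0 t) (\<lambda>k w. coC (\<phi> (r k) w)) g sequentially"
    by (rule branch_sequence_limit[of m \<phi> w, OF br(2) br(1) small[OF wu(1)] wR lim])
      (rule that, assumption+)
  define \<psi> where "\<psi> k w = coC (\<phi> (r k) w)" for k w
  have C\<psi>: "\<phi> (r k) w = C (\<psi> k w)" if "w \<in> ball 0 t" for k w
    using rt(6)[of k] that by (metis C_coC \<psi>_def imageI)
  have ul: "uniform_limit (ball 0 t) \<psi> g sequentially" using rt(8) by (simp add: \<psi>_def[abs_def])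
  have ulK: "uniform_limit K \<psi> g sequentially" if "compact K" "K \<subseteq> ball 0 t" for K
    by (rule uniform_limit_on_subset[OF ul that(2)])
  have hol\<psi>: "\<psi> k holomorphic_on ball 0 t" for k using rt(7) by (simp add: \<psi>_def[abs_def])
  have qr: "(\<lambda>k. q (r k)) \<longlonglongrightarrow> 0" using LIMSEQ_subseq_LIMSEQ[OF q0 rt(1)] by (simp add: o_def)
  have qsmall: "\<forall>\<^sub>F k in sequentially. q (r k) < \<epsilon>" if "\<epsilon> > 0" for \<epsilon>
    using order_tendstoD(2)[OF qr that] .
  have z: "0 \<in> ball 0 t" using rt(2) by simp
  show False
  proof (cases "g constant_on ball 0 t")
    case True
    then have g0: "g w = 0" if "w \<in> ball 0 t" for w
      using that z rt(4) unfolding constant_on_def by metis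
    \<comment> \<open>The bound \<open>t/16\<close> on the disc of radius \<open>t\<close> gives the
      Lipschitz constant 1/8 on the half disc, which contains the disc of radius
      \<open>2 * q\<close>. Its image then has radius at most \<open>q/4\<close> about the image of
      0.\<close>
    have "\<forall>\<^sub>F k in sequentially. q (r k) < t / 4 \<and> (\<forall>w\<in>ball 0 t. dist (\<psi> k w) (g w) < t / 16)"
      using uniform_limitD[OF ul, of "t/16"] qsmall[of "t/4"] rt(2) by (simp add: eventually_conj)
    then obtain k where k: "q (r k) < t / 4" "\<And>w. w \<in> ball 0 t \<Longrightarrow> norm (\<psi> k w) \<le> t / 16"
      using g0 by (force simp: eventually_sequentially)
    have "\<phi> (r k) w \<in> C ` ball (\<psi> k 0) (q (r k) / 2)" if w: "w \<in> ball 0 (2 * q (r k))" for w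
    proof -
      have "w \<in> ball 0 (t / 2)" using w k(1) by simp
      then have "norm (\<psi> k w - \<psi> k 0) \<le> (2 * (t / 16) / t) * norm (w - 0)"
        by (intro Lipschitz_of_bounded_holomorphic[OF hol\<psi> k(2)]) (use rt(2) in auto)
      also have "\<dots> = norm w / 8" using rt(2) by simp
      also have "\<dots> < q (r k) / 2" using w by (simp add: q) (use q(1)[of "r k"] in linarith)
      finally have "\<psi> k w \<in> ball (\<psi> k 0) (q (r k) / 2)" by (simp add: dist_norm norm_minus_commute)
      moreover have "w \<in> ball 0 t" using w k(1) rt(2) by simp
      ultimately show ?thesis using C\<psi>[of w k] by blast
    qed
    then show False using bad2[of "r k" "\<psi> k 0"] by blast
  next
    case False
    have "\<not> (\<forall>N. \<exists>\<^sub>F k in sequentially. m (r k) \<ge> N)"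
      using unbounded_iterates_constant_limit[of "\<lambda>k. m (r k)" "\<lambda>k. \<phi> (r k)", OF br(2) _ rt(2,3,6,7,5,4,8)] False
      by blast
    then obtain N where "\<forall>\<^sub>F k in sequentially. \<exists>i\<in>{..<N}. m (r k) = i"
      by (auto simp: not_frequently not_le)
    then have "\<exists>\<^sub>F k in sequentially. \<exists>i\<in>{..<N}. m (r k) = i"
      by (rule eventually_frequently[OF sequentially_bot])
    then obtain m0 where m0: "\<exists>\<^sub>F k in sequentially. m (r k) = m0"
      unfolding frequently_bex_finite_distrib[OF finite_lessThan] by blast
    obtain \<eta> where \<eta>: "\<eta> > 0" "\<forall>\<^sub>F k in sequentially. ball (g 0) \<eta> \<subseteq> \<psi> k ` ball 0 t"
      by (rule eventually_ball_subset_image[OF open_ball connected_ball hol\<psi> rt(5) ulK False z])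
        (assumption | rule that)+
    have "isCont g 0"
      using holomorphic_on_imp_continuous_on[OF rt(5)] z by (simp add: continuous_on_eq_continuous_at)
    then obtain s0 where s0: "s0 > 0" "\<And>w. dist w 0 < s0 \<Longrightarrow> dist (g w) (g 0) < \<eta> / 2"
      using \<eta>(1) unfolding continuous_at_eps_delta by (metis half_gt_zero)
    define s where "s = min s0 t"
    have s: "0 < s" "s \<le> t" using s0 rt(2) by (auto simp: s_def)
    have "\<forall>\<^sub>F k in sequentially. ball 0 \<eta> \<subseteq> \<psi> k ` ball 0 t \<and> \<psi> k ` ball 0 s \<subseteq> ball 0 \<eta>"
      using \<eta>(2) uniform_limitD[OF ul half_gt_zero[OF \<eta>(1)]]
    proof eventually_elim
      case (elim k)
      have "norm (\<psi> k w) < \<eta>" if "w \<in> ball 0 s" for w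
      proof -
        have "dist (\<psi> k w) (g w) < \<eta> / 2" using elim(2) that s by auto
        moreover have "dist (g w) (g 0) < \<eta> / 2" using s0(2)[of w] that by (simp add: s_def)
        ultimately show ?thesis using dist_triangle_half_r[of "g w" "\<psi> k w" \<eta> 0] rt(4) by (simp add: dist_commute)
      qed
      then show ?case using elim(1) rt(4) by auto
    qed
    note ev = this
    obtain k1 where k1: "m (r k1) = m0" "ball 0 \<eta> \<subseteq> \<psi> k1 ` ball 0 t"
      using frequently_ex[OF frequently_eventually_frequently[OF m0 ev]] by blast
    \<comment> \<open>The values of the branch \<open>k\<close> near 0 are covered by the branch
      \<open>k1\<close> of the same order, and a shared value forces a shared parameter.\<close>
    have eq: "\<psi> k w = \<psi> k1 w" if k: "m (r k) = m0" "\<psi> k ` ball 0 s \<subseteq> ball 0 \<eta>" and w: "w \<in> ball 0 s" for k w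
    proof -
      have "\<psi> k w \<in> \<psi> k1 ` ball 0 t" using k w k1(2) by blast
      then obtain v where v: "v \<in> ball 0 t" "\<psi> k w = \<psi> k1 v" by auto
      have wt: "w \<in> ball 0 t" using w s by simp
      have "\<phi> (r k) w = \<phi> (r k1) v" using C\<psi> v wt by simp
      moreover have "w \<in> ball 0 R" "v \<in> ball 0 R" using wt v rt(3) by auto
      ultimately have "w = v" using branch_eqD[of m0 "\<phi> (r k)" "\<phi> (r k1)" w v] br(2)[of "r k"] br(2)[of "r k1"] k k1
        by simp
      then show ?thesis using v by simp
    qed
    \<comment> \<open>Infinitely many members of the sequence take the value
      \<open>\<psi> k1 w\<close> at \<open>w\<close>, so it is also the limit.\<close>
    have g1: "g w = \<psi> k1 w" if w: "w \<in> ball 0 s" for w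
    proof (rule ccontr)
      assume "g w \<noteq> \<psi> k1 w"
      then have "\<forall>\<^sub>F k in sequentially. \<forall>x\<in>ball 0 t. dist (\<psi> k x) (g x) < dist (\<psi> k1 w) (g w)"
        by (intro uniform_limitD[OF ul]) auto
      then obtain k where "m (r k) = m0" "\<psi> k ` ball 0 s \<subseteq> ball 0 \<eta>"
        "\<forall>x\<in>ball 0 t. dist (\<psi> k x) (g x) < dist (\<psi> k1 w) (g w)"
        using frequently_ex[OF frequently_eventually_frequently[OF m0 eventually_conj[OF ev]]] by blast
      moreover have "w \<in> ball 0 t" using w s by simp
      ultimately have "dist (\<psi> k w) (g w) < dist (\<psi> k1 w) (g w)" "\<psi> k w = \<psi> k1 w"
        using eq[of k w] w by blast+
      then show False by simp
    qed
    have \<phi>g: "\<phi> (r k) w = C (g w)" if "m (r k) = m0" "\<psi> k ` ball 0 s \<subseteq> ball 0 \<eta>" "w \<in> ball 0 s" for k w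
      using C\<psi>[of w k] eq[OF that] g1[OF that(3)] that(3) s by simp
    have gs: "g holomorphic_on ball 0 s"
      by (rule holomorphic_on_subset[OF rt(5)]) (use s in \<open>simp add: subset_ball\<close>)
    have ev': "\<forall>\<^sub>F k in sequentially. \<psi> k ` ball 0 s \<subseteq> ball 0 \<eta>"
      using ev by eventually_elim blast
    obtain k2 where k2: "m (r k2) = m0" "\<psi> k2 ` ball 0 s \<subseteq> ball 0 \<eta>"
      using frequently_ex[OF frequently_eventually_frequently[OF m0 ev']] by blast
    have "norm (deriv g 0) < 1"
      by (rule fixed_branch_deriv[OF br(2) br(1) gs rt(4) s(1) _ \<phi>g[OF k2]]) (use s rt(3) in auto)
    moreover have "(g has_field_derivative deriv g 0) (at 0)"
      by (rule holomorphic_derivI[OF rt(5) open_ball z])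
    then have "((\<lambda>h. norm (g h / h)) \<longlongrightarrow> norm (deriv g 0)) (at 0)"
      using rt(4) tendsto_norm by (fastforce simp: has_field_derivative_iff)
    ultimately have "\<forall>\<^sub>F h in at 0. norm (g h / h) < 1" by (rule order_tendstoD(2)[rotated])
    then obtain s' where s': "s' > 0" "\<And>h. h \<noteq> 0 \<Longrightarrow> norm h < s' \<Longrightarrow> norm (g h / h) < 1"
      by (auto simp: eventually_at)
    \<comment> \<open>A derivative of norm below 1 at the fixed point 0 keeps every small disc about
      0 inside itself, which the violating branches exclude.\<close>
    have gle: "norm (g h) \<le> norm h" if "norm h < s'" for h
      using s'(2)[of h] that rt(4) by (cases "h = 0") (auto simp: norm_divide divide_less_eq)
    have "\<forall>\<^sub>F k in sequentially. q (r k) < min s s' / 2 \<and> \<psi> k ` ball 0 s \<subseteq> ball 0 \<eta>"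
      by (rule eventually_conj[OF qsmall ev']) (use s(1) s'(1) in simp)
    then obtain k where k: "m (r k) = m0" "q (r k) < min s s' / 2" "\<psi> k ` ball 0 s \<subseteq> ball 0 \<eta>"
      using frequently_ex[OF frequently_eventually_frequently[OF m0]] by blast
    have "\<phi> (r k) w \<in> C ` ball 0 (2 * q (r k))" if w: "w \<in> ball 0 (2 * q (r k))" for w
    proof -
      have "w \<in> ball 0 s" "norm w < s'" using w k(2) by auto
      then show ?thesis using \<phi>g[OF k(1,3), of w] gle[of w] w by auto
    qed
    moreover have "\<phi> (r k) 0 = C 0" using \<phi>g[OF k(1,3), of 0] s(1) rt(4) by simp
    ultimately show False using bad1[of "r k"] by blast
  qed
qed

section \<open>Construction of the nice set\<close>

definition returns :: "real \<Rightarrow> nat \<Rightarrow> complex set" where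
  "returns r n = {w. \<exists>v\<in>ball 0 r. iter f n (C w) = Some (C v)}"

lemma open_returns: "open (returns r n)"
proof -
  have "open {x. \<exists>y\<in>C ` ball 0 r. iter f n x = Some y}"
    by (intro open_iter_vimage open_C_image) simp
  then have "open (C -` {x. \<exists>y\<in>C ` ball 0 r. iter f n x = Some y})"
    by (rule open_vimage) (rule continuous_on_C)
  moreover have "C -` {x. \<exists>y\<in>C ` ball 0 r. iter f n x = Some y} = returns r n"
    unfolding returns_def vimage_def by blast
  ultimately show ?thesis by simp
qed

lemma returns_0 [simp]: "returns r 0 = ball 0 r"
  by (auto simp: returns_def)

text \<open>With \<open>\<tau>\<close> the return map of order \<open>m\<close>, a point of
  \<open>X\<close> lies on the sheet \<open>\<phi>\<close> exactly if
  \<open>C x = \<phi> (\<tau> x)\<close>, a closed condition; it is open because the sheet is open.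
  So a connected set of returning points cannot leave the sheet.\<close>

lemma connected_subset_branch_image:
  assumes X: "connected X" "X \<subseteq> returns \<rho> m" and br: "branch m \<phi>" "\<rho> \<le> R"
    and x0: "x0 \<in> X" "C x0 \<in> \<phi> ` ball 0 \<rho>"
  shows "C ` X \<subseteq> \<phi> ` ball 0 \<rho>"
proof -
  define \<tau> where "\<tau> x = coC (the (iter f m (C x)))" for x
  have sub: "ball 0 \<rho> \<subseteq> ball (0::complex) R" using br(2) by (rule subset_ball)
  have \<tau>: "iter f m (C x) = Some (C (\<tau> x)) \<and> \<tau> x \<in> ball 0 \<rho>" if x: "x \<in> X" for x
  proof -
    obtain v where "v \<in> ball 0 \<rho>" "iter f m (C x) = Some (C v)" using X(2) x unfolding returns_def by blast
    then show ?thesis by (simp add: \<tau>_def)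
  qed
  have iff: "C x \<in> \<phi> ` ball 0 \<rho> \<longleftrightarrow> C x = \<phi> (\<tau> x)" if x: "x \<in> X" for x
  proof
    assume "C x \<in> \<phi> ` ball 0 \<rho>"
    then obtain u where u: "u \<in> ball 0 \<rho>" "C x = \<phi> u" by (rule imageE)
    then have "iter f m (C x) = Some (C u)" using branchD[OF br(1)] sub by auto
    then show "C x = \<phi> (\<tau> x)" using \<tau>[OF x] u by simp
  qed (use \<tau>[OF x] in auto)
  define E where "E = {x \<in> X. C x \<in> \<phi> ` ball 0 \<rho>}"
  have "open (\<phi> ` ball 0 \<rho>)" by (rule branch_open[OF br(1) open_ball sub])
  then have "openin (top_of_set X) (X \<inter> C -` (\<phi> ` ball 0 \<rho>))"
    by (rule continuous_openin_preimage_gen[OF continuous_on_C])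
  moreover have "X \<inter> C -` (\<phi> ` ball 0 \<rho>) = E" by (auto simp: E_def)
  moreover have "closedin (top_of_set X) E"
  proof -
    have "continuous_on X (\<lambda>x. the (iter f m (C x)))"
      by (rule continuous_on_compose2[OF continuous_iter[of m] continuous_on_C]) (use \<tau> in fastforce)
    then have "continuous_on X \<tau>" unfolding \<tau>_def
      by (rule continuous_on_compose2[OF continuous_on_coC_Compl])
        (use \<tau> in \<open>force+\<close>)
    then have "continuous_on X (\<lambda>x. \<phi> (\<tau> x))"
      by (rule continuous_on_compose2[OF branch_continuous[OF br(1) sub]]) (use \<tau> in blast)
    then have "continuous_on X (\<lambda>x. dist (C x) (\<phi> (\<tau> x)))"
      by (intro continuous_on_dist continuous_on_C)
    then have "closedin (top_of_set X) (X \<inter> (\<lambda>x. dist (C x) (\<phi> (\<tau> x))) -` {0})"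
      by (rule continuous_closedin_preimage) simp
    moreover have "X \<inter> (\<lambda>x. dist (C x) (\<phi> (\<tau> x))) -` {0} = E"
      using iff by (simp add: E_def set_eq_iff cong: conj_cong)
    ultimately show ?thesis by simp
  qed
  ultimately have "E = {} \<or> E = X" using X(1) by (simp add: connected_clopen)
  moreover have "x0 \<in> E" using x0 by (simp add: E_def)
  ultimately have "E = X" by auto
  show ?thesis
  proof (rule image_subsetI)
    fix x assume "x \<in> X"
    then have "x \<in> E" by (simp only: \<open>E = X\<close>)
    then show "C x \<in> \<phi> ` ball 0 \<rho>" by (simp only: E_def mem_Collect_eq)
  qed
qed

text \<open>A point of the component outside the disc of radius \<open>r\<close> lies in a connected
  piece \<open>X\<close> that meets this disc and all of whose points have a positive return time.
  At the least such time \<open>m\<close>, the iterate carries \<open>X\<close> into the component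
  for \<open>n - m\<close>, which the induction confines to the double disc. Hence \<open>X\<close>
  lies in one pullback of order \<open>m\<close> of the double disc, and \<open>good r\<close>
  confines that.\<close>

lemma component_bound:
  assumes r: "0 < r" "2 * r < R" "good r"
  shows "connected_component_set (\<Union>j\<le>n. returns r j) 0 \<subseteq> ball 0 (2 * r)"
proof (induction n rule: less_induct)
  case (less n)
  define U where "U k = connected_component_set (\<Union>j\<le>k. returns r j) 0" for k
  have op: "open (\<Union>j\<le>k. returns r j)" for k by (intro open_UN) (simp add: open_returns)
  have Uop: "open (U k)" "connected (U k)" "U k \<subseteq> (\<Union>j\<le>k. returns r j)" for k
    unfolding U_def
    by (rule open_connected_component[OF op], rule connected_connected_component, rule connected_component_subset)
  have Ball: "ball 0 r \<subseteq> U k" for k unfolding U_def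
    by (rule connected_component_maximal) (use r(1) in \<open>auto intro!: bexI[of _ 0] simp: \<close>)
  have "w \<in> ball 0 (2 * r)" if w: "w \<in> U n" for w
  proof (cases "w \<in> ball 0 r")
    case True
    then show ?thesis using r(1) by simp
  next
    case False
    define Y where "Y = U n \<inter> (\<Union>j\<in>{1..n}. returns r j)"
    have Y: "open Y" unfolding Y_def by (intro open_Int Uop open_UN) (simp add: open_returns)
    have UY: "U n \<subseteq> ball 0 r \<union> Y"
    proof
      fix x assume x: "x \<in> U n"
      then obtain j where j: "j \<le> n" "x \<in> returns r j" using Uop(3) by blast
      show "x \<in> ball 0 r \<union> Y"
      proof (cases "j = 0")
        case False
        then have "j \<in> {1..n}" using j(1) by simp
        then show ?thesis using j(2) x unfolding Y_def by blast
      qed (use j in simp)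
    qed
    then have wY: "w \<in> Y" using w False by blast
    define X where "X = connected_component_set Y w"
    have X: "open X" "connected X" "w \<in> X" "X \<subseteq> Y"
      unfolding X_def using open_connected_component[OF Y] connected_component_subset wY by auto
    \<comment> \<open>\<open>X\<close> is open and closed in \<open>Y\<close>; missing the disc, it
      would split the connected set \<open>U n\<close>.\<close>
    have "X \<inter> ball 0 r \<noteq> {}"
    proof
      assume disj: "X \<inter> ball 0 r = {}"
      have "closedin (top_of_set Y) X" unfolding X_def by (rule closedin_connected_component)
      then have "openin (top_of_set Y) (Y - X)" by (simp add: openin_diff)
      then have "open (Y - X)" using Y openin_open_eq by blast
      then have B: "open (ball 0 r \<union> (Y - X))" by auto
      have "X \<inter> U n = {} \<or> (ball 0 r \<union> (Y - X)) \<inter> U n = {}"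
        by (rule connectedD[OF Uop(2) X(1) B]) (use disj UY in blast)+
      moreover have "0 \<in> ball 0 r \<inter> U n" using Ball[of n] r(1) by (meson IntI centre_in_ball subsetD)
      ultimately show False using w X(3) by blast
    qed
    then obtain x0 where x0: "x0 \<in> X" "x0 \<in> ball 0 r" by blast
    \<comment> \<open>Time 0 is excluded because \<open>X\<close> contains points of the disc
      itself. Minimality of \<open>m\<close> leaves a remaining time between 0 and
      \<open>n - m\<close> for every point of \<open>X\<close>, and \<open>m \<ge> 1\<close> makes
      the induction hypothesis available.\<close>
    define Q where "Q j \<longleftrightarrow> j \<ge> 1 \<and> X \<inter> returns r j \<noteq> {}" for j
    obtain j0 where "j0 \<in> {1..n}" "w \<in> returns r j0" using wY by (auto simp: Y_def)
    then have j0: "Q j0" "j0 \<le> n" using X(3) unfolding Q_def by auto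
    define m where "m = (LEAST j. Q j)"
    have m: "Q m" "m \<le> n" using LeastI[of Q, OF j0(1)] Least_le[of Q, OF j0(1)] j0(2) unfolding m_def by auto
    have ret: "\<exists>y. iter f m (C x) = Some y \<and> (\<exists>j\<le>n - m. \<exists>v\<in>ball 0 r. iter f j y = Some (C v))"
      if x: "x \<in> X" for x
    proof -
      obtain j where j: "j \<in> {1..n}" "x \<in> returns r j" using X(4) x by (auto simp: Y_def)
      then have "Q j" using x unfolding Q_def by auto
      then have mj: "m \<le> j" unfolding m_def by (rule Least_le)
      obtain v where v: "v \<in> ball 0 r" "iter f j (C x) = Some (C v)" using j(2) unfolding returns_def by blast
      then have "iter f (m + (j - m)) (C x) = Some (C v)" using mj by simp
      then obtain y where "iter f m (C x) = Some y" "iter f (j - m) y = Some (C v)"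
        by (rule iter_add_SomeE)
      moreover have "j - m \<le> n - m" using j(1) by (simp add: diff_le_mono)
      ultimately show ?thesis using v(1) by blast
    qed
    define N where "N = U (n - m)"
    have N2: "N \<subseteq> ball 0 (2 * r)" using less[of "n - m"] m unfolding N_def U_def Q_def by auto
    define A where "A = (\<lambda>x. the (iter f m (C x))) ` X"
    have "continuous_on X (\<lambda>x. the (iter f m (C x)))"
      by (rule continuous_on_compose2[OF continuous_iter[of m] continuous_on_C]) (use ret in fastforce)
    then have A: "connected A" unfolding A_def using X(2) by (rule connected_continuous_image)
    obtain x1 v1 where x1: "x1 \<in> X" "v1 \<in> ball 0 r" "iter f m (C x1) = Some (C v1)"
      using m(1) unfolding Q_def returns_def by blast
    have "C v1 \<in> A" unfolding A_def using x1 by force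
    moreover have "C v1 \<in> C ` N" using x1(2) Ball unfolding N_def by blast
    ultimately have meets: "A \<inter> C ` N \<noteq> {}" by blast
    \<comment> \<open>If the connected set \<open>A\<close> left \<open>N\<close>, it would hit the
      boundary of \<open>N\<close> at a point that still returns within \<open>n - m\<close> steps;
      this point could be adjoined to the component \<open>N\<close>.\<close>
    have "A - C ` N = {}"
    proof (rule ccontr)
      assume "A - C ` N \<noteq> {}"
      then obtain y where y: "y \<in> A" "y \<in> frontier (C ` N)" using connected_Int_frontier[OF A meets] by blast
      have "open (C ` N)" unfolding N_def by (intro open_C_image Uop)
      then have yN: "y \<notin> C ` N" using y(2) frontier_disjoint_eq by blast
      have "compact (closure N)" using N2 bounded_subset[OF bounded_ball] by (simp add: compact_closure)
      then have "closed (C ` closure N)"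
        by (intro compact_imp_closed compact_continuous_image continuous_on_C)
      then have "closure (C ` N) \<subseteq> C ` closure N" by (intro closure_minimal image_mono closure_subset)
      then obtain q where q: "y = C q" "q \<in> closure N" using y(2) unfolding frontier_def by blast
      obtain x where "x \<in> X" "y = the (iter f m (C x))" using y(1) by (auto simp: A_def)
      then have "\<exists>j\<le>n - m. \<exists>v\<in>ball 0 r. iter f j y = Some (C v)" using ret[of x] by auto
      then have q': "q \<in> (\<Union>j\<le>n - m. returns r j)" unfolding returns_def q(1) by blast
      have "connected (insert q N)"
        by (rule connected_intermediate_closure[of N]) (use Uop(2) q(2) closure_subset in \<open>auto simp: N_def\<close>)
      moreover have "0 \<in> insert q N"
        using Ball[of "n - m"] r(1) unfolding N_def by (meson centre_in_ball insertI2 subsetD)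
      moreover have "insert q N \<subseteq> (\<Union>j\<le>n - m. returns r j)" using q' Uop(3) unfolding N_def by blast
      ultimately have "insert q N \<subseteq> N"
        unfolding N_def U_def by (intro connected_component_maximal)
      then show False using yN q(1) by blast
    qed
    then have AN: "A \<subseteq> C ` ball 0 (2 * r)" using N2 by blast
    have Xret: "X \<subseteq> returns (2 * r) m"
    proof
      fix x assume x: "x \<in> X"
      obtain y where y: "iter f m (C x) = Some y" using ret[OF x] by blast
      then have "y \<in> A" using x unfolding A_def by force
      then obtain v where "v \<in> ball 0 (2 * r)" "y = C v" using AN by blast
      then show "x \<in> returns (2 * r) m" using y unfolding returns_def by blast
    qed
    obtain v0 where v0: "v0 \<in> ball 0 (2 * r)" "iter f m (C x0) = Some (C v0)"
      using Xret x0(1) unfolding returns_def by blast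
    have v0R: "v0 \<in> ball 0 R" using v0(1) r(2) by simp
    obtain \<phi> where \<phi>: "branch m \<phi>" "\<phi> v0 = C x0" using branch_exists[OF v0(2) v0R] by blast
    have Cx0: "C x0 \<in> \<phi> ` ball 0 (2 * r)" using v0(1) \<phi>(2) by (metis imageI)
    have sub: "C ` X \<subseteq> \<phi> ` ball 0 (2 * r)"
      by (rule connected_subset_branch_image[OF X(2) Xret \<phi>(1) _ x0(1) Cx0]) (use r(2) in simp)
    have "C x0 \<in> C ` ball 0 (2 * r)" using x0(2) r(1) by simp
    then have "\<phi> ` ball 0 (2 * r) \<inter> C ` ball 0 (2 * r) \<noteq> {}" using Cx0 by blast
    moreover have "m \<ge> 1" using m(1) by (simp add: Q_def)
    ultimately consider "\<phi> ` ball 0 (2 * r) \<subseteq> C ` ball 0 (2 * r)"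
      | x where "\<phi> ` ball 0 (2 * r) \<subseteq> C ` ball x (r / 2)"
      using r(3) \<phi>(1) unfolding good_def by blast
    then show ?thesis
    proof cases
      case 1
      have "C w \<in> C ` ball 0 (2 * r)" using X(3) sub 1 by blast
      then show ?thesis by auto
    next
      case 2
      have "C w \<in> C ` ball x (r / 2)" "C x0 \<in> C ` ball x (r / 2)" using X(3) x0(1) sub 2 by blast+
      then have "dist x w < r / 2" "dist x x0 < r / 2" by auto
      moreover have "norm w \<le> dist x w + dist x x0 + norm x0"
        using dist_triangle[of 0 w x0] dist_triangle3[of x0 w x] by simp
      ultimately show ?thesis using x0(2) by simp
    qed
  qed
  then show ?case unfolding U_def by blast
qed

definition core :: "real \<Rightarrow> complex set" where
  "core r = connected_component_set (\<Union>j. returns r j) 0"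

lemma open_core: "open (core r)"
  unfolding core_def by (intro open_connected_component open_UN) (simp add: open_returns)

lemma connected_core: "connected (core r)"
  by (simp add: core_def)

lemma core_subset: "core r \<subseteq> (\<Union>j. returns r j)"
  unfolding core_def by (rule connected_component_subset)

lemma core_maximal:
  assumes "connected X" "X \<subseteq> (\<Union>j. returns r j)" "X \<inter> core r \<noteq> {}"
  shows "X \<subseteq> core r"
proof -
  obtain x where x: "x \<in> X" "x \<in> core r" using assms(3) by blast
  have "core r = connected_component_set (\<Union>j. returns r j) x"
    using x(2) unfolding core_def by (metis connected_component_eq)
  then show ?thesis using connected_component_maximal[OF x(1) assms(1,2)] by simp
qed

lemma ball_subset_core: "r > 0 \<Longrightarrow> ball 0 r \<subseteq> core r"
  unfolding core_def by (rule connected_component_maximal) (auto intro!: exI[of _ "0::nat"])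

text \<open>A path in the core is compact, so finitely many return times suffice along it, and
  \<open>component_bound\<close> applies.\<close>

lemma core_bound:
  assumes r: "0 < r" "2 * r < R" "good r"
  shows "core r \<subseteq> ball 0 (2 * r)"
proof
  fix w assume w: "w \<in> core r"
  have "path_connected (core r)"
    using open_core connected_core connected_open_path_connected by blast
  moreover have "0 \<in> core r" using ball_subset_core[OF r(1)] r(1) by auto
  ultimately obtain p where p: "path p" "path_image p \<subseteq> core r" "pathstart p = 0" "pathfinish p = w"
    using w unfolding path_connected_def by blast
  have "path_image p \<subseteq> (\<Union>j\<in>UNIV. returns r j)" using p(2) core_subset by blast
  then obtain J where J: "finite J" "path_image p \<subseteq> (\<Union>j\<in>J. returns r j)"
    using compactE_image[OF compact_path_image[OF p(1)], of UNIV "returns r"] open_returns by metis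
  have "J \<subseteq> {..Max J}" using J(1) by auto
  then have sub: "path_image p \<subseteq> (\<Union>j\<le>Max J. returns r j)" using J(2) by blast
  have "path_image p \<subseteq> connected_component_set (\<Union>j\<le>Max J. returns r j) 0"
    by (rule connected_component_maximal[OF _ connected_path_image[OF p(1)] sub])
      (metis p(3) pathstart_in_path_image)
  then show "w \<in> ball 0 (2 * r)"
    using component_bound[OF r] p(4) pathfinish_in_path_image by blast
qed

lemma closure_core:
  assumes "q \<in> closure (core r)" "q \<in> (\<Union>j. returns r j)" "0 < r"
  shows "q \<in> core r"
proof -
  have "connected (insert q (core r))"
    by (rule connected_intermediate_closure[OF connected_core]) (use assms closure_subset in auto)
  then have "insert q (core r) \<subseteq> core r"
    by (rule core_maximal) (use assms(2) core_subset ball_subset_core[OF assms(3)] assms(3) in auto)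
  then show ?thesis by blast
qed

text \<open>The outside of a bounded set in the plane is its single unbounded complementary
  component. Removing just this component leaves a connected set with connected complement, hence a
  simply connected one, and creates no new boundary points.\<close>

lemma filled_core_properties:
  assumes r: "0 < r" "2 * r < R" "good r"
  defines "U \<equiv> - outside (core r)"
  shows "open U" "simply_connected U" "core r \<subseteq> U" "U \<subseteq> ball 0 (2 * r)" "frontier U \<subseteq> frontier (core r)"
    and "connected (outside (core r))" "\<not> bounded (outside (core r))"
proof -
  have bd: "bounded (core r)" using core_bound[OF r] bounded_subset[OF bounded_ball] by blast
  show conO: "connected (outside (core r))" by (rule connected_outside[OF bd]) simp
  show "\<not> bounded (outside (core r))" by (rule unbounded_outside[OF bd])
  have comp: "outside (core r) \<in> components (- core r)"
    using conO outside_bounded_nonempty[OF bd] outside_in_components by blast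
  have "closed (- core r)" using open_core by (simp add: closed_Compl)
  then have "closed (outside (core r))" using comp by (rule closed_components)
  then show op: "open U" by (simp add: U_def open_Compl)
  show "core r \<subseteq> U" unfolding U_def using outside_no_overlap[of "core r"] by blast
  show Usub: "U \<subseteq> ball 0 (2 * r)"
    unfolding U_def using outside_subset_convex[OF convex_ball core_bound[OF r]] by blast
  show "frontier U \<subseteq> frontier (core r)"
    unfolding U_def frontier_complement using frontier_of_components_subset[OF comp] by simp
  have "connected U" unfolding U_def by (rule component_complement_connected[OF connected_core comp])
  moreover have "bounded U" using Usub bounded_subset[OF bounded_ball] by blast
  ultimately show "simply_connected U"
    using simply_connected_iff_simple[OF op] conO by (simp add: U_def)
qed

text \<open>Suppose \<open>\<gamma>\<close> sent a point \<open>v\<close> of a hole \<open>H\<close>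
  outside. By the Sura-Bura theorem \<open>H\<close> lies in a compact set \<open>K\<close> that is
  relatively open in the complement of the core and still avoids the outside. The part of
  \<open>\<gamma>\<close> applied to \<open>K\<close> that lies in the outside is relatively open
  and closed there, so it would be all of the unbounded outside.\<close>

lemma branch_preserves_filled_core:
  assumes r: "0 < r" "2 * r < R" "good r" and \<phi>: "branch n \<phi>"
    and C\<gamma>: "\<And>w. w \<in> ball 0 (2 * r) \<Longrightarrow> \<phi> w = C (\<gamma> w)" and sub: "\<gamma> ` core r \<subseteq> core r"
    and v: "v \<notin> outside (core r)"
  shows "\<gamma> v \<notin> outside (core r)"
proof
  assume \<gamma>v: "\<gamma> v \<in> outside (core r)"
  note U = filled_core_properties[OF r]
  have vU: "v \<in> - core r"
    using \<gamma>v sub outside_no_overlap[of "core r"] by blast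
  define H where "H = connected_component_set (- core r) v"
  have "v \<in> inside (core r)" using v vU by (simp add: inside_outside)
  then have "bounded H" unfolding H_def inside_def by blast
  have clc: "closed (- core r)" using open_core by (simp add: closed_Compl)
  then have "closed H" unfolding H_def by (rule closed_connected_component)
  then have compH: "compact H" using \<open>bounded H\<close> by (simp add: compact_eq_bounded_closed)
  have HU: "H \<subseteq> - outside (core r)"
  proof
    fix y assume "y \<in> H"
    then have "connected_component_set (- core r) y = H"
      unfolding H_def by (metis connected_component_eq)
    then show "y \<in> - outside (core r)" using \<open>bounded H\<close> unfolding outside_def by simp
  qed
  have "H \<in> components (- core r)" unfolding H_def using vU by (rule componentsI)
  then obtain K where K: "openin (top_of_set (- core r)) K" "compact K" "H \<subseteq> K" "K \<subseteq> - outside (core r)"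
    using Sura_Bura_clopen_subset[OF closed_imp_locally_compact[OF clc] _ compH U(1) HU] by blast
  obtain T where T: "open T" "K = - core r \<inter> T" using K(1) unfolding openin_open by blast
  define W where "W = T \<inter> - outside (core r)"
  have W: "open W" "W \<subseteq> ball 0 (2 * r)" "K \<subseteq> W" "W \<subseteq> T"
    unfolding W_def using T U(1,4) K(4) by auto
  have \<gamma>op: "open (\<gamma> ` B)" if B: "open B" "B \<subseteq> ball 0 (2 * r)" for B
  proof -
    have "open (\<phi> ` B)" by (rule branch_open[OF \<phi> B(1)]) (use B(2) r(2) in auto)
    then have "open (C -` (\<phi> ` B))" by (rule open_vimage) (rule continuous_on_C)
    moreover have "C -` (\<phi> ` B) = \<gamma> ` B"
    proof -
      have "\<phi> ` B = C ` \<gamma> ` B" using C\<gamma> B(2) by (auto simp: image_iff subset_iff)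
      then show ?thesis by (auto simp: vimage_def)
    qed
    ultimately show ?thesis by simp
  qed
  have cont: "continuous_on (ball 0 (2 * r)) \<gamma>"
  proof -
    have "continuous_on (ball 0 (2 * r)) (\<lambda>w. coC (\<phi> w))"
      by (rule continuous_on_compose2[OF continuous_on_coC_Compl branch_continuous[OF \<phi>]])
        (use r(2) C\<gamma> in auto)
    then show ?thesis by (rule continuous_on_eq) (simp add: C\<gamma>)
  qed
  \<comment> \<open>A point of \<open>W\<close> not in \<open>K\<close> belongs to the core, and
    \<open>\<gamma>\<close> keeps it in the core. So the compact \<open>K\<close> and the open
    \<open>W\<close> have the same images within the outside.\<close>
  have "outside (core r) \<inter> \<gamma> ` K = outside (core r) \<inter> \<gamma> ` W"
  proof -
    have "y \<in> K" if "y \<in> W" "\<gamma> y \<in> outside (core r)" for y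
    proof -
      have "y \<notin> core r" using that(2) sub outside_no_overlap[of "core r"] by blast
      then show ?thesis using that(1) W(4) T(2) by blast
    qed
    then show ?thesis using W(3) by blast
  qed
  then have "openin (top_of_set (outside (core r))) (outside (core r) \<inter> \<gamma> ` K)"
    using \<gamma>op[OF W(1,2)] by (simp add: openin_open_Int)
  moreover have compK: "compact (\<gamma> ` K)"
    by (rule compact_continuous_image[OF continuous_on_subset[OF cont] K(2)]) (use W in blast)
  then have "closedin (top_of_set (outside (core r))) (outside (core r) \<inter> \<gamma> ` K)"
    by (intro closedin_closed_Int compact_imp_closed)
  moreover have "v \<in> K" using K(3) vU unfolding H_def by auto
  then have "outside (core r) \<inter> \<gamma> ` K \<noteq> {}" using \<gamma>v by blast
  ultimately have "outside (core r) \<inter> \<gamma> ` K = outside (core r)"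
    using U(6) unfolding connected_clopen by blast
  then have "outside (core r) \<subseteq> \<gamma> ` K" by blast
  then have "bounded (outside (core r))" using compact_imp_bounded[OF compK] bounded_subset by blast
  then show False using U(7) by simp
qed

text \<open>A boundary point \<open>x\<close> of the filled core returning to a point
  \<open>v\<close> of it gives a pullback \<open>\<gamma>\<close> with
  \<open>\<gamma> v = x\<close>, and the pulled-back core consists of returning points. If it meets
  the core, it is absorbed by it, and \<open>branch_preserves_filled_core\<close> puts
  \<open>x\<close> inside. If it is disjoint, the core lies entirely in the pulled-back filled core;
  by \<open>good r\<close> that is too small to hold the disc of radius \<open>r\<close>, or else
  both cores contain 0.\<close>

lemma nice_filled_core:
  assumes r: "0 < r" "2 * r < R" "good r"
  shows "nice f (C ` (- outside (core r)))"
  unfolding nice_def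
proof (intro conjI allI impI)
  define U where "U = - outside (core r)"
  note Uf = filled_core_properties[OF r, folded U_def]
  show "open (C ` (- outside (core r)))" unfolding U_def[symmetric] by (intro open_C_image Uf)
  fix n :: nat assume n: "n > 0"
  show "{y. \<exists>x\<in>frontier (C ` (- outside (core r))). iter f n x = Some y} \<inter> C ` (- outside (core r)) = {}"
  proof (rule ccontr)
    assume "\<not> ?thesis"
    then obtain y0 v where y0: "y0 \<in> frontier (C ` U)" "iter f n y0 = Some (C v)" "v \<in> U"
      unfolding U_def by blast
    have bdU: "bounded U" using Uf(4) bounded_subset[OF bounded_ball] by blast
    have compU: "compact (closure U)" using bdU by (simp add: compact_closure)
    have "closed (C ` closure U)"
      by (intro compact_imp_closed compact_continuous_image continuous_on_C compU)
    then have "closure (C ` U) \<subseteq> C ` closure U" by (intro closure_minimal image_mono closure_subset)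
    then obtain x where x: "y0 = C x" "x \<in> closure U" using y0(1) unfolding frontier_def by blast
    have "open (C ` U)" by (intro open_C_image Uf)
    then have xU: "x \<notin> U" using y0(1) x(1) frontier_disjoint_eq by blast
    then have "x \<in> frontier U" using x(2) Uf(1) by (simp add: frontier_def interior_open)
    then have xfr: "x \<in> frontier (core r)" using Uf(5) by blast
    then have xcl: "x \<in> closure (core r)" by (simp add: frontier_def)
    have "x \<notin> core r" using xfr open_core frontier_disjoint_eq by blast
    then have xret: "x \<notin> (\<Union>j. returns r j)" using closure_core[OF xcl _ r(1)] by blast
    have sub2: "ball 0 (2 * r) \<subseteq> ball (0::complex) R" using r(2) by auto
    have v2: "v \<in> ball 0 (2 * r)" using y0(3) Uf(4) by blast
    have it: "iter f n (C x) = Some (C v)" using y0(2) x(1) by simp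
    obtain \<phi> where \<phi>: "branch n \<phi>" "\<phi> v = C x"
      using branch_exists[OF it subsetD[OF sub2 v2]] by blast
    have UR: "U \<subseteq> ball 0 R" using Uf(4) sub2 by blast
    have "open (\<phi> ` U)" by (rule branch_open[OF \<phi>(1) Uf(1) UR])
    then have op: "open (C -` (\<phi> ` U))" by (rule open_vimage) (rule continuous_on_C)
    have "x \<in> C -` (\<phi> ` U)" using y0(3) \<phi>(2) by (metis imageI vimageI)
    \<comment> \<open>The pullback of \<open>U\<close> is a neighbourhood of \<open>x\<close>, which
      is a limit of core points. So the pullback meets the core, and \<open>good r\<close> becomes
      applicable.\<close>
    then obtain q where q: "q \<in> core r" "C q \<in> \<phi> ` U"
      using op xcl open_Int_closure_eq_empty[of "C -` (\<phi> ` U)" "core r"] by blast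
    have "C q \<in> \<phi> ` ball 0 (2 * r)" using q(2) Uf(4) by blast
    moreover have "C q \<in> C ` ball 0 (2 * r)" using q(1) core_bound[OF r] by blast
    ultimately have "\<phi> ` ball 0 (2 * r) \<inter> C ` ball 0 (2 * r) \<noteq> {}" by blast
    then have alt: "\<phi> 0 = C 0 \<and> \<phi> ` ball 0 (2 * r) \<subseteq> C ` ball 0 (2 * r) \<or>
        (\<exists>x. \<phi> ` ball 0 (2 * r) \<subseteq> C ` ball x (r / 2))"
      using r(3) \<phi>(1) n unfolding good_def by (metis Suc_leI One_nat_def)
    define \<gamma> where "\<gamma> w = coC (\<phi> w)" for w
    have C\<gamma>: "\<phi> w = C (\<gamma> w)" if "w \<in> ball 0 (2 * r)" for w
    proof -
      have "\<phi> w \<in> range C" using alt that by blast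
      then show ?thesis by (auto simp: \<gamma>_def)
    qed
    have \<gamma>v: "\<gamma> v = x" using \<phi>(2) by (simp add: \<gamma>_def)
    \<comment> \<open>The return times add up: \<open>n\<close> steps back to the core and
      \<open>j\<close> more to the disc.\<close>
    have \<gamma>ret: "\<gamma> w \<in> (\<Union>j. returns r j)" if w: "w \<in> core r" for w
    proof -
      have w2: "w \<in> ball 0 (2 * r)" using w core_bound[OF r] by blast
      obtain j u where ju: "u \<in> ball 0 r" "iter f j (C w) = Some (C u)"
        using w core_subset unfolding returns_def by blast
      have "iter f n (C (\<gamma> w)) = Some (C w)"
        using branchD[OF \<phi>(1) subsetD[OF sub2 w2]] C\<gamma>[OF w2] by simp
      then have "iter f (n + j) (C (\<gamma> w)) = Some (C u)" using ju(2) by (simp add: iter_add)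
      then show ?thesis using ju(1) unfolding returns_def by blast
    qed
    have cont: "continuous_on (ball 0 (2 * r)) \<gamma>"
    proof -
      have "continuous_on (ball 0 (2 * r)) (\<lambda>w. coC (\<phi> w))"
        by (rule continuous_on_compose2[OF continuous_on_coC_Compl branch_continuous[OF \<phi>(1) sub2]])
          (use C\<gamma> in auto)
      then show ?thesis by (simp add: \<gamma>_def[abs_def])
    qed
    have con\<gamma>: "connected (\<gamma> ` core r)"
      by (rule connected_continuous_image[OF continuous_on_subset[OF cont core_bound[OF r]] connected_core])
    show False
    proof (cases "\<gamma> ` core r \<inter> core r = {}")
      case False
      have "\<gamma> ` core r \<subseteq> core r" by (rule core_maximal[OF con\<gamma> _ False]) (use \<gamma>ret in blast)
      moreover have "v \<notin> outside (core r)" using y0(3) by (simp add: U_def)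
      ultimately have "\<gamma> v \<notin> outside (core r)"
        using branch_preserves_filled_core[OF r \<phi>(1) C\<gamma>] by blast
      then show False using \<gamma>v xU by (simp add: U_def)
    next
      case True
      have clR: "closure U \<subseteq> ball 0 R"
      proof -
        have "closure U \<subseteq> cball 0 (2 * r)" using Uf(4) by (intro closure_minimal) (auto intro: less_imp_le)
        then show ?thesis using r(2) by auto
      qed
      have "compact (\<phi> ` closure U)"
        by (rule compact_continuous_image[OF branch_continuous[OF \<phi>(1) clR] compU])
      then have "open (- (\<phi> ` closure U))" by (intro open_Compl compact_imp_closed)
      then have op2: "open (C -` (- (\<phi> ` closure U)))" by (rule open_vimage) (rule continuous_on_C)
      \<comment> \<open>The core avoids the pulled-back boundary of \<open>U\<close>: boundary
        points of \<open>U\<close> are limits of core points, so a common point would make the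
        pulled-back core meet the core.\<close>
      have cover: "core r \<subseteq> C -` (\<phi> ` U) \<union> C -` (- (\<phi> ` closure U))"
      proof
        fix q assume q: "q \<in> core r"
        show "q \<in> C -` (\<phi> ` U) \<union> C -` (- (\<phi> ` closure U))"
        proof (rule ccontr)
          assume "\<not> ?thesis"
          then obtain y where y: "y \<in> closure U" "C q = \<phi> y" "y \<notin> U" by blast
          then have "y \<in> frontier U" using Uf(1) by (simp add: frontier_def interior_open)
          then have ycl: "y \<in> closure (core r)" using Uf(5) by (auto simp: frontier_def)
          have "open (\<phi> -` (C ` core r) \<inter> ball 0 R)"
            using continuous_on_open_vimage[THEN iffD1, OF open_ball branch_continuous[OF \<phi>(1) order_refl]]
              open_C_image[OF open_core] by simp
          moreover have "y \<in> \<phi> -` (C ` core r) \<inter> ball 0 R"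
            using y(1) imageI[OF q, of C] clR unfolding y(2) by blast
          ultimately obtain y' where y': "y' \<in> core r" "\<phi> y' \<in> C ` core r"
            using ycl open_Int_closure_eq_empty[of "\<phi> -` (C ` core r) \<inter> ball 0 R" "core r"] by blast
          then have "\<gamma> y' \<in> core r" by (auto simp: \<gamma>_def)
          then show False using True y'(1) by blast
        qed
      qed
      have "C -` (\<phi> ` U) \<inter> core r = {} \<or> C -` (- (\<phi> ` closure U)) \<inter> core r = {}"
        by (rule connectedD[OF connected_core op op2 _ cover]) (use closure_subset in blast)
      then have "C -` (- (\<phi> ` closure U)) \<inter> core r = {}" using q by blast
      then have core\<phi>: "C ` core r \<subseteq> \<phi> ` ball 0 (2 * r)" using cover Uf(4) by blast
      have "C ` ball 0 r \<subseteq> \<phi> ` ball 0 (2 * r)" using core\<phi> ball_subset_core[OF r(1)] by blast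
      from alt show False
      proof
        assume "\<phi> 0 = C 0 \<and> \<phi> ` ball 0 (2 * r) \<subseteq> C ` ball 0 (2 * r)"
        then have "\<gamma> 0 = 0" by (simp add: \<gamma>_def)
        moreover have "0 \<in> core r" using ball_subset_core[OF r(1)] r(1) by auto
        ultimately show False using True by (metis disjoint_iff imageI)
      next
        assume "\<exists>x. \<phi> ` ball 0 (2 * r) \<subseteq> C ` ball x (r / 2)"
        then obtain x where "\<phi> ` ball 0 (2 * r) \<subseteq> C ` ball x (r / 2)" by blast
        then have "C ` ball 0 r \<subseteq> C ` ball x (r / 2)" using \<open>C ` ball 0 r \<subseteq> \<phi> ` ball 0 (2 * r)\<close> by blast
        then have "ball 0 r \<subseteq> ball x (r / 2)" by (simp add: inj_image_subset_iff inj_def)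
        then show False using r(1) norm_ge_zero[of x] by (simp add: ball_subset_ball_iff)
      qed
    qed
  qed
qed

section \<open>The nice set on the sphere and the final estimates\<close>

lemma small_nice_set:
  obtains U where "simply_connected U" "nice f U" "chart e0 c \<in> U" "U \<subseteq> C ` ball 0 R"
proof -
  \<comment> \<open>The bound 1 is arbitrary; smallness comes from \<open>2 * r < R\<close>.\<close>
  obtain r where r: "0 < r" "2 * r < R" "good r" using good_radius_exists[of 1] by auto
  define U where "U = - outside (core r)"
  note Uf = filled_core_properties[OF r, folded U_def]
  have "homeomorphism U (C ` U) C coC"
    by (rule homeomorphismI) (auto simp: continuous_on_C image_iff intro!: continuous_on_coC)
  then have "simply_connected (C ` U)"
    using Uf(2) homeomorphic_simply_connected homeomorphic_def by blast
  moreover have "nice f (C ` U)" unfolding U_def by (rule nice_filled_core[OF r])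
  moreover have "0 \<in> ball 0 r" using r(1) by simp
  then have "0 \<in> U" using Uf(3) ball_subset_core[OF r(1)] by blast
  then have "C 0 \<in> C ` U" by simp
  then have "chart e0 c \<in> C ` U" by (simp add: C_def)
  moreover have "ball 0 (2 * r) \<subseteq> ball (0::complex) R" using r(2) by auto
  then have "C ` U \<subseteq> C ` ball 0 R" using Uf(4) by blast
  ultimately show ?thesis by (rule that)
qed

end

text \<open>For a transcendental map \<open>Infty\<close> is one of the two points because
  \<open>f\<close> is undefined there; this is why its post-singular partner must be finite.\<close>

lemma two_exceptional_points:
  assumes "transcendental_meromorphic f \<or> (\<exists>d\<ge>2. rational_map_of_degree d f)"
  obtains e1 e2 where "analytic_sphere_map f" "e1 \<noteq> e2"
    "e1 \<in> postsingular_set f \<or> f e1 = None" "e2 \<in> postsingular_set f \<or> f e2 = None"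
  using assms
proof
  assume "transcendental_meromorphic f"
  then obtain g where g: "g nicely_meromorphic_on UNIV" "\<not> rational_function g" "f = meromorphic_map g"
    unfolding transcendental_meromorphic_def by blast
  obtain p where "p \<in> postsingular_set f" "p \<noteq> Infty"
    by (rule transcendental_finite_postsingular_point[OF g])
  moreover have "f Infty = None" by (simp add: g(3))
  ultimately show thesis using that[of p Infty] meromorphic_map_analytic[OF g(1)] g(3) by simp
next
  assume "\<exists>d\<ge>2. rational_map_of_degree d f"
  then obtain p q where f: "q \<noteq> 0" "coprime p q" "max (degree p) (degree q) \<ge> 2" "f = quotient_map p q"
    unfolding rational_map_of_degree_def by auto
  obtain e1 e2 where "e1 \<in> postsingular_set f" "e2 \<in> postsingular_set f" "e1 \<noteq> e2"
    by (rule rational_two_postsingular_points[OF f])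
  then show thesis using that[of e1 e2] quotient_map_analytic[OF f(1,2)] f(4) by simp
qed

theorem proposition3:
  fixes f :: sphere_map and z :: riemann_sphere
  assumes "transcendental_meromorphic f \<or> (\<exists>d\<ge>2. rational_map_of_degree d f)"
    and "z \<in> julia_set f - postsingular_set f"
  shows "\<forall>\<epsilon>>0. \<exists>U. simply_connected U \<and> nice f U \<and> z \<in> U \<and>
           diameter U < \<epsilon> \<and> set_dist U (postsingular_set f) > 0"
proof (intro allI impI)
  fix \<epsilon> :: real assume \<epsilon>: "\<epsilon> > 0"
  obtain e1 e2 where e: "analytic_sphere_map f" "e1 \<noteq> e2"
    "e1 \<in> postsingular_set f \<or> f e1 = None" "e2 \<in> postsingular_set f \<or> f e2 = None"
    by (rule two_exceptional_points[OF assms(1)])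
  interpret analytic_sphere_map f by (rule e(1))
  have "open (- postsingular_set f)" using closed_postsingular by (simp add: open_Compl)
  then obtain \<delta> where \<delta>: "\<delta> > 0" "ball z \<delta> \<subseteq> - postsingular_set f"
    using assms(2) open_contains_ball by blast
  obtain e0 where e0: "z \<noteq> e0" by (metis riemann_sphere.distinct(1))
  define c where "c = coord e0 z"
  have zc: "chart e0 c = z" using e0 by (simp add: c_def)
  \<comment> \<open>A third of \<open>\<epsilon>\<close> keeps the diameter at most
    \<open>2 * \<epsilon> / 3\<close>, and half of \<open>\<delta>\<close> leaves the distance
    \<open>\<delta>/2\<close> to the post-singular set.\<close>
  define \<rho> where "\<rho> = min (\<epsilon> / 3) (\<delta> / 2)"
  have \<rho>: "\<rho> > 0" using \<epsilon> \<delta>(1) by (simp add: \<rho>_def)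
  have "open {u. chart e0 u \<in> ball z \<rho>}" by (rule open_chart_vimage) simp
  moreover have "c \<in> {u. chart e0 u \<in> ball z \<rho>}" using \<rho> zc by simp
  ultimately obtain R where R: "R > 0" "ball c R \<subseteq> {u. chart e0 u \<in> ball z \<rho>}"
    unfolding open_contains_ball by blast
  have im: "chart e0 (c + w) \<in> ball z \<rho>" if "w \<in> ball 0 R" for w
  proof -
    have "c + w \<in> ball c R" using that by (simp add: dist_norm)
    then show ?thesis using R(2) by blast
  qed
  interpret julia_disc f e0 c R e1 e2
  proof
    have "ball z \<rho> \<subseteq> ball z \<delta>" using \<delta>(1) by (auto simp: \<rho>_def)
    then show "(\<lambda>w. chart e0 (c + w)) ` ball 0 R \<inter> postsingular_set f = {}"
      using im \<delta>(2) by blast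
    show "chart e0 c \<in> julia_set f" using assms(2) zc by simp
  qed (use R(1) e in auto)
  obtain U where U: "simply_connected U" "nice f U" "chart e0 c \<in> U" "U \<subseteq> C ` ball 0 R"
    by (rule small_nice_set)
  have Usub: "U \<subseteq> ball z \<rho>" using U(4) im unfolding C_def by blast
  have "diameter U \<le> 2 * \<rho>"
  proof -
    have "dist x y \<le> 2 * \<rho>" if "x \<in> U" "y \<in> U" for x y
    proof -
      have "dist z x < \<rho>" "dist z y < \<rho>" using Usub that by auto
      then show ?thesis using dist_triangle3[of x y z] by linarith
    qed
    then show ?thesis using U(3) unfolding diameter_def by (auto intro!: cSUP_least)
  qed
  also have "\<dots> < \<epsilon>" using \<epsilon> by (simp add: \<rho>_def)
  finally have "diameter U < \<epsilon>" .
  moreover have "ereal (\<delta> / 2) \<le> set_dist U (postsingular_set f)"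
    unfolding set_dist_def
  proof (intro INF_greatest)
    fix a b assume a: "a \<in> U" and b: "b \<in> postsingular_set f"
    have "b \<notin> ball z \<delta>" using \<delta>(2) b by blast
    then have "\<delta> \<le> dist z b" by simp
    moreover have "dist z a < \<delta> / 2" using a Usub by (auto simp: \<rho>_def)
    ultimately show "ereal (\<delta> / 2) \<le> ereal (dist a b)" using dist_triangle[of z b a] by simp
  qed
  then have "set_dist U (postsingular_set f) > 0"
    using \<delta>(1) by (metis ereal_less(2) half_gt_zero less_le_trans)
  ultimately show "\<exists>U. simply_connected U \<and> nice f U \<and> z \<in> U \<and>
           diameter U < \<epsilon> \<and> set_dist U (postsingular_set f) > 0"
    using U zc by blast
qed

end
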